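(* Let $n\geq 2$. Brin's higher-dimensional Thompson group $nV$ has a finite presentation with two generators and $2n^2+3n+13$ relations.
   Context: Let $\{0,1\}^*$ be the set of finite words over $\{0,1\}$, let $\mathfrak{C}=\{0,1\}^{\mathbb{N}}$ be the Cantor set of infinite words and $\Gamma=\mathfrak{C}^n$. For $\alpha=(\alpha_1,\dots,\alpha_n)\in(\{0,1\}^* )^n$, let $\Gamma(\alpha)=\{\alpha w: w\in\Gamma\}$, where $\alpha w$ is coordinatewise concatenation. The group $nV$ consists of all homeomorphisms $g$ of $\Gamma$ obtained as follows: given two partitions $\Gamma=\bigcup_{i=1}^k\Gamma(\alpha^{(i)})=\bigcup_{i=1}^k\Gamma(\beta^{(i)})$ into the same number of disjoint sets of this form, $g$ maps $\alpha^{(i)}w\mapsto\beta^{(i)}w$ for $1\le i\le k$ and all $w\in\Gamma$. The group operation is composition. *)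

theory Defs
  imports
    "HOL-Algebra.Bij"
    "HOL-Algebra.Generated_Groups"
    "HOL-Analysis.Function_Topology"
begin

section \<open>Free groups and group presentations\<close>

text \<open>
  A letter \<open>(x, True)\<close> stands for the generator \<open>x\<close> and \<open>(x, False)\<close> for its formal inverse.
  The free group on \<open>X\<close> is realised on the freely reduced words over \<open>X\<close>.
\<close>

fun inv_letter :: "'x \<times> bool \<Rightarrow> 'x \<times> bool" where
  "inv_letter (x, b) = (x, \<not> b)"

definition freely_reduced :: "('x \<times> bool) list \<Rightarrow> bool" where
  "freely_reduced w \<longleftrightarrow> successively (\<lambda>a b. b \<noteq> inv_letter a) w"

fun push_letter :: "'x \<times> bool \<Rightarrow> ('x \<times> bool) list \<Rightarrow> ('x \<times> bool) list" where
  "push_letter a [] = [a]"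
| "push_letter a (b # w) = (if b = inv_letter a then w else a # b # w)"

definition free_group :: "'x set \<Rightarrow> ('x \<times> bool) list monoid" where
  "free_group X =
     \<lparr>carrier = {w. set w \<subseteq> X \<times> UNIV \<and> freely_reduced w},
      mult = (\<lambda>u v. foldr push_letter u v),
      one = []\<rparr>"

definition normal_closure :: "('g, 'm) monoid_scheme \<Rightarrow> 'g set \<Rightarrow> 'g set" where
  "normal_closure G R =
     generate G (\<Union>g \<in> carrier G. (\<lambda>r. g \<otimes>\<^bsub>G\<^esub> r \<otimes>\<^bsub>G\<^esub> inv\<^bsub>G\<^esub> g) ` R)"

text \<open>
  \<open>G\<close> has the presentation \<open>\<langle>X | R\<rangle>\<close>. A relation \<open>u = v\<close> is encoded by its relator
  \<open>u v\<^sup>-\<^sup>1\<close>, an element of the free group on \<open>X\<close>.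
\<close>

definition has_presentation ::
    "('g, 'm) monoid_scheme \<Rightarrow> 'x set \<Rightarrow> ('x \<times> bool) list set \<Rightarrow> bool" where
  "has_presentation G X R \<longleftrightarrow>
     R \<subseteq> carrier (free_group X) \<and>
     free_group X Mod normal_closure (free_group X) R \<cong> G"

lemma inv_letter_inv_letter [simp]: "inv_letter (inv_letter a) = a"
  by (cases a) simp

lemma inv_letter_neq [simp]: "inv_letter a \<noteq> a" "a \<noteq> inv_letter a"
  by (cases a; simp)+

lemma freely_reduced_simps [simp]:
  "freely_reduced []"
  "freely_reduced [a]"
  "freely_reduced (a # b # w) \<longleftrightarrow> b \<noteq> inv_letter a \<and> freely_reduced (b # w)"
  by (auto simp: freely_reduced_def)

lemma freely_reduced_Cons: "freely_reduced (a # w) \<Longrightarrow> freely_reduced w"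
  by (cases w) auto

lemma freely_reduced_push: "freely_reduced w \<Longrightarrow> freely_reduced (push_letter a w)"
  by (cases w) (auto dest: freely_reduced_Cons)

lemma freely_reduced_foldr_push: "freely_reduced v \<Longrightarrow> freely_reduced (foldr push_letter u v)"
  by (induction u) (auto intro: freely_reduced_push)

lemma set_push: "set (push_letter a w) \<subseteq> insert a (set w)"
  by (cases w) auto

lemma set_foldr_push: "set (foldr push_letter u v) \<subseteq> set u \<union> set v"
  by (induction u) (use set_push in fastforce)+

lemma push_inv_push:
  "freely_reduced w \<Longrightarrow> push_letter (inv_letter a) (push_letter a w) = w"
proof (cases w)
  case (Cons b v)
  assume "freely_reduced w"
  then show ?thesis using Cons by (cases v) auto
qed auto

lemma push_push_inv:
  "freely_reduced w \<Longrightarrow> push_letter a (push_letter (inv_letter a) w) = w"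
  using push_inv_push[of w "inv_letter a"] by simp

lemma foldr_push_push:
  assumes "freely_reduced w"
  shows "foldr push_letter (push_letter a v) w = push_letter a (foldr push_letter v w)"
  using assms by (cases v) (auto simp: push_push_inv freely_reduced_foldr_push)

lemma foldr_push_assoc:
  assumes "freely_reduced w"
  shows "foldr push_letter (foldr push_letter u v) w = foldr push_letter u (foldr push_letter v w)"
  using assms by (induction u) (auto simp: foldr_push_push)

lemma foldr_push_Nil: "freely_reduced u \<Longrightarrow> foldr push_letter u [] = u"
proof (induction u)
  case (Cons a u)
  then show ?case by (cases u) (auto dest: freely_reduced_Cons)
qed simp

lemma foldr_push_inverse:
  "freely_reduced v \<Longrightarrow> foldr push_letter (rev (map inv_letter u)) (foldr push_letter u v) = v"
  by (induction u arbitrary: v) (auto simp: push_inv_push freely_reduced_foldr_push)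

lemma group_free_group: "group (free_group X)"
proof (rule groupI)
  fix u assume u: "u \<in> carrier (free_group X)"
  let ?v = "foldr push_letter (rev (map inv_letter u)) []"
  have "set (rev (map inv_letter u)) \<subseteq> X \<times> UNIV"
    using u by (fastforce simp: free_group_def)
  then have "set ?v \<subseteq> X \<times> UNIV"
    using set_foldr_push[of "rev (map inv_letter u)" "[]"] by simp
  then have v: "?v \<in> carrier (free_group X)"
    by (simp add: free_group_def freely_reduced_foldr_push)
  have "foldr push_letter ?v u = []"
    using u foldr_push_inverse[of "[]" u]
    by (simp add: foldr_push_assoc foldr_push_Nil free_group_def)
  then show "\<exists>v\<in>carrier (free_group X). v \<otimes>\<^bsub>free_group X\<^esub> u = \<one>\<^bsub>free_group X\<^esub>"
    using v by (intro bexI[of _ ?v]) (simp_all add: free_group_def)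
next
  fix u v assume "u \<in> carrier (free_group X)" "v \<in> carrier (free_group X)"
  then show "u \<otimes>\<^bsub>free_group X\<^esub> v \<in> carrier (free_group X)"
    using set_foldr_push[of u v] by (auto simp: free_group_def freely_reduced_foldr_push)
qed (auto simp: free_group_def foldr_push_assoc)

lemma normal_normal_closure:
  assumes "group G" "R \<subseteq> carrier G"
  shows "normal_closure G R \<lhd> G"
proof -
  interpret group G by fact
  show ?thesis unfolding normal_closure_def
  proof (rule normal_generateI)
    show "(\<Union>g\<in>carrier G. (\<lambda>r. g \<otimes>\<^bsub>G\<^esub> r \<otimes>\<^bsub>G\<^esub> inv\<^bsub>G\<^esub> g) ` R) \<subseteq> carrier G"
      using assms by auto
  next
    fix h g
    assume h: "h \<in> (\<Union>g\<in>carrier G. (\<lambda>r. g \<otimes>\<^bsub>G\<^esub> r \<otimes>\<^bsub>G\<^esub> inv\<^bsub>G\<^esub> g) ` R)" and g: "g \<in> carrier G"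
    then obtain a r where ar: "a \<in> carrier G" "r \<in> R"
      and h: "h = a \<otimes>\<^bsub>G\<^esub> r \<otimes>\<^bsub>G\<^esub> inv\<^bsub>G\<^esub> a" by auto
    have "r \<in> carrier G" using ar assms by auto
    then have "g \<otimes>\<^bsub>G\<^esub> h \<otimes>\<^bsub>G\<^esub> inv\<^bsub>G\<^esub> g = (g \<otimes>\<^bsub>G\<^esub> a) \<otimes>\<^bsub>G\<^esub> r \<otimes>\<^bsub>G\<^esub> inv\<^bsub>G\<^esub> (g \<otimes>\<^bsub>G\<^esub> a)"
      using ar g h by (simp add: m_assoc inv_mult_group)
    then show "g \<otimes>\<^bsub>G\<^esub> h \<otimes>\<^bsub>G\<^esub> inv\<^bsub>G\<^esub> g \<in> (\<Union>g\<in>carrier G. (\<lambda>r. g \<otimes>\<^bsub>G\<^esub> r \<otimes>\<^bsub>G\<^esub> inv\<^bsub>G\<^esub> g) ` R)"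
      using ar g by (intro UN_I[of "g \<otimes>\<^bsub>G\<^esub> a"]) auto
  qed
qed


section \<open>Brin's higher-dimensional Thompson groups\<close>

text \<open>
  Finite and infinite words over \<open>{0, 1}\<close> are represented by \<open>bool list\<close> and \<open>nat \<Rightarrow> bool\<close>.
  An \<open>n\<close>-tuple is a function on \<open>nat\<close> of which only the values at \<open>0, \<dots>, n - 1\<close> matter;
  points of \<open>Gamma n\<close> are moreover required to be \<open>undefined\<close> elsewhere.
\<close>

definition Cantor_space :: "(nat \<Rightarrow> bool) topology" where
  "Cantor_space = product_topology (\<lambda>_. discrete_topology UNIV) UNIV"

definition Gamma_top :: "nat \<Rightarrow> (nat \<Rightarrow> nat \<Rightarrow> bool) topology" where
  "Gamma_top n = product_topology (\<lambda>_. Cantor_space) {..<n}"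

definition Gamma :: "nat \<Rightarrow> (nat \<Rightarrow> nat \<Rightarrow> bool) set" where
  "Gamma n = ({..<n} \<rightarrow>\<^sub>E UNIV)"

lemma topspace_Gamma_top [simp]: "topspace (Gamma_top n) = Gamma n"
  by (simp add: Gamma_top_def Gamma_def Cantor_space_def)

definition prepend :: "bool list \<Rightarrow> (nat \<Rightarrow> bool) \<Rightarrow> nat \<Rightarrow> bool" where
  "prepend u w = (\<lambda>j. if j < length u then u ! j else w (j - length u))"

definition prepend_tuple ::
    "nat \<Rightarrow> (nat \<Rightarrow> bool list) \<Rightarrow> (nat \<Rightarrow> nat \<Rightarrow> bool) \<Rightarrow> nat \<Rightarrow> nat \<Rightarrow> bool" where
  "prepend_tuple n \<alpha> w = (\<lambda>i\<in>{..<n}. prepend (\<alpha> i) (w i))"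

definition cone :: "nat \<Rightarrow> (nat \<Rightarrow> bool list) \<Rightarrow> (nat \<Rightarrow> nat \<Rightarrow> bool) set" where
  "cone n \<alpha> = prepend_tuple n \<alpha> ` Gamma n"

definition cone_partition :: "nat \<Rightarrow> nat \<Rightarrow> (nat \<Rightarrow> nat \<Rightarrow> bool list) \<Rightarrow> bool" where
  "cone_partition n k \<alpha> \<longleftrightarrow>
     (\<Union>i<k. cone n (\<alpha> i)) = Gamma n \<and> disjoint_family_on (\<lambda>i. cone n (\<alpha> i)) {..<k}"

text \<open>
  The operation of \<open>BijGroup (Gamma n)\<close> is composition of maps (right factor applied first).
  The homeomorphism condition is implied by the prefix-replacement condition.
\<close>

definition nV :: "nat \<Rightarrow> (((nat \<Rightarrow> nat \<Rightarrow> bool) \<Rightarrow> nat \<Rightarrow> nat \<Rightarrow> bool)) monoid" where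
  "nV n = BijGroup (Gamma n)
     \<lparr>carrier := {g \<in> Bij (Gamma n).
        homeomorphic_map (Gamma_top n) (Gamma_top n) g \<and>
        (\<exists>k \<alpha> \<beta>. cone_partition n k \<alpha> \<and> cone_partition n k \<beta> \<and>
           (\<forall>i<k. \<forall>w\<in>Gamma n. g (prepend_tuple n (\<alpha> i) w) = prepend_tuple n (\<beta> i) w))}\<rparr>"

end

theory Submission
  imports Defs "HOL-Library.Multiset" "HOL-Library.Sublist"
begin

text \<open>
  A cell is a product of cylinders, one word for each coordinate, and a tiling is an ordered list of cells
  that partitions the space. The \<open>k\<close> cells \<open>0, 10, 110, \<dots>, 1\<dots>10,
  1\<dots>1\<close> of the first coordinate form the comb tiling. The chart of a tiling \<open>P\<close>
  with \<open>k\<close> cells is the element of \<open>nV\<close> that carries the cells of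
  \<open>P\<close>, in their order, to those of the comb with \<open>k\<close> cells. An element with a
  table from \<open>P\<close> to \<open>Q\<close> is \<open>(chart Q)\<^sup>-\<^sup>1 (chart P)\<close>.
  Two changes of a tiling, exchanging neighbours and halving the first cell along a coordinate
  \<open>d\<close>, change its chart by left multiplication with an element that depends on the position
  (or on \<open>d\<close>) and on the number of cells, but not on the cells themselves. Refining to
  uniform grids connects any two tilings, so these elements generate \<open>nV\<close>
  (\<open>nV_generated\<close>). All of them are words in \<open>n + 3\<close> letters: three exchanges
  and the \<open>n\<close> halvings; conjugation with the halving along coordinate 0 gives the other
  exchanges.

  Two sequences of moves that start at combs and end in the same tiling give the same element of
  \<open>nV\<close>. The list \<open>rels\<close> selects \<open>n\<^sup>2 + 4 n + 12\<close> such
  coincidences. They imply the Coxeter relations among exchanges at all positions and the commutation of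
  halvings with exchanges, by the argument that presents Thompson's group \<open>F\<close> finitely; the
  remaining ones say that two halvings can be done in either order. In every group satisfying
  \<open>rels\<close>, a diamond argument then shows that the value of a sequence of moves depends only on
  the tilings at its ends (\<open>ops_unique\<close>). A word in the letters is not a sequence of moves,
  since it also contains inverses, but it is a fraction of two of them. Forming the same fraction in a
  group with these relations and in \<open>nV\<close> at once (\<open>simultaneous_moves\<close>) shows
  that a word that is trivial in \<open>nV\<close> is trivial in the group (\<open>trivial_word\<close>),
  because a chart determines its tiling.

  By these relations \<open>nV\<close> is perfect, hence generated by the commutators of finitely many
  elements \<open>h\<^sub>0, \<dots>, h\<^sub>p\<^sub>-\<^sub>1\<close>. Let \<open>z\<close> rotate the
  \<open>N\<close> cells of a long comb and let \<open>h\<^sub>i\<close> act, as a copy, inside the union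
  of the last two cells. The product \<open>v\<close> of the conjugates of these copies by
  \<open>z\<close> to the power \<open>4\<^sup>i\<^sup>+\<^sup>1\<close> has its factors at positions with
  distinct differences, so that a commutator of two conjugates of \<open>v\<close> is the commutator of
  two copies alone (\<open>isolated_commutator\<close>). Therefore \<open>z\<close> and \<open>v\<close>
  generate the whole copy of \<open>nV\<close>, and together with the rotation this gives
  \<open>nV\<close>.

  Rewriting \<open>rels\<close> in \<open>z\<close> and \<open>v\<close> and adding the two definitions of
  \<open>z\<close> and \<open>v\<close> in terms of the letters gives a presentation with at most
  \<open>n\<^sup>2 + 4 n + 14\<close> relators, which for \<open>n \<ge> 2\<close> does not exceed
  \<open>2 n\<^sup>2 + 3 n + 13\<close>. Further words that are trivial in \<open>nV\<close> fill the list
  up to this number.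
\<close>

section \<open>Words, moves and relations\<close>

type_synonym cell = "nat \<Rightarrow> bool list"

text \<open>
  Only the first cell of a list is ever split; other cells are brought to the front by exchanges. So one
  letter for each direction is enough, whatever the length of the list.
\<close>

datatype move = Swp nat | Spl nat

fun swp :: "nat \<Rightarrow> 'a list \<Rightarrow> 'a list" where
  "swp 0 (a # b # P) = b # a # P"
| "swp (Suc i) (a # P) = a # swp i P"
| "swp i P = P"

definition half :: "cell \<Rightarrow> nat \<Rightarrow> bool \<Rightarrow> cell" where
  "half a d b = a(d := a d @ [b])"

fun run :: "move list \<Rightarrow> cell list \<Rightarrow> cell list" where
  "run [] P = P"
| "run (Swp i # ms) P = run ms (swp i P)"
| "run (Spl d # ms) (a # P) = run ms (half a d False # half a d True # P)"
| "run (Spl d # ms) [] = []"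

fun valid :: "nat \<Rightarrow> nat \<Rightarrow> move list \<Rightarrow> bool" where
  "valid n k [] \<longleftrightarrow> True"
| "valid n k (Swp i # ms) \<longleftrightarrow> Suc i < k \<and> valid n k ms"
| "valid n k (Spl d # ms) \<longleftrightarrow> d < n \<and> 0 < k \<and> valid n (Suc k) ms"

fun grow :: "move list \<Rightarrow> nat" where
  "grow [] = 0"
| "grow (Swp i # ms) = grow ms"
| "grow (Spl d # ms) = Suc (grow ms)"

type_synonym gword = "(nat \<times> bool) list"

text \<open>
  Letter 3 halves the first cell along coordinate 0, so conjugation with it shifts an exchange by one
  position. Letter 0 exchanges the first two cells, letter 1 the second and the third of at least four,
  and letter 2 the last two of three.
\<close>

fun T_word :: "nat \<Rightarrow> gword" where
  "T_word 0 = [(0, True)]"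
| "T_word (Suc i) = replicate i (3, True) @ [(1, True)] @ replicate i (3, False)"

definition S_word :: "nat \<Rightarrow> gword" where
  "S_word k = replicate (k - 1) (3, True) @ [(2, True)] @ replicate (k - 1) (3, False)"

text \<open>
  The last cell of the comb with \<open>k\<close> cells is the union of the cells from there on in every
  longer comb. Exchanges that avoid it are therefore the same element for all \<open>k\<close>, and those
  that involve it need the separate family \<open>S_word\<close>.
\<close>

definition swap_word :: "nat \<Rightarrow> nat \<Rightarrow> gword" where
  "swap_word k i = (if i + 2 < k then T_word i else S_word i)"

text \<open>
  Words act from the left, so the first move contributes the rightmost factor.
\<close>

fun word :: "nat \<Rightarrow> move list \<Rightarrow> gword" where
  "word k [] = []"
| "word k (Swp i # ms) = word k ms @ swap_word k i"
| "word k (Spl d # ms) = word (Suc k) ms @ [(3 + d, True)]"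

text \<open>
  Splits the second cell: it is brought to the front, split, and its halves go behind the former first
  cell.
\<close>

definition split1 :: "move list" where
  "split1 = [Swp 0, Spl 0, Swp 1, Swp 0]"

text \<open>
  The first seven entries are Coxeter relations near the front of the list, and near its end where the
  last cell is involved. The next eight say that exchanges further back are shifted by the split of the
  second cell and commute with the exchange of the first two cells, and two consecutive positions suffice
  to generate all later cases. The last entry starts from two different combs: on its left side the end of
  the shorter one is split into the last two cells of the longer one. The lengths decide whether an
  exchange involves the last cell.
\<close>

definition const_rels :: "(nat \<times> move list \<times> nat \<times> move list) list" where
  "const_rels =
    [(4, [Swp 0, Swp 0], 4, []),
     (4, [Swp 1, Swp 1], 4, []),
     (3, [Swp 1, Swp 1], 3, []),
     (4, [Swp 0, Swp 1, Swp 0], 4, [Swp 1, Swp 0, Swp 1]),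
     (5, [Swp 1, Swp 2, Swp 1], 5, [Swp 2, Swp 1, Swp 2]),
     (3, [Swp 1, Swp 0, Swp 1], 3, [Swp 0, Swp 1, Swp 0]),
     (4, [Swp 2, Swp 1, Swp 2], 4, [Swp 1, Swp 2, Swp 1]),
     (5, Swp 2 # split1, 5, split1 @ [Swp 3]),
     (6, Swp 3 # split1, 6, split1 @ [Swp 4]),
     (4, Swp 2 # split1, 4, split1 @ [Swp 3]),
     (5, Swp 3 # split1, 5, split1 @ [Swp 4]),
     (5, [Swp 2, Swp 0], 5, [Swp 0, Swp 2]),
     (6, [Swp 3, Swp 0], 6, [Swp 0, Swp 3]),
     (4, [Swp 2, Swp 0], 4, [Swp 0, Swp 2]),
     (5, [Swp 3, Swp 0], 5, [Swp 0, Swp 3]),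
     (3, Swp 1 # split1, 4, [Swp 1, Swp 2])]"

definition shift_rels :: "nat \<Rightarrow> (nat \<times> move list \<times> nat \<times> move list) list" where
  "shift_rels d =
    [(4, [Swp 1, Spl d], 4, [Spl d, Swp 2]),
     (5, [Swp 2, Spl d], 5, [Spl d, Swp 3]),
     (3, [Swp 1, Spl d], 3, [Spl d, Swp 2]),
     (4, [Swp 2, Spl d], 4, [Spl d, Swp 3])]"

text \<open>
  The first two cells are split along \<open>d\<close> and \<open>e\<close>, in either order.
\<close>

definition two_cells_rel :: "nat \<Rightarrow> nat \<Rightarrow> nat \<times> move list \<times> nat \<times> move list" where
  "two_cells_rel d e =
    (3, [Spl d, Swp 1, Swp 0, Spl e],
     3, [Swp 0, Spl e, Swp 1, Swp 0, Spl d, Swp 1, Swp 0, Swp 2, Swp 1])"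

text \<open>
  The first cell is quartered, by splitting it along \<open>d\<close> and its halves along
  \<open>e\<close>, or the other way round.
\<close>

definition one_cell_rel :: "nat \<Rightarrow> nat \<Rightarrow> nat \<times> move list \<times> nat \<times> move list" where
  "one_cell_rel d e =
    (3, [Spl d, Spl e, Swp 1, Swp 0, Spl e],
     3, [Spl e, Spl d, Swp 1, Swp 0, Spl d, Swp 0, Swp 1, Swp 2, Swp 1, Swp 0])"

text \<open>
  Both kinds of relations between two splits are symmetric in \<open>d\<close> and \<open>e\<close>. One
  half of the square of pairs \<open>(d, e)\<close>, with the diagonal, indexes the first kind and the
  other half indexes the second, which makes \<open>n\<^sup>2\<close> relations.
\<close>

definition rels :: "nat \<Rightarrow> (nat \<times> move list \<times> nat \<times> move list) list" where
  "rels n = const_rels @ concat (map shift_rels [1..<n]) @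
     map (\<lambda>(d, e). if d \<le> e then two_cells_rel d e else one_cell_rel e d)
       (List.product [0..<n] [0..<n])"

abbreviation inv_map :: "('a \<Rightarrow> 'a) \<Rightarrow> 'a \<Rightarrow> 'a" where
  "inv_map f \<equiv> inv_into UNIV f"

definition acts :: "(nat \<Rightarrow> 'a \<Rightarrow> 'a) \<Rightarrow> gword \<Rightarrow> 'a \<Rightarrow> 'a" where
  "acts A w = foldr (\<lambda>(l, b). if b then A l else inv_map (A l)) w"

lemma acts_append [simp]: "acts A (u @ v) x = acts A u (acts A v x)"
  by (simp add: acts_def)

lemma acts_Nil [simp]: "acts A [] x = x"
  by (simp add: acts_def)

lemma acts_Cons [simp]: "acts A ((l, b) # w) x = (if b then A l else inv_map (A l)) (acts A w x)"
  by (simp add: acts_def)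

lemma length_rels: "n \<ge> 1 \<Longrightarrow> length (rels n) = n\<^sup>2 + 4 * n + 12"
proof -
  have "length (concat (map shift_rels xs)) = 4 * length xs" for xs
    by (induction xs) (auto simp: shift_rels_def)
  then show "n \<ge> 1 \<Longrightarrow> length (rels n) = n\<^sup>2 + 4 * n + 12"
    by (simp add: rels_def const_rels_def power2_eq_square)
qed

lemma valid_append: "valid n k (ms @ ms') \<longleftrightarrow> valid n k ms \<and> valid n (k + grow ms) ms'"
  by (induction n k ms rule: valid.induct) auto

lemma grow_append [simp]: "grow (ms @ ms') = grow ms + grow ms'"
  by (induction ms rule: grow.induct) auto

lemma length_swp [simp]: "length (swp i P) = length P"
  by (induction i P rule: swp.induct) auto

lemma mset_swp [simp]: "mset (swp i P) = mset P"
  by (induction i P rule: swp.induct) auto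

lemma set_swp [simp]: "set (swp i P) = set P"
  by (metis mset_swp set_mset_mset)

lemma distinct_swp [simp]: "distinct (swp i P) = distinct P"
  by (metis mset_swp distinct_count_atmost_1 set_swp)

lemma map_swp: "map f (swp i P) = swp i (map f P)"
  by (induction i P rule: swp.induct) auto

lemma length_run: "valid n (length P) ms \<Longrightarrow> length (run ms P) = length P + grow ms"
  by (induction ms P rule: run.induct) auto

lemma run_append: "valid n (length P) ms \<Longrightarrow> run (ms @ ms') P = run ms' (run ms P)"
  by (induction ms P rule: run.induct) auto

lemma word_append: "word k (ms @ ms') = word (k + grow ms) ms' @ word k ms"
  by (induction k ms rule: word.induct) auto

section \<open>Consequences of the relations\<close>

text \<open>
  Relations are exploited in actions on a type rather than in a group: a group with these relations acts
  on itself by left multiplication, associativity becomes nested application of functions, and a product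
  of two actions is again an action.
\<close>

locale thompson_action =
  fixes n :: nat and A :: "nat \<Rightarrow> 'a \<Rightarrow> 'a"
  assumes n_pos: "n \<ge> 1"
    and bij_A: "i < n + 3 \<Longrightarrow> bij (A i)"
    and rels: "(k, ms, k', ms') \<in> set (rels n) \<Longrightarrow> acts A (word k ms) x = acts A (word k' ms') x"
begin

abbreviation "T i \<equiv> acts A (T_word i)"
abbreviation "S i \<equiv> acts A (S_word i)"
abbreviation "R d \<equiv> A (3 + d)"
abbreviation "R0 \<equiv> A 3"
abbreviation "R' \<equiv> inv_map (A 3)"
abbreviation "u k i \<equiv> acts A (swap_word k i)"
abbreviation "ops k ms \<equiv> acts A (word k ms)"

lemma R0_inv [simp]: "R0 (R' x) = x" "R' (R0 x) = x"
  using bij_A[of 3] n_pos by (simp_all add: bij_is_inj bij_is_surj surj_f_inv_f)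

lemma bij_acts: "set w \<subseteq> {..<n+3} \<times> UNIV \<Longrightarrow> bij (acts A w)"
proof (induction w)
  case Nil
  then show ?case by (simp add: acts_def id_def[symmetric])
next
  case (Cons a w)
  obtain l b where a: "a = (l, b)" by (cases a)
  have "acts A (a # w) = (if b then A l else inv_map (A l)) \<circ> acts A w"
    by (simp add: a fun_eq_iff)
  moreover have "bij (A l)" using Cons.prems a bij_A by auto
  moreover have "bij (acts A w)" using Cons by auto
  ultimately show ?case by (simp only: bij_comp bij_imp_bij_inv split: if_split) simp
qed

lemma T_Suc: "T (Suc (Suc i)) x = R0 (T (Suc i) (R' x))"
proof -
  have "replicate (Suc i) (3::nat, False) = replicate i (3, False) @ [(3, False)]"
    by (metis replicate_Suc replicate_append_same)
  then show ?thesis by simp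
qed

lemma S_Suc: "S (Suc (Suc i)) x = R0 (S (Suc i) (R' x))"
proof -
  have "replicate (Suc i) (3::nat, False) = replicate i (3, False) @ [(3, False)]"
    by (metis replicate_Suc replicate_append_same)
  then show ?thesis by (simp add: S_word_def)
qed

lemma RT: "i \<ge> 1 \<Longrightarrow> R0 (T i x) = T (Suc i) (R0 x)"
  by (cases i) (simp_all add: T_Suc del: T_word.simps)

lemma RS: "i \<ge> 1 \<Longrightarrow> R0 (S i x) = S (Suc i) (R0 x)"
  by (cases i) (simp_all add: S_Suc)

text \<open>
  \<open>X\<close> splits the second cell, as \<open>R0\<close> splits the first. It shifts exchanges
  further back in the same way, but it is itself a product of exchanges (\<open>X_eq\<close>), and this is
  what makes all later shift relations follow from finitely many.
\<close>

definition "X x = T 0 (T 1 (R0 (T 0 x)))"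

lemma const_rel: "(k, ms, k', ms') \<in> set const_rels \<Longrightarrow> ops k ms x = ops k' ms' x"
  using rels[of k ms k' ms'] by (auto simp: rels_def)

lemmas const_rels' = const_rel[unfolded const_rels_def split1_def, simplified]

lemma base_rels:
  "T 0 (T 0 x) = x" "T 1 (T 1 x) = x" "S 1 (S 1 x) = x"
  "T 0 (T 1 (T 0 x)) = T 1 (T 0 (T 1 x))"
  "T 1 (T 2 (T 1 x)) = T 2 (T 1 (T 2 x))"
  "S 1 (T 0 (S 1 x)) = T 0 (S 1 (T 0 x))"
  "S 2 (T 1 (S 2 x)) = T 1 (S 2 (T 1 x))"
  "X (T 2 x) = T 3 (X x)" "X (T 3 x) = T 4 (X x)"
  "X (S 2 x) = S 3 (X x)" "X (S 3 x) = S 4 (X x)"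
  "T 0 (T 2 x) = T 2 (T 0 x)" "T 0 (T 3 x) = T 3 (T 0 x)"
  "T 0 (S 2 x) = S 2 (T 0 x)" "T 0 (S 3 x) = S 3 (T 0 x)"
  "X (S 1 x) = S 2 (T 1 x)"
  using const_rels'[of 4 "[Swp 0, Swp 0]" 4 "[]" x]
  using const_rels'[of 4 "[Swp 1, Swp 1]" 4 "[]" x]
  using const_rels'[of 3 "[Swp 1, Swp 1]" 3 "[]" x]
  using const_rels'[of 4 "[Swp 0, Swp 1, Swp 0]" 4 "[Swp 1, Swp 0, Swp 1]" x]
  using const_rels'[of 5 "[Swp 1, Swp 2, Swp 1]" 5 "[Swp 2, Swp 1, Swp 2]" x]
  using const_rels'[of 3 "[Swp 1, Swp 0, Swp 1]" 3 "[Swp 0, Swp 1, Swp 0]" x]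
  using const_rels'[of 4 "[Swp 2, Swp 1, Swp 2]" 4 "[Swp 1, Swp 2, Swp 1]" x]
  using const_rels'[of 5 "Swp 2 # [Swp 0, Spl 0, Swp 1, Swp 0]" 5 "[Swp 0, Spl 0, Swp 1, Swp 0] @ [Swp 3]" x]
  using const_rels'[of 6 "Swp 3 # [Swp 0, Spl 0, Swp 1, Swp 0]" 6 "[Swp 0, Spl 0, Swp 1, Swp 0] @ [Swp 4]" x]
  using const_rels'[of 4 "Swp 2 # [Swp 0, Spl 0, Swp 1, Swp 0]" 4 "[Swp 0, Spl 0, Swp 1, Swp 0] @ [Swp 3]" x]
  using const_rels'[of 5 "Swp 3 # [Swp 0, Spl 0, Swp 1, Swp 0]" 5 "[Swp 0, Spl 0, Swp 1, Swp 0] @ [Swp 4]" x]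
  using const_rels'[of 5 "[Swp 2, Swp 0]" 5 "[Swp 0, Swp 2]" x]
  using const_rels'[of 6 "[Swp 3, Swp 0]" 6 "[Swp 0, Swp 3]" x]
  using const_rels'[of 4 "[Swp 2, Swp 0]" 4 "[Swp 0, Swp 2]" x]
  using const_rels'[of 5 "[Swp 3, Swp 0]" 5 "[Swp 0, Swp 3]" x]
  using const_rels'[of 3 "Swp 1 # [Swp 0, Spl 0, Swp 1, Swp 0]" 4 "[Swp 1, Swp 2]" x]
  by (simp_all add: swap_word_def X_def)

text \<open>
  \<open>R0\<close> and \<open>X\<close> shift the positions in \<open>T\<close> and in \<open>S\<close>
  in the same way, so statements about exchanges at later positions can be proved for both families at
  once.
\<close>

definition "shift_family Y \<longleftrightarrow> Y = T \<or> Y = S"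

lemma shift_family_T: "shift_family (\<lambda>i. T i)" and shift_family_S: "shift_family (\<lambda>i. S i)"
  by (simp_all add: shift_family_def)

lemma RY: "shift_family Y \<Longrightarrow> i \<ge> 1 \<Longrightarrow> R0 (Y i x) = Y (Suc i) (R0 x)"
  unfolding shift_family_def using RT RS by auto

lemma R'Y: "shift_family Y \<Longrightarrow> i \<ge> 1 \<Longrightarrow> R' (Y (Suc i) x) = Y i (R' x)"
  using RY[of Y i "R' x"] by (metis R0_inv)

lemma bij_T: "bij (T i)" and bij_S: "bij (S i)"
  by (cases i; rule bij_acts; use n_pos in \<open>auto simp: S_word_def\<close>)+

lemma bij_R0: "bij R0" using bij_A[of 3] n_pos by simp

lemma X_eq: "X x = S 2 (T 1 (S 1 x))"
  using base_rels(16)[of "S 1 x"] by (simp only: base_rels(3))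

lemma X_surj: "\<exists>y. X y = x"
  using bij_T[of 0] bij_T[of 1] bij_R0 unfolding X_def by (metis bij_pointE)

text \<open>
  \<open>X2\<close> and \<open>X3\<close> are the splits of the third and the fourth cell, in the form
  that \<open>X_eq\<close> gives for the second.
\<close>

definition "X2 x = S 3 (T 2 (S 2 x))"
definition "X3 x = S 4 (T 3 (S 3 x))"

lemma num_Suc: "Suc 1 = 2" "Suc 2 = 3" "Suc 3 = 4" by simp_all

lemma R_X: "R0 (X x) = X2 (R0 x)" "R0 (X2 x) = X3 (R0 x)"
  using RY[OF shift_family_S, of 2] RY[OF shift_family_T, of 1] RY[OF shift_family_S, of 1]
        RY[OF shift_family_S, of 3] RY[OF shift_family_T, of 2]
  by (simp_all only: X_eq X2_def X3_def num_Suc one_le_numeral order_refl)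

lemma X_X2: "X (X2 x) = X3 (X x)"
  by (simp only: X2_def X3_def base_rels)

lemma X2_surj: "\<exists>y. X2 y = x"
  using bij_T[of 2] bij_S[of 2] bij_S[of 3] unfolding X2_def by (metis bij_pointE)

text \<open>
  Induction in the style of Thompson's group \<open>F\<close>. As \<open>R0\<close> conjugates
  \<open>X\<close> to \<open>X2\<close> and \<open>X2\<close> to \<open>X3\<close>, these shift the
  exchanges for which \<open>X\<close> is already known to do so. Now \<open>X2\<close> turns position
  \<open>i - 1\<close> into \<open>i\<close>, and \<open>X X2 = X3 X\<close> carries the rule for
  \<open>X\<close> from \<open>i - 1\<close> to \<open>i\<close>.
\<close>

lemma X_Y:
  assumes Y: "shift_family Y" and "i \<ge> 2"
  shows "X (Y i x) = Y (Suc i) (X x)"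
  using \<open>i \<ge> 2\<close>
proof (induction i arbitrary: x rule: less_induct)
  case (less i)
  consider "i = 2" | "i = 3" | "i \<ge> 4" using less.prems by linarith
  then show ?case
  proof cases
    case 1
    then show ?thesis using Y base_rels by (auto simp: shift_family_def simp del: T_word.simps)
  next
    case 2
    then show ?thesis using Y base_rels by (auto simp: shift_family_def simp del: T_word.simps)
  next
    case 3
    then obtain j where j: "i = Suc (Suc j)" "j \<ge> 2" by (intro that[of "i - 2"]) auto
    (* X2 is bijective, so it suffices to check the identity after X2. *)
    obtain y where y: "x = X2 y" using X2_surj by metis
    have X2Y: "X2 (Y (Suc j) z) = Y i (X2 z)" for z
    proof -
      have "X2 (Y (Suc j) z) = X2 (R0 (Y j (R' z)))"
        using RY[OF Y, of j "R' z"] j by simp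
      also have "\<dots> = R0 (X (Y j (R' z)))" by (simp only: R_X)
      also have "\<dots> = R0 (Y (Suc j) (X (R' z)))" using less.IH[of j] j by simp
      also have "\<dots> = Y i (R0 (X (R' z)))" using RY[OF Y, of "Suc j"] j by simp
      also have "\<dots> = Y i (X2 z)" by (simp only: R_X R0_inv)
      finally show ?thesis .
    qed
    have X3Y: "X3 (Y i z) = Y (Suc i) (X3 z)" for z
    proof -
      have "X3 (Y i z) = X3 (R0 (Y (Suc j) (R' z)))"
        using RY[OF Y, of "Suc j" "R' z"] j by simp
      also have "\<dots> = R0 (X2 (Y (Suc j) (R' z)))" by (simp only: R_X)
      also have "\<dots> = R0 (Y i (X2 (R' z)))" by (simp only: X2Y)
      also have "\<dots> = Y (Suc i) (R0 (X2 (R' z)))" using RY[OF Y, of i] j by simp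
      also have "\<dots> = Y (Suc i) (X3 z)" by (simp only: R_X R0_inv)
      finally show ?thesis .
    qed
    have "X (Y i x) = X (X2 (Y (Suc j) y))" by (simp only: y X2Y)
    also have "\<dots> = X3 (X (Y (Suc j) y))" by (rule X_X2)
    also have "\<dots> = X3 (Y i (X y))" using less.IH[of "Suc j"] j by simp
    also have "\<dots> = Y (Suc i) (X x)" by (simp only: y X3Y X_X2)
    finally show ?thesis .
  qed
qed

lemma X2_Y:
  assumes Y: "shift_family Y" and "i \<ge> 3"
  shows "X2 (Y i x) = Y (Suc i) (X2 x)"
proof -
  obtain j where j: "i = Suc j" "j \<ge> 2" using \<open>i \<ge> 3\<close> by (cases i) auto
  have "X2 (Y i x) = X2 (R0 (Y j (R' x)))" using RY[OF Y, of j "R' x"] j by simp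
  also have "\<dots> = R0 (X (Y j (R' x)))" by (simp only: R_X)
  also have "\<dots> = R0 (Y i (X (R' x)))" using X_Y[OF Y, of j] j by simp
  also have "\<dots> = Y (Suc i) (R0 (X (R' x)))" using RY[OF Y, of i] j by simp
  also have "\<dots> = Y (Suc i) (X2 x)" by (simp only: R_X R0_inv)
  finally show ?thesis .
qed

lemma T0_X2: "T 0 (X2 x) = X2 (T 0 x)"
  by (simp only: X2_def base_rels)

text \<open>
  \<open>X2\<close> consists of exchanges that commute with \<open>T 0\<close>, and it turns position
  \<open>i - 1\<close> into \<open>i\<close>.
\<close>

lemma T0_Y:
  assumes Y: "shift_family Y" and "i \<ge> 2"
  shows "T 0 (Y i x) = Y i (T 0 x)"
  using \<open>i \<ge> 2\<close>
proof (induction i arbitrary: x rule: less_induct)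
  case (less i)
  consider "i = 2" | "i = 3" | "i \<ge> 4" using less.prems by linarith
  then show ?case
  proof cases
    case 3
    then obtain j where j: "i = Suc j" "j \<ge> 3" by (cases i) auto
    obtain y where y: "x = X2 y" using X2_surj by metis
    have "T 0 (Y i x) = T 0 (X2 (Y j y))" using X2_Y[OF Y, of j] j by (simp add: y del: T_word.simps)
    also have "\<dots> = X2 (T 0 (Y j y))" by (rule T0_X2)
    also have "\<dots> = X2 (Y j (T 0 y))" using less.IH[of j y] j by (simp del: T_word.simps)
    also have "\<dots> = Y i (X2 (T 0 y))" using X2_Y[OF Y, of j] j by simp
    also have "\<dots> = Y i (T 0 x)" by (simp only: y T0_X2)
    finally show ?thesis .
  qed (use Y base_rels in \<open>auto simp: shift_family_def simp del: T_word.simps\<close>)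
qed

text \<open>
  \<open>T 1\<close> is the conjugate by \<open>X\<close> of a product \<open>w\<close> of copies of
  \<open>T 0\<close> and of \<open>R0\<close> and its inverse. These move an exchange at position \<open>i
  - 1\<close> up and back again, so \<open>w\<close> commutes with it, and \<open>X\<close> carries this
  to position \<open>i\<close>.
\<close>

lemma T1_Y:
  assumes Y: "shift_family Y" and "i \<ge> 3"
  shows "T 1 (Y i x) = Y i (T 1 x)"
proof -
  obtain j where j: "i = Suc j" "j \<ge> 2" using \<open>i \<ge> 3\<close> by (cases i) auto
  (* By the braid relation of T 0 and T 1 this is the conjugate of T 1 by the inverse of X. *)
  define w where "w z = T 0 (R' (T 0 (R0 (T 0 z))))" for z
  have X_w: "X (w z) = T 1 (X z)" for z
    by (simp only: X_def w_def base_rels(1,4) R0_inv)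
  have w_Y: "w (Y j z) = Y j (w z)" for z
  proof -
    have 1: "T 0 (Y j z) = Y j (T 0 z)" for z using T0_Y[OF Y, of j] j by simp
    have 2: "R0 (Y j z) = Y i (R0 z)" for z using RY[OF Y, of j] j by simp
    have 3: "T 0 (Y i z) = Y i (T 0 z)" for z using T0_Y[OF Y, of i] j by simp
    have 4: "R' (Y i z) = Y j (R' z)" for z using R'Y[OF Y, of j] j by simp
    show ?thesis by (simp only: w_def 1 2 3 4)
  qed
  have XY: "X (Y j z) = Y i (X z)" for z using X_Y[OF Y, of j] j by simp
  obtain y where y: "x = X y" using X_surj by metis
  have "T 1 (Y i x) = T 1 (X (Y j y))" by (simp only: y XY)
  also have "\<dots> = X (w (Y j y))" by (simp only: X_w)
  also have "\<dots> = Y i (X (w y))" by (simp only: w_Y XY)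
  also have "\<dots> = Y i (T 1 x)" by (simp only: X_w y)
  finally show ?thesis .
qed

lemma T_Y:
  assumes Y: "shift_family Y" and "i + 2 \<le> j"
  shows "T i (Y j x) = Y j (T i x)"
  using \<open>i + 2 \<le> j\<close>
proof (induction i arbitrary: j x)
  case 0
  then show ?case using T0_Y[OF Y] by simp
next
  case (Suc i)
  then obtain m where m: "j = Suc m" "i + 2 \<le> m" by (cases j) auto
  show ?case
  proof (cases i)
    case 0
    then show ?thesis using T1_Y[OF Y, of j] Suc.prems by simp
  next
    case (Suc i')
    have "T (Suc i) (Y j x) = R0 (T i (R' (Y j x)))" using Suc by (simp only: T_Suc)
    also have "\<dots> = R0 (T i (Y m (R' x)))" using R'Y[OF Y, of m] m by simp
    also have "\<dots> = R0 (Y m (T i (R' x)))" using Suc.IH[of m] m by simp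
    also have "\<dots> = Y j (R0 (T i (R' x)))" using RY[OF Y, of m] m by simp
    also have "\<dots> = Y j (T (Suc i) x)" using Suc by (simp only: T_Suc)
    finally show ?thesis .
  qed
qed

lemma T_T: "T i (T i x) = x"
proof (induction i arbitrary: x)
  case (Suc i)
  show ?case
  proof (cases i)
    case 0
    then show ?thesis using base_rels(2) by simp
  next
    case (Suc j)
    then show ?thesis using Suc.IH by (simp only: T_Suc R0_inv)
  qed
qed (rule base_rels(1))

lemma S_S: "i \<ge> 1 \<Longrightarrow> S i (S i x) = x"
proof (induction i arbitrary: x)
  case (Suc i)
  show ?case
  proof (cases i)
    case 0
    then show ?thesis using base_rels(3) by simp
  next
    case (Suc j)
    then show ?thesis using Suc.IH by (simp only: S_Suc R0_inv)
  qed
qed simp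

lemma braid_T: "T i (T (Suc i) (T i x)) = T (Suc i) (T i (T (Suc i) x))"
proof (induction i arbitrary: x)
  case 0
  then show ?case using base_rels(4) by (simp del: T_word.simps)
next
  case (Suc i)
  show ?case
  proof (cases i)
    case 0
    then show ?thesis using base_rels(5) by (simp only: num_Suc One_nat_def[symmetric])
  next
    case (Suc j)
    then show ?thesis using Suc.IH by (simp only: T_Suc R0_inv)
  qed
qed

lemma braid_TS: "S (Suc i) (T i (S (Suc i) x)) = T i (S (Suc i) (T i x))"
proof (induction i arbitrary: x)
  case 0
  then show ?case using base_rels(6) by (simp del: T_word.simps)
next
  case (Suc i)
  show ?case
  proof (cases i)
    case 0
    then show ?thesis using base_rels(7) by (simp only: num_Suc One_nat_def[symmetric])
  next
    case (Suc j)
    then show ?thesis using Suc.IH by (simp only: T_Suc S_Suc R0_inv)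
  qed
qed

lemma R_shift_base:
  assumes "d < n" 
  shows "R d (T 1 x) = T 2 (R d x)" "R d (T 2 x) = T 3 (R d x)"
    "R d (S 1 x) = S 2 (R d x)" "R d (S 2 x) = S 3 (R d x)"
proof -
  have *: "ops k ms x = ops k' ms' x" if "d \<ge> 1" "(k, ms, k', ms') \<in> set (shift_rels d)" for k ms k' ms'
    using that assms by (intro rels) (auto simp: rels_def intro!: bexI[of _ d])
  show "R d (T 1 x) = T 2 (R d x)" "R d (T 2 x) = T 3 (R d x)"
    "R d (S 1 x) = S 2 (R d x)" "R d (S 2 x) = S 3 (R d x)"
    using *[of 4 "[Swp 1, Spl d]" 4 "[Spl d, Swp 2]"] *[of 5 "[Swp 2, Spl d]" 5 "[Spl d, Swp 3]"]
      *[of 3 "[Swp 1, Spl d]" 3 "[Spl d, Swp 2]"] *[of 4 "[Swp 2, Spl d]" 4 "[Spl d, Swp 3]"]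
      RT[of 1 x] RT[of 2 x] RS[of 1 x] RS[of 2 x] 
    by (cases "d = 0"; simp add: shift_rels_def swap_word_def num_Suc numeral_2_eq_2[symmetric] numeral_3_eq_3[symmetric] del: T_word.simps)+
qed

text \<open>
  Two consecutive positions are relations. They give \<open>R d X = X2 R d\<close>, and \<open>X\<close>
  and \<open>X2\<close> shift all later exchanges.
\<close>

lemma R_shift:
  assumes d: "d < n" and Y: "shift_family Y" and "i \<ge> 1"
  shows "R d (Y i x) = Y (Suc i) (R d x)"
  using \<open>i \<ge> 1\<close>
proof (induction i arbitrary: x rule: less_induct)
  case (less i)
  have RdX: "R d (X z) = X2 (R d z)" for z
    by (simp only: X_eq X2_def R_shift_base[OF d])
  consider "i = 1" | "i = 2" | "i \<ge> 3" using less.prems by linarith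
  then show ?case
  proof cases
    case 3
    then obtain j where j: "i = Suc j" "j \<ge> 2" by (cases i) auto
    obtain y where y: "x = X y" using X_surj by metis
    have XY: "X (Y j z) = Y i (X z)" for z using X_Y[OF Y, of j] j by simp
    have "R d (Y i x) = R d (X (Y j y))" by (simp only: y XY)
    also have "\<dots> = X2 (R d (Y j y))" by (rule RdX)
    also have "\<dots> = X2 (Y i (R d y))" using less.IH[of j y] j by simp
    also have "\<dots> = Y (Suc i) (X2 (R d y))" using X2_Y[OF Y, of i] j by simp
    also have "\<dots> = Y (Suc i) (R d x)" by (simp only: RdX y)
    finally show ?thesis .
  qed (use Y R_shift_base[OF d] in \<open>auto simp: shift_family_def num_Suc numeral_2_eq_2[symmetric] numeral_3_eq_3[symmetric] simp del: T_word.simps\<close>)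
qed

lemma u_u: "Suc i < k \<Longrightarrow> 3 \<le> k \<Longrightarrow> u k i (u k i x) = x"
  by (simp add: swap_word_def T_T S_S)

lemma u_far: "Suc j < k \<Longrightarrow> i + 2 \<le> j \<Longrightarrow> u k i (u k j x) = u k j (u k i x)"
  using T_Y[OF shift_family_T, of i j x] T_Y[OF shift_family_S, of i j x] by (simp add: swap_word_def)

lemma u_braid:
  "Suc (Suc i) < k \<Longrightarrow> u k i (u k (Suc i) (u k i x)) = u k (Suc i) (u k i (u k (Suc i) x))"
  using braid_T[of i x] braid_TS[of i x] by (simp add: swap_word_def del: T_word.simps)

lemma Rd_u: "d < n \<Longrightarrow> 1 \<le> i \<Longrightarrow> Suc i < k \<Longrightarrow> R d (u k i x) = u (Suc k) (Suc i) (R d x)"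
  using R_shift[OF _ shift_family_T, of d i x] R_shift[OF _ shift_family_S, of d i x] by (simp add: swap_word_def del: T_word.simps)

end

section \<open>Rearrangements\<close>

definition lift :: "move list \<Rightarrow> move list" where
  "lift = map (\<lambda>m. case m of Swp i \<Rightarrow> Swp (Suc i) | Spl d \<Rightarrow> Spl d)"

lemma lift_simps [simp]: "lift [] = []" "lift (Swp i # ms) = Swp (Suc i) # lift ms"
  by (simp_all add: lift_def)

lemma grow_lift [simp]: "grow (lift ms) = grow ms"
  by (induction ms rule: grow.induct) (auto simp: lift_def)

lemma valid_lift: "grow ms = 0 \<Longrightarrow> valid n k ms \<Longrightarrow> valid n (Suc k) (lift ms)"
  by (induction n k ms rule: valid.induct) auto

lemma run_lift: "grow ms = 0 \<Longrightarrow> run (lift ms) (a # P) = a # run ms P"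
  by (induction ms P rule: run.induct) auto

lemma mset_run: "grow ms = 0 \<Longrightarrow> mset (run ms P) = mset P"
  by (induction ms P rule: run.induct) auto

lemma push_back: "\<exists>ms. grow ms = 0 \<and> valid n (Suc (length (P @ Q))) ms \<and> run ms (a # P @ Q) = P @ a # Q"
proof (induction P)
  case Nil
  show ?case by (intro exI[of _ "[]"]) simp
next
  case (Cons b P)
  then obtain ms where "grow ms = 0" "valid n (Suc (length (P @ Q))) ms" "run ms (a # P @ Q) = P @ a # Q"
    by blast
  then show ?case
    by (intro exI[of _ "Swp 0 # lift ms"]) (use valid_lift in \<open>auto simp: run_lift\<close>)
qed

lemma rearrange:
  "mset P = mset Q \<Longrightarrow> \<exists>ms. grow ms = 0 \<and> valid n (length P) ms \<and> run ms P = Q"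
proof (induction P arbitrary: Q)
  case Nil
  show ?case by (rule exI[of _ "[]"]) (use Nil in simp)
next
  case (Cons a P)
  have "a \<in> set Q" using Cons.prems by (metis list.set_intros(1) mset_eq_setD)
  then obtain Q1 Q2 where Q: "Q = Q1 @ a # Q2" by (meson split_list)
  with Cons obtain ms where ms: "grow ms = 0" "valid n (length P) ms" "run ms P = Q1 @ Q2"
    by (metis add_mset_add_mset_same_iff mset.simps(2) mset_append union_mset_add_mset_right)
  obtain ms' where ms': "grow ms' = 0" "valid n (Suc (length (Q1 @ Q2))) ms'"
      "run ms' (a # Q1 @ Q2) = Q1 @ a # Q2"
    using push_back by blast
  have len: "length P = length (Q1 @ Q2)"
    using Cons.prems Q by (metis length_append length_Cons add_Suc_right nat.inject size_mset)
  have v: "valid n (length (a # P)) (lift ms)" using ms valid_lift by simp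
  show ?case
    by (intro exI[of _ "lift ms @ ms'"])
      (use ms ms' v len run_append[OF v, of ms'] in \<open>auto simp: run_lift valid_append Q\<close>)
qed

lemma mset_front: "a \<in> set P \<Longrightarrow> \<exists>C. mset P = mset (a # C)"
proof -
  assume "a \<in> set P"
  then obtain P1 P2 where "P = P1 @ a # P2" by (meson split_list)
  then show ?thesis by (intro exI[of _ "P1 @ P2"]) simp
qed

context thompson_action begin

text \<open>
  \<open>bub k j m\<close> moves the entry at position \<open>j\<close> back over the next
  \<open>m\<close> entries.
\<close>

fun bub :: "nat \<Rightarrow> nat \<Rightarrow> nat \<Rightarrow> 'a \<Rightarrow> 'a" where
  "bub k j 0 x = x"
| "bub k j (Suc m) x = u k (j + m) (bub k j m x)"

lemma bub_Suc: "bub k j (Suc m) x = bub k (Suc j) m (u k j x)"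
  by (induction m arbitrary: x) auto

lemma bub_above: "j + m < i \<Longrightarrow> Suc i < k \<Longrightarrow> bub k j m (u k i x) = u k i (bub k j m x)"
  by (induction m arbitrary: x) (auto simp: u_far)

lemma bub_below: "i + 2 \<le> j \<Longrightarrow> j + m < k \<Longrightarrow> bub k j m (u k i x) = u k i (bub k j m x)"
  by (induction m arbitrary: x) (auto intro: u_far[symmetric])

lemma bub_shift:
  "j \<le> i \<Longrightarrow> Suc i < j + m \<Longrightarrow> j + m < k \<Longrightarrow> bub k j m (u k (Suc i) x) = u k i (bub k j m x)"
proof (induction m arbitrary: x)
  case (Suc m)
  show ?case
  proof (cases "Suc i < j + m")
    case True
    then show ?thesis using Suc by (auto intro: u_far[symmetric])
  next
    case False
    then have i: "Suc i = j + m" using Suc by simp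
    then obtain m' where m': "m = Suc m'" "i = j + m'" using Suc by (cases m) auto
    show ?thesis
      using Suc.prems m' by (simp add: bub_above u_braid)
  qed
qed simp

text \<open>
  Moving two neighbours back over prescribed numbers of entries may be done in either order, once the
  positions are adjusted for their passing each other.
\<close>

lemma bub_bub:
  "p \<le> q \<Longrightarrow> Suc (j + q) < k \<Longrightarrow> bub k j (Suc q) (bub k (Suc j) p x) = bub k j p (bub k j (Suc q) x)"
proof (induction p arbitrary: x)
  case (Suc p)
  then show ?case using bub_shift[of j "j + p" "Suc q" k] by simp
qed simp

text \<open>
  The operator of an insertion sort that starts from the back: the entry at position \<open>j\<close>
  moves behind the later entries with smaller keys.
\<close>

fun srt :: "('b \<Rightarrow> nat) \<Rightarrow> nat \<Rightarrow> nat \<Rightarrow> 'b list \<Rightarrow> 'a \<Rightarrow> 'a" where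
  "srt key k j [] x = x"
| "srt key k j (a # Q) x = bub k j (length (filter (\<lambda>b. key b < key a) Q)) (srt key k (Suc j) Q x)"

lemma srt_below: "i + 2 \<le> j \<Longrightarrow> j + length Q \<le> k \<Longrightarrow> srt key k j Q (u k i x) = u k i (srt key k j Q x)"
proof (induction Q arbitrary: j x)
  case (Cons a Q)
  define m where "m = length (filter (\<lambda>b. key b < key a) Q)"
  have "m \<le> length Q" by (simp add: m_def)
  then have "bub k j m (u k i z) = u k i (bub k j m z)" for z
    using Cons.prems by (intro bub_below) auto
  with Cons show ?case by (simp flip: m_def)
qed simp

lemma filter_swp: "length (filter P (swp i Q)) = length (filter P Q)"
  by (metis mset_filter mset_swp size_mset)

text \<open>
  Sorting absorbs an exchange. This single step contains the uniqueness of rearrangements: along any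
  sequence of exchanges the operator \<open>srt\<close> of the current list, applied to the current point,
  is constant.
\<close>

lemma srt_swp:
  "Suc i < length P \<Longrightarrow> j + length P = k \<Longrightarrow> 3 \<le> k \<Longrightarrow> distinct (map key P) \<Longrightarrow>
    srt key k j (swp i P) (u k (j + i) x) = srt key k j P x"
proof (induction i P arbitrary: j x rule: swp.induct)
  case (1 a b Q)
  define ma where "ma = length (filter (\<lambda>c. key c < key a) Q)"
  define mb where "mb = length (filter (\<lambda>c. key c < key b) Q)"
  have m: "ma \<le> length Q" "mb \<le> length Q" by (simp_all add: ma_def mb_def)
  have mono: "ma \<le> mb" if "key a < key b"
    using that unfolding ma_def mb_def by (induction Q) auto
  have mono': "mb \<le> ma" if "key b < key a"
    using that unfolding ma_def mb_def by (induction Q) auto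
  let ?y = "srt key k (Suc (Suc j)) Q x"
  have low: "srt key k (Suc (Suc j)) Q (u k j x) = u k j ?y"
    using 1 by (intro srt_below) auto
  have uu: "u k j (u k j z) = z" for z using 1 by (intro u_u) auto
  have ne: "key a \<noteq> key b" using 1 by auto
  show ?case
  proof (cases "key a < key b")
    case True
    have "srt key k j (swp 0 (a # b # Q)) (u k (j + 0) x) = bub k j (Suc mb) (bub k (Suc j) ma (u k j ?y))"
      using True low by (simp add: ma_def mb_def)
    also have "\<dots> = bub k j ma (bub k j (Suc mb) (u k j ?y))"
      using True mono m 1 by (intro bub_bub) auto
    also have "\<dots> = bub k j ma (bub k (Suc j) mb ?y)" by (simp only: bub_Suc uu)
    finally show ?thesis using True by (simp add: ma_def mb_def)
  next
    case False
    then have lt: "key b < key a" using ne by simp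
    have "srt key k j (a # b # Q) x = bub k j (Suc ma) (bub k (Suc j) mb ?y)"
      using lt by (simp add: ma_def mb_def)
    also have "\<dots> = bub k j mb (bub k j (Suc ma) ?y)"
      using lt mono' m 1 by (intro bub_bub) auto
    also have "\<dots> = bub k j mb (bub k (Suc j) ma (u k j ?y))" by (simp only: bub_Suc)
    finally show ?thesis using False low by (simp add: ma_def mb_def)
  qed
next
  case (2 i a P)
  have "srt key k (Suc j) (swp i P) (u k (Suc j + i) x) = srt key k (Suc j) P x"
    using 2 by (intro 2) auto
  then show ?case by (simp add: filter_swp)
qed auto

lemma srt_run:
  "valid n (length P) ms \<Longrightarrow> grow ms = 0 \<Longrightarrow> 3 \<le> length P \<Longrightarrow> distinct (map key P) \<Longrightarrow>
    srt key (length P) 0 (run ms P) (ops (length P) ms x) = srt key (length P) 0 P x"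
proof (induction ms P arbitrary: x rule: run.induct)
  case (2 i ms P)
  have "distinct (map key (swp i P))" using 2 by (simp add: map_swp)
  then have "srt key (length P) 0 (run (Swp i # ms) P) (ops (length P) (Swp i # ms) x)
     = srt key (length P) 0 (swp i P) (u (length P) i x)"
    using 2 by simp
  also have "\<dots> = srt key (length P) 0 P x" using 2 srt_swp[of i P 0] by simp
  finally show ?case .
qed auto

lemma bij_u: "3 \<le> k \<Longrightarrow> bij (u k i)"
  by (auto simp: swap_word_def bij_T bij_S simp del: acts_append)

lemma inj_bub: "3 \<le> k \<Longrightarrow> bub k j m x = bub k j m y \<Longrightarrow> x = y"
proof (induction m arbitrary: x y)
  case (Suc m)
  then show ?case using bij_u[of k "j + m"] by (auto simp: bij_is_inj[THEN inj_eq])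
qed simp

lemma inj_srt: "3 \<le> k \<Longrightarrow> srt key k j P x = srt key k j P y \<Longrightarrow> x = y"
proof (induction P arbitrary: j x y)
  case (Cons a P)
  from Cons.prems have "srt key k (Suc j) P x = srt key k (Suc j) P y"
    by (auto dest: inj_bub)
  with Cons show ?case by blast
qed simp

lemma rearrangement_unique:
  assumes "distinct P" "3 \<le> length P" "valid n (length P) ms" "valid n (length P) ms'"
    and "grow ms = 0" "grow ms' = 0" "run ms P = run ms' P"
  shows "ops (length P) ms x = ops (length P) ms' x"
proof -
  obtain key :: "cell \<Rightarrow> nat" where key: "inj_on key (set P)"
    using finite_imp_inj_to_nat_seg[of "set P"] by auto
  then have "distinct (map key P)" using assms by (simp add: distinct_map)
  then show ?thesis
    using assms srt_run[of P ms key x] srt_run[of P ms' key x] inj_srt by metis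
qed

text \<open>
  Exchanges that leave the first cell in place may be done before or after splitting it.
\<close>

lemma ops_lift:
  "d < n \<Longrightarrow> grow ms = 0 \<Longrightarrow> valid n k ms \<Longrightarrow>
    ops (Suc (Suc k)) (lift (lift ms)) (R d x) = R d (ops (Suc k) (lift ms) x)"
proof (induction ms arbitrary: x rule: grow.induct)
  case (2 i ms)
  then show ?case by (simp add: Rd_u[symmetric])
qed auto

end

section \<open>Disjoint cells and grids\<close>

definition incomp :: "bool list \<Rightarrow> bool list \<Rightarrow> bool" where
  "incomp u v \<longleftrightarrow> (\<exists>j. j < length u \<and> j < length v \<and> u ! j \<noteq> v ! j)"

definition cell_disj :: "nat \<Rightarrow> cell \<Rightarrow> cell \<Rightarrow> bool" where
  "cell_disj n a b \<longleftrightarrow> (\<exists>d<n. incomp (a d) (b d))"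

text \<open>
  Coordinates from \<open>n\<close> on do not affect the cone of a cell. Requiring them to be empty makes
  cells with the same prefix map equal.
\<close>

definition wf_cell :: "nat \<Rightarrow> cell \<Rightarrow> bool" where
  "wf_cell n a \<longleftrightarrow> (\<forall>d\<ge>n. a d = [])"

text \<open>
  Disjointness is symmetric and irreflexive, so being sorted with respect to it means being pairwise
  disjoint, and entails that no cell occurs twice.
\<close>

definition disjoint_cells :: "nat \<Rightarrow> cell list \<Rightarrow> bool" where
  "disjoint_cells n P \<longleftrightarrow> sorted_wrt (cell_disj n) P \<and> (\<forall>a\<in>set P. wf_cell n a)"

lemma cell_disj_sym: "cell_disj n a b \<Longrightarrow> cell_disj n b a"
  unfolding cell_disj_def incomp_def by metis

lemma cell_disj_irrefl: "\<not> cell_disj n a a"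
  by (auto simp: cell_disj_def incomp_def)

lemma cell_disj_half: "cell_disj n a b \<Longrightarrow> cell_disj n (half a d v) b"
  unfolding cell_disj_def incomp_def half_def by (force simp: nth_append)

lemma cell_disj_half_half: "d < n \<Longrightarrow> cell_disj n (half a d False) (half a d True)"
  unfolding cell_disj_def incomp_def half_def by (rule exI[of _ d]) (auto intro!: exI[of _ "length (a d)"])

lemma wf_cell_half: "d < n \<Longrightarrow> wf_cell n a \<Longrightarrow> wf_cell n (half a d v)"
  by (auto simp: wf_cell_def half_def)

lemma sorted_wrt_swp: "sorted_wrt (cell_disj n) P \<Longrightarrow> sorted_wrt (cell_disj n) (swp i P)"
  by (induction i P rule: swp.induct) (auto intro: cell_disj_sym)

lemma disjoint_cells_distinct: "disjoint_cells n P \<Longrightarrow> distinct P"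
  unfolding disjoint_cells_def by (induction P) (auto simp: cell_disj_irrefl)

lemma disjoint_cells_swp: "disjoint_cells n P \<Longrightarrow> disjoint_cells n (swp i P)"
  by (auto simp: disjoint_cells_def sorted_wrt_swp)

lemma disjoint_cells_half:
  assumes "disjoint_cells n (a # P)" "d < n" shows "disjoint_cells n (half a d False # half a d True # P)"
  using assms by (auto simp: disjoint_cells_def cell_disj_half cell_disj_half_half wf_cell_half)

lemma disjoint_cells_run: "disjoint_cells n P \<Longrightarrow> valid n (length P) ms \<Longrightarrow> disjoint_cells n (run ms P)"
  by (induction ms P rule: run.induct) (auto simp: disjoint_cells_swp disjoint_cells_half)

lemma disjoint_cells_mset: "disjoint_cells n P \<Longrightarrow> mset P = mset Q \<Longrightarrow> disjoint_cells n Q"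
  using rearrange[of P Q] disjoint_cells_run by metis

definition at_depth :: "nat \<Rightarrow> nat \<Rightarrow> cell list \<Rightarrow> bool" where
  "at_depth n M P \<longleftrightarrow> (\<forall>a\<in>set P. \<forall>d<n. length (a d) = M)"

definition within_depth :: "nat \<Rightarrow> nat \<Rightarrow> cell list \<Rightarrow> bool" where
  "within_depth n M P \<longleftrightarrow> (\<forall>a\<in>set P. \<forall>d<n. length (a d) \<le> M)"

text \<open>
  The cells of depth \<open>M\<close> in all coordinates that lie in some cell of \<open>P\<close>. As
  long as no cell becomes deeper than \<open>M\<close>, this set is invariant under moves, and a list at
  depth \<open>M\<close> enumerates it.
\<close>

definition grid :: "nat \<Rightarrow> nat \<Rightarrow> cell list \<Rightarrow> cell set" where
  "grid n M P = {c. wf_cell n c \<and> (\<forall>d<n. length (c d) = M) \<and> (\<exists>a\<in>set P. \<forall>d. prefix (a d) (c d))}"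

lemma run_refines:
  "valid n (length P) ms \<Longrightarrow> a \<in> set P \<Longrightarrow> \<exists>c\<in>set (run ms P). \<forall>d. prefix (a d) (c d)"
proof (induction ms P arbitrary: a rule: run.induct)
  case (3 d ms b P)
  show ?case
  proof (cases "a = b")
    case True
    have "\<exists>c\<in>set (run (Spl d # ms) (b # P)). \<forall>e. prefix (half b d False e) (c e)"
      using 3 by auto
    then obtain c where c: "c\<in>set (run (Spl d # ms) (b # P))" "\<forall>e. prefix (half b d False e) (c e)" by blast
    have "prefix (a e) (half b d False e)" for e using True by (simp add: half_def)
    then show ?thesis using c prefix_order.trans by metis
  next
    case False
    then show ?thesis using 3 by auto
  qed
qed auto

lemma within_depth_if_run_within_depth: "valid n (length P) ms \<Longrightarrow> within_depth n M (run ms P) \<Longrightarrow> within_depth n M P"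
  unfolding within_depth_def by (metis run_refines prefix_length_le order_trans)

lemma within_depth_if_at_depth: "at_depth n M P \<Longrightarrow> within_depth n M P"
  by (auto simp: at_depth_def within_depth_def)

lemma prefix_snoc_cases:
  assumes "prefix u v" "length u < length v" shows "prefix (u @ [False]) v \<or> prefix (u @ [True]) v"
proof -
  obtain x w where "v = u @ x # w" using assms
    by (metis append.right_neutral less_irrefl neq_Nil_conv prefixE)
  then show ?thesis by (cases x) (auto simp: prefix_def)
qed

lemma grid_half:
  assumes "d < n" "length (a d) < M"
  shows "grid n M (half a d False # half a d True # P) = grid n M (a # P)"
proof -
  have "(\<forall>e. prefix (a e) (c e)) \<longleftrightarrow>
      (\<forall>e. prefix (half a d False e) (c e)) \<or> (\<forall>e. prefix (half a d True e) (c e))"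
    if "length (c d) = M" for c :: cell
  proof
    assume *: "\<forall>e. prefix (a e) (c e)"
    then have "prefix (a d @ [False]) (c d) \<or> prefix (a d @ [True]) (c d)"
      using prefix_snoc_cases assms that by auto
    then show "(\<forall>e. prefix (half a d False e) (c e)) \<or> (\<forall>e. prefix (half a d True e) (c e))"
      using * by (auto simp: half_def)
  next
    have "prefix (a e) (half a d v e)" for v e by (simp add: half_def)
    then show "(\<forall>e. prefix (half a d False e) (c e)) \<or> (\<forall>e. prefix (half a d True e) (c e)) \<Longrightarrow>
       \<forall>e. prefix (a e) (c e)"
      using prefix_order.trans by metis
  qed
  then show ?thesis using assms by (auto simp: grid_def)
qed

lemma grid_swp [simp]: "grid n M (swp i P) = grid n M P"
  by (simp add: grid_def)

lemma grid_run: "valid n (length P) ms \<Longrightarrow> within_depth n M (run ms P) \<Longrightarrow> grid n M (run ms P) = grid n M P"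
proof (induction ms P rule: run.induct)
  case (3 d ms a P)
  have "within_depth n M (half a d False # half a d True # P)"
    using 3 within_depth_if_run_within_depth[of n "half a d False # half a d True # P" ms] by simp
  then have "length (a d) < M" using 3 by (force simp: within_depth_def half_def)
  then show ?case using 3 by (simp add: grid_half)
qed auto

lemma grid_at_depth:
  assumes "at_depth n M P" "disjoint_cells n P" shows "grid n M P = set P"
proof -
  have "c = a" if c: "a \<in> set P" "\<forall>d<n. length (c d) = M" "wf_cell n c" "\<forall>d. prefix (a d) (c d)" for a c
  proof
    fix d
    show "c d = a d"
    proof (cases "d < n")
      case True
      then have "length (a d) = length (c d)" using c assms by (auto simp: at_depth_def)
      moreover obtain z where "c d = a d @ z" using c(4) by (meson prefixE)
      ultimately show ?thesis by simp
    next
      case False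
      then show ?thesis using c assms by (auto simp: wf_cell_def disjoint_cells_def)
    qed
  qed
  then show ?thesis using assms by (auto simp: grid_def at_depth_def disjoint_cells_def)
qed

definition weight :: "nat \<Rightarrow> nat \<Rightarrow> cell \<Rightarrow> nat" where
  "weight n M a = (\<Sum>d<n. M - length (a d))"

lemma weight_half:
  assumes "d < n" "length (a d) < M" shows "Suc (weight n M (half a d v)) = weight n M a"
proof -
  have "weight n M a = (M - length (a d)) + (\<Sum>e\<in>{..<n} - {d}. M - length (a e))"
    unfolding weight_def using assms by (intro sum.remove) auto
  moreover have "weight n M (half a d v) = (M - length (half a d v d)) + (\<Sum>e\<in>{..<n} - {d}. M - length (half a d v e))"
    unfolding weight_def using assms by (intro sum.remove) auto
  moreover have "(\<Sum>e\<in>{..<n} - {d}. M - length (half a d v e)) = (\<Sum>e\<in>{..<n} - {d}. M - length (a e))"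
    by (intro sum.cong) (auto simp: half_def)
  ultimately show ?thesis using assms by (simp add: half_def)
qed

text \<open>
  A cell of weight \<open>w\<close> needs \<open>2\<^sup>w - 1\<close> splits until all its parts have
  depth \<open>M\<close>. The sum of these numbers decreases with each split.
\<close>

lemma run_to_at_depth:
  assumes "within_depth n M P"
  shows "\<exists>ms. valid n (length P) ms \<and> at_depth n M (run ms P)"
  using assms
proof (induction "\<Sum>a\<leftarrow>P. 2 ^ weight n M a - (1::nat)" arbitrary: P rule: less_induct)
  case less
  show ?case
  proof (cases "at_depth n M P")
    case True
    then show ?thesis by (intro exI[of _ "[]"]) simp
  next
    case False
    then obtain a d where a: "a \<in> set P" "d < n" "length (a d) < M"
      using less.prems by (auto simp: at_depth_def within_depth_def) (metis le_neq_implies_less)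
    then obtain P1 P2 where P: "P = P1 @ a # P2" by (meson split_list)
    then have "mset P = mset (a # P1 @ P2)" by simp
    then obtain ms where ms: "grow ms = 0" "valid n (length P) ms" "run ms P = a # P1 @ P2"
      using rearrange by blast
    let ?Q = "half a d False # half a d True # P1 @ P2"
    obtain w where w: "weight n M a = Suc w" "weight n M (half a d v) = w" for v
      using weight_half[of d n a M] a by (metis Suc_inject)
    have "(\<Sum>a\<leftarrow>?Q. 2 ^ weight n M a - (1::nat)) < (\<Sum>a\<leftarrow>P. 2 ^ weight n M a - 1)"
    proof -
      have "(p - 1) + (p - 1) < 2 * p - (1::nat)" if "p \<ge> 1" for p using that by linarith
      from this[of "2 ^ w"] have "(2 ^ w - 1) + (2 ^ w - 1) < 2 ^ Suc w - (1::nat)" by simp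
      then show ?thesis using w by (simp add: P)
    qed
    moreover have "within_depth n M ?Q"
      using less.prems a by (auto simp: within_depth_def P half_def)
    ultimately obtain ms' where ms': "valid n (length ?Q) ms'" "at_depth n M (run ms' ?Q)"
      using less.hyps by blast
    have "run (ms @ Spl d # ms') P = run ms' ?Q" using ms run_append by simp
    moreover have "valid n (length P) (ms @ Spl d # ms')"
      using ms ms' a by (simp add: valid_append P)
    ultimately show ?thesis using ms' by metis
  qed
qed

lemma set_eq_mset_eq: "distinct P \<Longrightarrow> distinct Q \<Longrightarrow> set P = set Q \<Longrightarrow> mset P = mset Q"
  by (simp add: set_eq_iff_mset_eq_distinct)

lemma run_to_grid:
  assumes "disjoint_cells n P" "within_depth n M P" "disjoint_cells n Q" "at_depth n M Q" "set Q = grid n M P"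
  shows "\<exists>ms. valid n (length P) ms \<and> run ms P = Q"
proof -
  obtain ms where ms: "valid n (length P) ms" "at_depth n M (run ms P)"
    using run_to_at_depth assms by blast
  have c: "disjoint_cells n (run ms P)" using disjoint_cells_run assms ms by blast
  have "set (run ms P) = set Q"
    using grid_at_depth[OF ms(2) c] grid_run[OF ms(1) within_depth_if_at_depth[OF ms(2)]] assms by simp
  then have "mset (run ms P) = mset Q"
    using disjoint_cells_distinct c assms set_eq_mset_eq by blast
  then obtain ms' where "grow ms' = 0" "valid n (length (run ms P)) ms'" "run ms' (run ms P) = Q"
    using rearrange by blast
  then show ?thesis
    using ms by (intro exI[of _ "ms @ ms'"]) (auto simp: valid_append run_append length_run)
qed

lemma ex_within_depth: "\<exists>M0. \<forall>M\<ge>M0. within_depth n M P"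
proof -
  let ?L = "(\<lambda>(a, d). length (a d)) ` (set P \<times> {..<n})"
  have "finite ?L" by simp
  then have "\<forall>x\<in>?L. x \<le> Max (insert 0 ?L)" by simp
  then show ?thesis unfolding within_depth_def
    by (intro exI[of _ "Max (insert 0 ?L)"]) (fastforce intro: order_trans)
qed

section \<open>Uniqueness\<close>

lemma half_comm: "d \<noteq> e \<Longrightarrow> half (half a d v) e w = half (half a e w) d v"
  by (auto simp: half_def fun_eq_iff)

lemma first_split:
  "0 < grow ms \<Longrightarrow> \<exists>ps d ms'. ms = ps @ Spl d # ms' \<and> grow ps = 0"
proof (induction ms rule: grow.induct)
  case (2 i ms)
  then obtain ps d ms' where "ms = ps @ Spl d # ms'" "grow ps = 0" by auto
  then show ?case by (intro exI[of _ "Swp i # ps"] exI) auto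
next
  case (3 d ms)
  show ?case by (intro exI[of _ "[]"] exI) auto
qed auto

context thompson_action begin

lemma bij_ops: "valid n k ms \<Longrightarrow> 3 \<le> k \<Longrightarrow> bij (ops k ms)"
proof (induction ms arbitrary: k rule: grow.induct)
  case 1
  then show ?case by (intro bijI') auto
next
  case (2 i ms)
  then have "bij (ops k ms \<circ> u k i)" by (intro bij_comp bij_u) auto
  moreover have "ops k (Swp i # ms) = ops k ms \<circ> u k i" by (simp add: fun_eq_iff)
  ultimately show ?case by (simp only:)
next
  case (3 d ms)
  then have "bij (ops (Suc k) ms \<circ> R d)" by (intro bij_comp bij_A) auto
  moreover have "ops k (Spl d # ms) = ops (Suc k) ms \<circ> R d" by (simp add: fun_eq_iff)
  ultimately show ?case by (simp only:)
qed

lemma ops_append: "ops k (ms @ ms') x = ops (k + grow ms) ms' (ops k ms x)"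
  by (simp add: word_append)

text \<open>
  The relation is imposed for \<open>d \<le> e\<close>. For \<open>d > e\<close> it is the relation for
  \<open>(e, d)\<close>, read after an initial exchange of the two cells and solved for the other side.
\<close>

lemma two_cells:
  assumes "d < n" "e < n"
  shows "R e (T 0 (T 1 (R d x))) = T 1 (T 2 (T 0 (T 1 (R d (T 0 (T 1 (R e (T 0 x))))))))"
proof -
  have *: "R e (T 0 (T 1 (R d x))) = T 1 (T 2 (T 0 (T 1 (R d (T 0 (T 1 (R e (T 0 x))))))))"
    if "d \<le> e" "d < n" "e < n" for d e x
  proof -
    have "two_cells_rel d e \<in> set (rels n)"
      using that by (force simp: rels_def)
    then have "ops 3 [Spl d, Swp 1, Swp 0, Spl e] x =
      ops 3 [Swp 0, Spl e, Swp 1, Swp 0, Spl d, Swp 1, Swp 0, Swp 2, Swp 1] x"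
      unfolding two_cells_rel_def by (rule rels)
    then show ?thesis by (simp add: swap_word_def del: T_word.simps)
  qed
  show ?thesis
  proof (cases "d \<le> e")
    case True
    then show ?thesis using * assms by simp
  next
    case False
    then have "R d (T 0 (T 1 (R e (T 0 x)))) = T 1 (T 2 (T 0 (T 1 (R e (T 0 (T 1 (R d (T 0 (T 0 x)))))))))"
      using assms by (intro *) auto
    then show ?thesis
      using T_Y[OF shift_family_T, of 0 2] by (simp only: T_T add_0 order_refl)
  qed
qed

lemma one_cell:
  assumes "d < n" "e < n" "d \<noteq> e"
  shows "R e (T 0 (T 1 (R e (R d x)))) = T 0 (T 1 (T 2 (T 1 (T 0 (R d (T 0 (T 1 (R d (R e x)))))))))"
proof -
  have *: "R e (T 0 (T 1 (R e (R d x)))) = T 0 (T 1 (T 2 (T 1 (T 0 (R d (T 0 (T 1 (R d (R e x)))))))))"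
    if "d < e" "d < n" "e < n" for d e x
  proof -
    have "one_cell_rel d e \<in> set (rels n)"
      using that by (auto simp: rels_def intro!: image_eqI[of _ _ "(e, d)"])
    then have "ops 3 [Spl d, Spl e, Swp 1, Swp 0, Spl e] x =
      ops 3 [Spl e, Spl d, Swp 1, Swp 0, Spl d, Swp 0, Swp 1, Swp 2, Swp 1, Swp 0] x"
      unfolding one_cell_rel_def by (rule rels)
    then show ?thesis by (simp add: swap_word_def del: T_word.simps)
  qed
  show ?thesis
  proof (cases "d < e")
    case True
    then show ?thesis using * assms by simp
  next
    case False
    then have "R d (T 0 (T 1 (R d (R e x)))) = T 0 (T 1 (T 2 (T 1 (T 0 (R e (T 0 (T 1 (R e (R d x)))))))))"
      using assms by (intro *) auto
    then show ?thesis by (simp only: T_T)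
  qed
qed

text \<open>
  Before its first split a path only permutes the cells, and the split acts on the cell \<open>a\<close>
  that has arrived at the front. As rearrangements are unique, every other way of bringing
  \<open>a\<close> to the front serves as well: the order of the remaining cells can be corrected after
  the split.
\<close>

lemma first_split_arrangement:
  assumes P: "disjoint_cells n P" "3 \<le> length P" and ms: "valid n (length P) ms" "0 < grow ms"
  obtains a d where "a \<in> set P" "d < n"
    "\<And>B ps. grow ps = 0 \<Longrightarrow> valid n (length P) ps \<Longrightarrow> run ps P = a # B \<Longrightarrow>
      \<exists>ms'. valid n (Suc (length P)) ms' \<and> run ms' (half a d False # half a d True # B) = run ms P \<and>
        grow ms = Suc (grow ms') \<and> (\<forall>x. ops (length P) ms x = ops (Suc (length P)) ms' (R d (ops (length P) ps x)))"
proof -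
  obtain qs d ms0 where ms0: "ms = qs @ Spl d # ms0" "grow qs = 0"
    using first_split[OF ms(2)] by blast
  have qs: "valid n (length P) qs" "d < n" "valid n (Suc (length P)) ms0"
    using ms ms0 by (auto simp: valid_append)
  have "run qs P \<noteq> []" using P length_run[OF qs(1)] by auto
  then obtain a C where C: "run qs P = a # C" by (cases "run qs P") auto
  have ms_run: "run ms P = run ms0 (half a d False # half a d True # C)"
    using ms0 qs C by (simp add: run_append)
  have "a \<in> set P" using C ms0 mset_run[of qs P] by (metis list.set_intros(1) set_mset_mset)
  moreover have "\<exists>ms'. valid n (Suc (length P)) ms' \<and> run ms' (half a d False # half a d True # B) = run ms P \<and>
        grow ms = Suc (grow ms') \<and> (\<forall>x. ops (length P) ms x = ops (Suc (length P)) ms' (R d (ops (length P) ps x)))"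
    if ps: "grow ps = 0" "valid n (length P) ps" "run ps P = a # B" for B ps
  proof -
    have "mset (a # B) = mset (a # C)" using ps C ms0 mset_run by metis
    then have "mset B = mset C" by simp
    then obtain rs where rs: "grow rs = 0" "valid n (length B) rs" "run rs B = C"
      using rearrange by blast
    have lenB: "length P = Suc (length B)" using ps length_run[OF ps(2)] by simp
    let ?ms' = "lift (lift rs) @ ms0"
    have v1: "valid n (length P) (lift rs)" and v2: "valid n (Suc (length P)) (lift (lift rs))"
      using rs valid_lift lenB by auto
    have "run (ps @ lift rs) P = run qs P"
      using ps rs C by (simp add: run_append run_lift)
    then have eq: "ops (length P) (ps @ lift rs) x = ops (length P) qs x" for x
      using P ps rs qs ms0 v1 disjoint_cells_distinct by (intro rearrangement_unique) (auto simp: valid_append)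
    have "ops (length P) ms x = ops (Suc (length P)) ?ms' (R d (ops (length P) ps x))" for x
    proof -
      have "ops (length P) ms x = ops (Suc (length P)) ms0 (R d (ops (length P) qs x))"
        by (simp add: ms0 ops_append del: word.simps) simp
      also have "\<dots> = ops (Suc (length P)) ms0 (R d (ops (length P) (lift rs) (ops (length P) ps x)))"
        by (simp add: eq[symmetric] ops_append ps)
      also have "\<dots> = ops (Suc (length P)) ms0 (ops (Suc (length P)) (lift (lift rs)) (R d (ops (length P) ps x)))"
        using ops_lift[OF qs(2) rs(1,2)] by (simp add: lenB)
      also have "\<dots> = ops (Suc (length P)) ?ms' (R d (ops (length P) ps x))"
        by (simp add: ops_append rs)
      finally show ?thesis .
    qed
    moreover have "run ?ms' (half a d False # half a d True # B) = run ms P"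
      using run_append[of n "half a d False # half a d True # B" "lift (lift rs)" ms0] v2 rs lenB
      by (simp add: run_lift ms_run)
    ultimately show ?thesis
      using v2 rs qs ms0 by (intro exI[of _ ?ms']) (auto simp: valid_append)
  qed
  ultimately show ?thesis using that qs by blast
qed

text \<open>
  A diamond argument, by induction on the number of splits. Suppose the paths begin by splitting
  \<open>a\<close> along \<open>d\<close> and \<open>b\<close> along \<open>e\<close>. If these splits
  differ, a relation between two splits provides a list \<open>Y\<close> in which both have been done. It
  is here that the common target is a uniform grid: \<open>Y\<close> is obtained by moves and not deeper
  than the grid, so some path \<open>w\<close> leads from \<open>Y\<close> to the target. The induction
  hypothesis, applied after the first split, compares each of the given paths with the one through
  \<open>Y\<close>.
\<close>

lemma ops_unique_at_depth:
  assumes "disjoint_cells n P" "3 \<le> length P" "valid n (length P) ms" "valid n (length P) ms'"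
    and "run ms P = run ms' P" "at_depth n M (run ms P)"
  shows "ops (length P) ms x = ops (length P) ms' x"
  using assms
proof (induction "grow ms" arbitrary: P ms ms' x rule: less_induct)
  case less
  note P = less.prems(1,2) and v = less.prems(3,4) and eq = less.prems(5) and at_depth = less.prems(6)
  have g: "grow ms = grow ms'"
    using length_run[OF v(1)] length_run[OF v(2)] eq by simp
  show ?case
  proof (cases "grow ms = 0")
    case True
    then show ?thesis using P v eq g disjoint_cells_distinct by (intro rearrangement_unique) auto
  next
    case False
    let ?k = "length P"
    let ?Q = "run ms P"
    have Pne: "P \<noteq> []" using P(2) by auto
    have cQ: "disjoint_cells n ?Q" and gQ: "set ?Q = grid n M P"
      using disjoint_cells_run[OF P(1) v(1)] grid_at_depth[OF at_depth] grid_run[OF v(1) within_depth_if_at_depth[OF at_depth]] by auto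
    (* Every intermediate list that is not too deep can be continued to the target grid. *)
    have complete: "\<exists>w. valid n (length Y) w \<and> run w Y = ?Q"
      if "valid n (length P) ys" "run ys P = Y" "within_depth n M Y" for ys Y
      using that run_to_grid[of n Y M ?Q] disjoint_cells_run[OF P(1)] grid_run cQ gQ at_depth by blast
    obtain a d where a: "a \<in> set P" "d < n" and
      A: "\<And>B ps. grow ps = 0 \<Longrightarrow> valid n ?k ps \<Longrightarrow> run ps P = a # B \<Longrightarrow>
        \<exists>ms1. valid n (Suc ?k) ms1 \<and> run ms1 (half a d False # half a d True # B) = ?Q \<and>
        grow ms = Suc (grow ms1) \<and> (\<forall>x. ops ?k ms x = ops (Suc ?k) ms1 (R d (ops ?k ps x)))"
      using first_split_arrangement[OF P v(1)] False by blast
    obtain b e where b: "b \<in> set P" "e < n" and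
      B: "\<And>B ps. grow ps = 0 \<Longrightarrow> valid n ?k ps \<Longrightarrow> run ps P = b # B \<Longrightarrow>
        \<exists>ms1. valid n (Suc ?k) ms1 \<and> run ms1 (half b e False # half b e True # B) = run ms' P \<and>
        grow ms' = Suc (grow ms1) \<and> (\<forall>x. ops ?k ms' x = ops (Suc ?k) ms1 (R e (ops ?k ps x)))"
      using first_split_arrangement[OF P v(2)] False g by auto
    have bring: "\<exists>ps. grow ps = 0 \<and> valid n ?k ps \<and> run ps P = D" if "mset P = mset D" for D
      using rearrange[OF that] by blast
    have IH: "ops (Suc ?k) m1 z = ops (Suc ?k) m2 z"
      if "disjoint_cells n Y" "length Y = Suc ?k" "valid n (Suc ?k) m1" "valid n (Suc ?k) m2"
        "run m1 Y = ?Q" "run m2 Y = ?Q" for m1 m2 Y z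
    proof -
      have "grow m1 < grow ms"
        using length_run[of n Y m1] length_run[OF v(1)] that by simp
      then show ?thesis using less.hyps[of m1 Y m2 z] that at_depth P by simp
    qed
    show ?thesis
    proof (cases "a = b")
      case True
      obtain C where C: "mset P = mset (a # C)"
        using a mset_front by metis
      obtain ps where ps: "grow ps = 0" "valid n ?k ps" "run ps P = a # C"
        using bring[OF C] by blast
      obtain m1 where m1: "valid n (Suc ?k) m1" "run m1 (half a d False # half a d True # C) = ?Q"
        "\<And>x. ops ?k ms x = ops (Suc ?k) m1 (R d (ops ?k ps x))"
        using A[OF ps] by blast
      obtain m2 where m2: "valid n (Suc ?k) m2" "run m2 (half a e False # half a e True # C) = ?Q"
        "\<And>x. ops ?k ms' x = ops (Suc ?k) m2 (R e (ops ?k ps x))"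
        using B[of ps C] ps True eq by metis
      have cC: "disjoint_cells n (a # C)" using disjoint_cells_mset[OF P(1) C] .
      have lenC: "?k = Suc (length C)" using C by (metis length_Cons size_mset)
      have cad: "disjoint_cells n (half a d False # half a d True # C)"
        and cae: "disjoint_cells n (half a e False # half a e True # C)"
        using disjoint_cells_half[OF cC] a b by auto
      show ?thesis
      proof (cases "d = e")
        case True
        have "ops (Suc ?k) m1 z = ops (Suc ?k) m2 z" for z
          using m1(2) m2(2) lenC True by (intro IH[OF cad _ m1(1) m2(1)]) auto
        then show ?thesis unfolding m1(3) m2(3) True .
      next
        case False
        define Y where "Y = half (half a d True) e False # half (half a d True) e True #
           half (half a d False) e False # half (half a d False) e True # C"
        (* The same cell is quartered: ?y and ?z split the two halves, and ?s brings the four quarters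
           into the same order. *)
        let ?y = "[Spl e, Swp 1, Swp 0, Spl e]" and ?z = "[Spl d, Swp 1, Swp 0, Spl d]"
        let ?s = "[Swp 0, Swp 1, Swp 2, Swp 1, Swp 0]"
        have ry: "run ?y (half a d False # half a d True # C) = Y"
          "run (?z @ ?s) (half a e False # half a e True # C) = Y"
          using False by (simp_all add: Y_def half_comm[of d e] numeral_2_eq_2)
        have "run (ps @ Spl d # ?y) P = Y"
          using run_append[OF ps(2), of "Spl d # ?y"] ps(3) ry(1) by simp
        note runY = this ry
        have vy: "valid n (Suc ?k) ?y" "valid n (Suc ?k) (?z @ ?s)" "valid n ?k (ps @ Spl d # ?y)"
          using a b ps lenC by (auto simp: valid_append)
        have sY: "within_depth n M Y"
        proof -
          have "within_depth n M (half a d False # half a d True # C)"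
            using m1(1,2) lenC within_depth_if_at_depth[OF at_depth] within_depth_if_run_within_depth[of n "half a d False # half a d True # C" m1 M] by simp
          moreover have "within_depth n M (half a e False # half a e True # C)"
            using m2(1,2) lenC within_depth_if_at_depth[OF at_depth] within_depth_if_run_within_depth[of n "half a e False # half a e True # C" m2 M] by simp
          ultimately show ?thesis using False by (auto simp: within_depth_def Y_def half_def)
        qed
        obtain w where w: "valid n (length Y) w" "run w Y = ?Q"
          using complete[OF vy(3) runY(1) sY] by blast
        have lenY: "length Y = ?k + 3" using lenC by (simp add: Y_def)
        have vw: "valid n (Suc ?k) (?y @ w)" "valid n (Suc ?k) ((?z @ ?s) @ w)"
          using vy(1,2) w(1) lenY by (simp_all add: valid_append numeral_3_eq_3)
        have rw: "run (?y @ w) (half a d False # half a d True # C) = ?Q" "run ((?z @ ?s) @ w) (half a e False # half a e True # C) = ?Q"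
          using run_append[of n "half a d False # half a d True # C" ?y w] run_append[of n "half a e False # half a e True # C" "?z @ ?s" w]
            vy(1,2) lenC ry w(2) by auto
        have 1: "ops (Suc ?k) m1 z = ops (Suc ?k) (?y @ w) z" for z
          using lenC by (intro IH[OF cad _ m1(1) vw(1) m1(2) rw(1)]) simp
        have 2: "ops (Suc ?k) m2 z = ops (Suc ?k) ((?z @ ?s) @ w) z" for z
          using lenC by (intro IH[OF cae _ m2(1) vw(2) m2(2) rw(2)]) simp
        show ?thesis
          unfolding m1(3) m2(3) 1 2 ops_append
          using one_cell[OF a(2) b(2) False] P(2) Pne
          by (simp add: swap_word_def del: T_word.simps)
      qed
    next
      case False
      obtain C0 where C0: "mset P = mset (a # C0)"
        using a mset_front by metis
      then have "set P = set (a # C0)" by (rule mset_eq_setD)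
      then have "b \<in> set C0" using b False by auto
      then obtain C where "mset C0 = mset (b # C)"
        using mset_front by metis
      then have C: "mset P = mset (a # b # C)" using C0 by simp
      obtain ps where ps: "grow ps = 0" "valid n ?k ps" "run ps P = a # b # C"
        using bring[OF C] by blast
      have lenC: "?k = Suc (Suc (length C))" using C by (metis length_Cons size_mset)
      have ps': "grow (ps @ [Swp 0]) = 0" "valid n ?k (ps @ [Swp 0])" "run (ps @ [Swp 0]) P = b # a # C"
        using ps lenC by (auto simp: valid_append run_append)
      obtain m1 where m1: "valid n (Suc ?k) m1" "run m1 (half a d False # half a d True # b # C) = ?Q"
        "\<And>x. ops ?k ms x = ops (Suc ?k) m1 (R d (ops ?k ps x))"
        using A[OF ps] by blast
      obtain m2 where m2: "valid n (Suc ?k) m2" "run m2 (half b e False # half b e True # a # C) = ?Q"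
        "\<And>x. ops ?k ms' x = ops (Suc ?k) m2 (R e (ops ?k (ps @ [Swp 0]) x))"
        using B[OF ps'] eq by metis
      have cC: "disjoint_cells n (a # b # C)" using disjoint_cells_mset[OF P(1) C] .
      then have cC': "disjoint_cells n (b # a # C)" using disjoint_cells_swp[of n "a # b # C" 0] by simp
      have cad: "disjoint_cells n (half a d False # half a d True # b # C)"
        and cbe: "disjoint_cells n (half b e False # half b e True # a # C)"
        using disjoint_cells_half[OF cC] disjoint_cells_half[OF cC'] a b by auto
      define Y where "Y = half b e False # half b e True # half a d False # half a d True # C"
      (* The other cell is brought to the front and split; ?s restores the order of the four halves. *)
      let ?y = "[Swp 1, Swp 0, Spl e]" and ?z = "[Swp 1, Swp 0, Spl d]"
      let ?s = "[Swp 1, Swp 0, Swp 2, Swp 1]"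
      have ry: "run ?y (half a d False # half a d True # b # C) = Y"
        "run (?z @ ?s) (half b e False # half b e True # a # C) = Y"
        by (simp_all add: Y_def numeral_2_eq_2)
      have "run (ps @ Spl d # ?y) P = Y"
        using run_append[OF ps(2), of "Spl d # ?y"] ps(3) ry(1) by simp
      note runY = this ry
      have vy: "valid n (Suc ?k) ?y" "valid n (Suc ?k) (?z @ ?s)" "valid n ?k (ps @ Spl d # ?y)"
        using a b ps lenC P by (auto simp: valid_append)
      have sY: "within_depth n M Y"
      proof -
        have "within_depth n M (half a d False # half a d True # b # C)"
            using m1(1,2) lenC within_depth_if_at_depth[OF at_depth] within_depth_if_run_within_depth[of n "half a d False # half a d True # b # C" m1 M] by simp
          moreover have "within_depth n M (half b e False # half b e True # a # C)"
            using m2(1,2) lenC within_depth_if_at_depth[OF at_depth] within_depth_if_run_within_depth[of n "half b e False # half b e True # a # C" m2 M] by simp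
          ultimately show ?thesis by (auto simp: within_depth_def Y_def)
      qed
      obtain w where w: "valid n (length Y) w" "run w Y = ?Q"
        using complete[OF vy(3) runY(1) sY] by blast
      have lenY: "length Y = ?k + 2" using lenC by (simp add: Y_def)
      have vw: "valid n (Suc ?k) (?y @ w)" "valid n (Suc ?k) ((?z @ ?s) @ w)"
          using vy(1,2) w(1) lenY by (simp_all add: valid_append numeral_3_eq_3)
        have rw: "run (?y @ w) (half a d False # half a d True # b # C) = ?Q" "run ((?z @ ?s) @ w) (half b e False # half b e True # a # C) = ?Q"
          using run_append[of n "half a d False # half a d True # b # C" ?y w] run_append[of n "half b e False # half b e True # a # C" "?z @ ?s" w]
            vy(1,2) lenC ry w(2) by auto
        have 1: "ops (Suc ?k) m1 z = ops (Suc ?k) (?y @ w) z" for z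
          using lenC by (intro IH[OF cad _ m1(1) vw(1) m1(2) rw(1)]) simp
        have 2: "ops (Suc ?k) m2 z = ops (Suc ?k) ((?z @ ?s) @ w) z" for z
          using lenC by (intro IH[OF cbe _ m2(1) vw(2) m2(2) rw(2)]) simp
        show ?thesis
        unfolding m1(3) m2(3) 1 2 ops_append
        using two_cells[OF a(2) b(2)] P(2) Pne ps(1)
        by (simp add: swap_word_def del: T_word.simps)
    qed
  qed
qed

text \<open>
  Both paths are continued to a uniform grid by the same moves, which act bijectively.
\<close>

theorem ops_unique:
  assumes "disjoint_cells n P" "3 \<le> length P" "valid n (length P) ms" "valid n (length P) ms'"
    and "run ms P = run ms' P"
  shows "ops (length P) ms x = ops (length P) ms' x"
proof -
  obtain M where M: "within_depth n M (run ms P)" using ex_within_depth by blast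
  then obtain w where w: "valid n (length (run ms P)) w" "at_depth n M (run w (run ms P))"
    using run_to_at_depth by blast
  have g: "grow ms = grow ms'"
    using length_run[OF assms(3)] length_run[OF assms(4)] assms(5) by simp
  have l: "length (run ms P) = length P + grow ms" using length_run assms by blast
  have "ops (length P) (ms @ w) x = ops (length P) (ms' @ w) x"
    using assms w l g by (intro ops_unique_at_depth[where M = M]) (auto simp: valid_append run_append)
  then have "ops (length P + grow ms) w (ops (length P) ms x) = ops (length P + grow ms) w (ops (length P) ms' x)"
    by (simp add: ops_append g)
  then show ?thesis
    using bij_ops[of "length P + grow ms" w] w l assms by (simp add: bij_is_inj[THEN inj_eq])
qed

end

section \<open>The comb partition\<close>

definition comb_cell :: "nat \<Rightarrow> cell" where
  "comb_cell i = (\<lambda>d. if d = 0 then replicate i True @ [False] else [])"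

definition comb_end :: "nat \<Rightarrow> cell" where
  "comb_end i = (\<lambda>d. if d = 0 then replicate i True else [])"

definition comb :: "nat \<Rightarrow> cell list" where
  "comb k = map comb_cell [0..<k - 1] @ [comb_end (k - 1)]"

lemma half_comb_end: "half (comb_end i) 0 False = comb_cell i" "half (comb_end i) 0 True = comb_end (Suc i)"
  by (auto simp: half_def comb_end_def comb_cell_def fun_eq_iff replicate_append_same)

lemma length_comb [simp]: "k \<ge> 1 \<Longrightarrow> length (comb k) = k"
  by (simp add: comb_def)

lemma comb_Suc: "comb (Suc (Suc m)) = map comb_cell [0..<m] @ [half (comb_end m) 0 False, half (comb_end m) 0 True]"
  by (simp add: comb_def half_comb_end)

lemma comb_Suc': "comb (Suc m) = map comb_cell [0..<m] @ [comb_end m]"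
  by (simp add: comb_def)

lemma disjoint_cells_comb: assumes "n \<ge> 1" shows "disjoint_cells n (comb k)"
proof -
  have "disjoint_cells n (comb (Suc m))" for m
  proof (induction m)
    case 0
    then show ?case using assms by (auto simp: comb_def disjoint_cells_def wf_cell_def comb_end_def)
  next
    case (Suc m)
    have "disjoint_cells n (comb_end m # map comb_cell [0..<m])"
      using Suc by (rule disjoint_cells_mset) (simp add: comb_Suc')
    then have "disjoint_cells n (half (comb_end m) 0 False # half (comb_end m) 0 True # map comb_cell [0..<m])"
      using assms by (intro disjoint_cells_half) auto
    then show ?case by (rule disjoint_cells_mset) (simp add: comb_Suc)
  qed
  moreover have "comb k = comb (Suc (k - 1))" by (simp add: comb_def)
  ultimately show ?thesis by metis
qed

text \<open>
  Splitting the last of three cells turns the comb with three cells into the one with four. As both have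
  the trivial chart, this path has to act trivially, which is the content of the relation \<open>X
  S\<^sub>1 = S\<^sub>2 T\<^sub>1\<close>.
\<close>

definition split_end :: "move list" where
  "split_end = [Swp 1, Swp 0, Spl 0, Swp 1, Swp 0, Swp 2, Swp 1]"

context thompson_action begin

lemma ops_split_end: "ops 3 split_end x = x"
proof -
  have "ops 3 split_end x = T 1 (S 2 (X (S 1 x)))"
    by (simp add: split_end_def X_def swap_word_def del: T_word.simps)
  then show ?thesis using S_S[of 2] by (simp only: base_rels one_le_numeral)
qed

lemma valid_split_end: "valid n 3 split_end" "grow split_end = 1"
  using n_pos by (auto simp: split_end_def)

text \<open>
  Paths never use inverses of splits, so the points reachable by paths from a given point do not form an
  orbit. Fractions of two paths repair this: both start from the comb with three cells and make the same
  number of splits, so that the same moves can continue both.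
\<close>

definition "joined x y \<longleftrightarrow> (\<exists>ms ms'. valid n 3 ms \<and> valid n 3 ms' \<and> grow ms = grow ms' \<and> ops 3 ms x = ops 3 ms' y)"

lemma joined_refl: "joined x x"
  unfolding joined_def by (intro exI[of _ "[]"]) simp

lemma joined_sym: "joined x y \<Longrightarrow> joined y x"
  unfolding joined_def by metis

text \<open>
  The two paths that start at \<open>y\<close> are continued to the same uniform grid. There they agree by
  \<open>ops_unique\<close>.
\<close>

lemma joined_trans:
  assumes "joined x y" "joined y z" shows "joined x z"
proof -
  obtain m1 m2 where m12: "valid n 3 m1" "valid n 3 m2" "grow m1 = grow m2" "ops 3 m1 x = ops 3 m2 y"
    using assms by (auto simp: joined_def)
  obtain m3 m4 where m34: "valid n 3 m3" "valid n 3 m4" "grow m3 = grow m4" "ops 3 m3 y = ops 3 m4 z"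
    using assms by (auto simp: joined_def)
  have c: "disjoint_cells n (comb 3)" using disjoint_cells_comb n_pos by blast
  let ?P = "run m2 (comb 3)" and ?Q = "run m3 (comb 3)"
  have l: "length ?P = 3 + grow m2" "length ?Q = 3 + grow m3" and cPQ: "disjoint_cells n ?P" "disjoint_cells n ?Q"
    using length_run[of n "comb 3"] disjoint_cells_run[OF c] m12 m34 by auto
  obtain M where M: "within_depth n M ?P" "within_depth n M ?Q"
    using ex_within_depth[of n ?P] ex_within_depth[of n ?Q] by (metis linear)
  obtain g where g: "valid n (length ?P) g" "at_depth n M (run g ?P)" using run_to_at_depth[OF M(1)] by blast
  let ?G = "run g ?P"
  have cG: "disjoint_cells n ?G" using disjoint_cells_run cPQ g by blast
  have "set ?G = grid n M ?P"
    using grid_at_depth[OF g(2) cG] grid_run[OF g(1) within_depth_if_at_depth[OF g(2)]] by simp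
  also have "\<dots> = grid n M (comb 3)" using grid_run[of n "comb 3" m2] m12 M by simp
  also have "\<dots> = grid n M ?Q" using grid_run[of n "comb 3" m3] m34 M by simp
  finally obtain h where h: "valid n (length ?Q) h" "run h ?Q = ?G"
    using run_to_grid[OF cPQ(2) M(2) cG g(2)] by blast
  have eq: "run (m2 @ g) (comb 3) = run (m3 @ h) (comb 3)"
    using run_append[of n "comb 3"] m12 m34 h by simp
  have v: "valid n 3 (m2 @ g)" "valid n 3 (m3 @ h)" using m12 m34 g h l by (auto simp: valid_append)
  have "grow (m2 @ g) = grow (m3 @ h)"
    using eq length_run[of n "comb 3"] v by (metis add_left_cancel length_comb one_le_numeral)
  moreover have "ops 3 (m2 @ g) y = ops 3 (m3 @ h) y"
    using ops_unique[OF c, of "m2 @ g" "m3 @ h" y] v eq by simp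
  ultimately show ?thesis
    unfolding joined_def using m12 m34 g h l
    by (intro exI[of _ "m1 @ g"] exI[of _ "m4 @ h"]) (auto simp: valid_append ops_append)
qed

text \<open>
  Letters 0 and 2 and the splits are single moves on three cells. Letter 1 exchanges the second and third
  of at least four cells, so the end of the comb is split first. The path \<open>split_end\<close>, which
  acts trivially, also makes the numbers of splits agree.
\<close>

lemma joined_letter: assumes "l < n + 3" shows "joined x (A l x)"
proof -
  consider "l = 0" | "l = 1" | "l = 2" | d where "l = 3 + d" "d < n"
    using assms by (metis add_less_cancel_left add.commute le_Suc_ex less_Suc_eq less_one not_less numeral_2_eq_2 numeral_3_eq_3 One_nat_def)
  then show ?thesis
  proof cases
    case 1
    then show ?thesis unfolding joined_def
      by (intro exI[of _ "[Swp 0]"] exI[of _ "[]"]) (simp add: swap_word_def)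
  next
    case 2
    then show ?thesis unfolding joined_def using valid_split_end
      by (intro exI[of _ "split_end @ [Swp 1]"] exI[of _ split_end])
         (simp add: valid_append ops_append ops_split_end swap_word_def del: word.simps, simp add: swap_word_def)
  next
    case 3
    then show ?thesis unfolding joined_def
      by (intro exI[of _ "[Swp 1]"] exI[of _ "[]"]) (simp add: swap_word_def S_word_def)
  next
    case 4
    then show ?thesis unfolding joined_def using valid_split_end
      by (intro exI[of _ "[Spl d]"] exI[of _ split_end]) (simp add: ops_split_end)
  qed
qed

lemma joined_word: "set w \<subseteq> {..<n + 3} \<times> UNIV \<Longrightarrow> joined x (acts A w x)"
proof (induction w)
  case (Cons a w)
  obtain l b where a: "a = (l, b)" by (cases a)
  let ?y = "acts A w x"
  have l: "l < n + 3" using Cons a by auto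
  have "joined ?y (acts A (a # w) x)"
  proof (cases b)
    case True
    then show ?thesis using joined_letter[OF l] a by simp
  next
    case False
    have "A l (inv_map (A l) ?y) = ?y" using bij_A[OF l] by (simp add: bij_is_surj surj_f_inv_f)
    then show ?thesis using False joined_letter[OF l, of "inv_map (A l) ?y"] joined_sym a by simp
  qed
  then show ?case using Cons joined_trans by auto
qed (simp add: joined_refl)

end

lemma acts_pair:
  assumes A: "thompson_action n A" and B: "thompson_action n B" and w: "set w \<subseteq> {..<n + 3} \<times> UNIV"
  shows "acts (\<lambda>l. map_prod (A l) (B l)) w (x, y) = (acts A w x, acts B w y)"
  using w
proof (induction w)
  case (Cons a w)
  obtain l b where a: "a = (l, b)" by (cases a)
  have l: "bij (A l)" "bij (B l)" using Cons a thompson_action.bij_A[OF A] thompson_action.bij_A[OF B] by auto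
  have "inv_map (map_prod (A l) (B l)) z = map_prod (inv_map (A l)) (inv_map (B l)) z" for z
    using l by (intro inv_f_eq prod.inj_map) (cases z; simp add: bij_is_inj bij_is_surj surj_f_inv_f)+
  then show ?case using Cons a by simp
qed simp

lemma set_T_word: "n \<ge> 1 \<Longrightarrow> set (T_word i) \<subseteq> {..<n + 3} \<times> UNIV"
  by (cases i) auto

lemma set_S_word: "n \<ge> 1 \<Longrightarrow> set (S_word i) \<subseteq> {..<n + 3} \<times> UNIV"
  by (auto simp: S_word_def)

lemma set_word: "n \<ge> 1 \<Longrightarrow> valid n k ms \<Longrightarrow> set (word k ms) \<subseteq> {..<n + 3} \<times> UNIV"
  by (induction k ms rule: word.induct) (simp_all add: swap_word_def set_T_word set_S_word)

lemma valid_rels: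
  assumes n: "n \<ge> 1" and r: "(k, ms, k', ms') \<in> set (rels n)"
  shows "valid n k ms \<and> valid n k' ms' \<and> k \<ge> 3 \<and> k' \<ge> 3"
proof -
  consider "(k, ms, k', ms') \<in> set const_rels" | d where "d \<in> {1..<n}" "(k, ms, k', ms') \<in> set (shift_rels d)"
    | d e where "d < n" "e < n" "(k, ms, k', ms') = (if d \<le> e then two_cells_rel d e else one_cell_rel e d)"
    using r unfolding rels_def by auto
  then show ?thesis
  proof cases
    case 1
    have "\<forall>(k, ms, k', ms')\<in>set const_rels. valid n k ms \<and> valid n k' ms' \<and> k \<ge> 3 \<and> k' \<ge> 3"
      using n by (simp add: const_rels_def split1_def)
    with 1 show ?thesis by fast
  next
    case 2
    then show ?thesis by (auto simp: shift_rels_def)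
  qed (auto simp: two_cells_rel_def one_cell_rel_def split: if_splits)
qed

lemma thompson_action_pair:
  assumes A: "thompson_action n A" and B: "thompson_action n B"
  shows "thompson_action n (\<lambda>l. map_prod (A l) (B l))"
proof -
  interpret A: thompson_action n A by fact
  interpret B: thompson_action n B by fact
  show ?thesis
  proof
    show "1 \<le> n" by (rule A.n_pos)
    show "bij (map_prod (A i) (B i))" if "i < n + 3" for i
      using A.bij_A[OF that] B.bij_A[OF that] by (rule bij_betw_map_prod[of _ UNIV UNIV _ UNIV UNIV, simplified])
    show "acts (\<lambda>l. map_prod (A l) (B l)) (word k ms) x = acts (\<lambda>l. map_prod (A l) (B l)) (word k' ms') x"
      if r: "(k, ms, k', ms') \<in> set (rels n)" for k ms k' ms' x
    proof -
      have "valid n k ms" "valid n k' ms'" using valid_rels[OF A.n_pos r] by auto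
      then show ?thesis using acts_pair[OF A B] set_word A.n_pos A.rels[OF r] B.rels[OF r]
        by (cases x) simp
    qed
  qed
qed

text \<open>
  In the product of two actions a pair of points is joined to its image by one fraction of paths, which
  therefore serves both components.
\<close>

theorem simultaneous_moves:
  assumes A: "thompson_action n A" and B: "thompson_action n B" and w: "set w \<subseteq> {..<n + 3} \<times> UNIV"
  obtains ms ms' where "valid n 3 ms" "valid n 3 ms'" "grow ms = grow ms'"
    "acts A (word 3 ms) x = acts A (word 3 ms') (acts A w x)"
    "acts B (word 3 ms) y = acts B (word 3 ms') (acts B w y)"
proof -
  interpret C: thompson_action n "\<lambda>l. map_prod (A l) (B l)" by (rule thompson_action_pair[OF A B])
  obtain ms ms' where m: "valid n 3 ms" "valid n 3 ms'" "grow ms = grow ms'"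
    "acts (\<lambda>l. map_prod (A l) (B l)) (word 3 ms) (x, y) =
     acts (\<lambda>l. map_prod (A l) (B l)) (word 3 ms') (acts (\<lambda>l. map_prod (A l) (B l)) w (x, y))"
    using C.joined_word[OF w, of "(x, y)"] unfolding C.joined_def by blast
  then show ?thesis
    using that acts_pair[OF A B] set_word[OF C.n_pos] w by simp
qed

section \<open>Words in a group\<close>

definition ev :: "('g, 'm) monoid_scheme \<Rightarrow> ('x \<Rightarrow> 'g) \<Rightarrow> ('x \<times> bool) list \<Rightarrow> 'g" where
  "ev G f w = foldr (\<lambda>(l, b) y. (if b then f l else inv\<^bsub>G\<^esub> (f l)) \<otimes>\<^bsub>G\<^esub> y) w \<one>\<^bsub>G\<^esub>"

text \<open>
  Extended by the identity outside the carrier, so that it is a bijection of the whole type.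
\<close>

definition left_mult :: "('g, 'm) monoid_scheme \<Rightarrow> 'g \<Rightarrow> 'g \<Rightarrow> 'g" where
  "left_mult G g x = (if x \<in> carrier G then g \<otimes>\<^bsub>G\<^esub> x else x)"

lemma ev_Nil [simp]: "ev G f [] = \<one>\<^bsub>G\<^esub>"
  and ev_Cons: "ev G f ((l, b) # w) = (if b then f l else inv\<^bsub>G\<^esub> (f l)) \<otimes>\<^bsub>G\<^esub> ev G f w"
  by (simp_all add: ev_def)

definition inv_word :: "('x \<times> bool) list \<Rightarrow> ('x \<times> bool) list" where
  "inv_word w = rev (map inv_letter w)"

definition subst_word :: "('x \<Rightarrow> ('y \<times> bool) list) \<Rightarrow> ('x \<times> bool) list \<Rightarrow> ('y \<times> bool) list" where
  "subst_word s w = concat (map (\<lambda>(l, b). if b then s l else inv_word (s l)) w)"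

context group begin

lemma ev_closed [simp]: "(\<And>l. f l \<in> carrier G) \<Longrightarrow> ev G f w \<in> carrier G"
  by (induction w) (auto simp: ev_Cons)

lemma ev_append: "(\<And>l. f l \<in> carrier G) \<Longrightarrow> ev G f (u @ v) = ev G f u \<otimes> ev G f v"
  by (induction u) (auto simp: ev_Cons m_assoc)

lemma ev_inv_word: "(\<And>l. f l \<in> carrier G) \<Longrightarrow> ev G f (inv_word w) = inv (ev G f w)"
  by (induction w) (auto simp: inv_word_def ev_Cons ev_append inv_mult_group)

lemma ev_subst: "(\<And>l. f l \<in> carrier G) \<Longrightarrow> ev G f (subst_word s w) = ev G (\<lambda>l. ev G f (s l)) w"
  by (induction w) (auto simp: subst_word_def ev_Cons ev_append ev_inv_word)

lemma ev_push: "(\<And>l. f l \<in> carrier G) \<Longrightarrow> ev G f (push_letter a w) = ev G f (a # w)"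
proof (cases w)
  case (Cons b v)
  assume f: "\<And>l. f l \<in> carrier G"
  obtain x s where a: "a = (x, s)" by (cases a)
  have "f x \<otimes> (inv f x \<otimes> ev G f v) = ev G f v" "inv f x \<otimes> (f x \<otimes> ev G f v) = ev G f v"
    using f by (simp_all add: m_assoc[symmetric])
  then show ?thesis using f Cons a by (auto simp: ev_Cons)
qed simp

lemma ev_foldr_push: "(\<And>l. f l \<in> carrier G) \<Longrightarrow> ev G f (foldr push_letter u v) = ev G f u \<otimes> ev G f v"
  by (induction u) (auto simp: ev_push ev_Cons m_assoc)

lemma ev_cong: "(\<And>l b. (l, b) \<in> set w \<Longrightarrow> f l = g l) \<Longrightarrow> ev G f w = ev G g w"
proof (induction w)
  case (Cons a w)
  obtain l b where a: "a = (l, b)" by (cases a)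
  have "f l = g l" using Cons.prems[of l b] a by simp
  moreover have "ev G f w = ev G g w" using Cons.prems by (intro Cons.IH) auto
  ultimately show ?case by (simp add: a ev_Cons)
qed simp

lemma left_mult_inv:
  "g \<in> carrier G \<Longrightarrow> left_mult G g (left_mult G (inv g) x) = x"
  "g \<in> carrier G \<Longrightarrow> left_mult G (inv g) (left_mult G g x) = x"
  by (auto simp: left_mult_def m_assoc[symmetric])

lemma bij_left_mult: "g \<in> carrier G \<Longrightarrow> bij (left_mult G g)"
  by (rule o_bij[of "left_mult G (inv g)"]) (auto simp: fun_eq_iff left_mult_inv)

lemma inv_left_mult: "g \<in> carrier G \<Longrightarrow> inv_map (left_mult G g) = left_mult G (inv g)"
  by (rule inv_unique_comp) (auto simp: fun_eq_iff left_mult_inv)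

lemma left_mult_eq: "x \<in> carrier G \<Longrightarrow> left_mult G g x = g \<otimes> x"
  by (simp add: left_mult_def)

lemma acts_left_mult:
  assumes "\<And>l. f l \<in> carrier G" "x \<in> carrier G"
  shows "acts (\<lambda>l. left_mult G (f l)) w x = ev G f w \<otimes> x"
proof (induction w)
  case (Cons a w)
  obtain l b where a: "a = (l, b)" by (cases a)
  show ?case using Cons assms by (cases b) (simp_all add: a ev_Cons inv_left_mult left_mult_eq m_assoc)
qed (use assms in simp)

lemma generate_eq_ev:
  assumes f: "\<And>l. f l \<in> carrier G" and x: "x \<in> generate G (f ` X)"
  shows "\<exists>w. set w \<subseteq> X \<times> UNIV \<and> ev G f w = x"
  using x
proof (induction rule: generate.induct)
  case one
  show ?case by (rule exI[of _ "[]"]) simp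
next
  case (incl h)
  then obtain l where "l \<in> X" "h = f l" by auto
  then show ?case using f by (intro exI[of _ "[(l, True)]"]) (simp add: ev_Cons)
next
  case (inv h)
  then obtain l where "l \<in> X" "h = f l" by auto
  then show ?case using f by (intro exI[of _ "[(l, False)]"]) (simp add: ev_Cons)
next
  case (eng h1 h2)
  then obtain w1 w2 where "set w1 \<subseteq> X \<times> UNIV" "ev G f w1 = h1" "set w2 \<subseteq> X \<times> UNIV" "ev G f w2 = h2" by auto
  then show ?case using f by (intro exI[of _ "w1 @ w2"]) (simp add: ev_append)
qed

lemma ev_in_generate:
  assumes f: "\<And>l. f l \<in> carrier G" and w: "set w \<subseteq> X \<times> UNIV"
  shows "ev G f w \<in> generate G (f ` X)"
  using w
proof (induction w)
  case (Cons a w)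
  obtain l b where a: "a = (l, b)" by (cases a)
  have "l \<in> X" using Cons a by auto
  then have "f l \<in> generate G (f ` X)" "inv f l \<in> generate G (f ` X)"
    by (auto intro: generate.incl generate.inv)
  then show ?case using Cons by (auto simp: a ev_Cons intro: generate.eng)
qed (simp add: generate.one)

end

section \<open>Tables\<close>

definition drop_tuple :: "nat \<Rightarrow> cell \<Rightarrow> (nat \<Rightarrow> nat \<Rightarrow> bool) \<Rightarrow> nat \<Rightarrow> nat \<Rightarrow> bool" where
  "drop_tuple n a x = (\<lambda>d\<in>{..<n}. \<lambda>j. x d (j + length (a d)))"

lemma prepend_closed [simp]: "prepend_tuple n a w \<in> Gamma n"
  by (auto simp: prepend_tuple_def Gamma_def)

lemma drop_closed [simp]: "drop_tuple n a w \<in> Gamma n"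
  by (auto simp: drop_tuple_def Gamma_def)

lemma drop_prepend: "w \<in> Gamma n \<Longrightarrow> drop_tuple n a (prepend_tuple n a w) = w"
  by (auto simp: drop_tuple_def prepend_tuple_def prepend_def Gamma_def PiE_iff extensional_def fun_eq_iff)

lemma cone_iff: "x \<in> cone n a \<longleftrightarrow> x \<in> Gamma n \<and> (\<forall>d<n. \<forall>j<length (a d). x d j = a d ! j)"
proof
  assume "x \<in> cone n a"
  then obtain w where "x = prepend_tuple n a w" by (auto simp: cone_def)
  then show "x \<in> Gamma n \<and> (\<forall>d<n. \<forall>j<length (a d). x d j = a d ! j)"
    using prepend_closed by (simp add: prepend_tuple_def prepend_def)
next
  assume *: "x \<in> Gamma n \<and> (\<forall>d<n. \<forall>j<length (a d). x d j = a d ! j)"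
  have "x = prepend_tuple n a (drop_tuple n a x)"
  proof (intro ext)
    fix d j
    show "x d j = prepend_tuple n a (drop_tuple n a x) d j"
      using * by (cases "d < n")
        (simp_all add: prepend_tuple_def prepend_def drop_tuple_def Gamma_def PiE_iff extensional_def)
  qed
  then show "x \<in> cone n a" unfolding cone_def using drop_closed by (rule image_eqI)
qed

lemma prepend_drop: "x \<in> cone n a \<Longrightarrow> prepend_tuple n a (drop_tuple n a x) = x"
  by (auto simp: cone_def drop_prepend)

lemma cone_subset: "cone n a \<subseteq> Gamma n"
  by (auto simp: cone_iff)

text \<open>
  If the words of two cells are compatible in every coordinate, then the longer one of each pair,
  continued by zeros, gives a common point.
\<close>

lemma cone_disjoint_iff: "cone n a \<inter> cone n b = {} \<longleftrightarrow> cell_disj n a b"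
proof
  show "cell_disj n a b \<Longrightarrow> cone n a \<inter> cone n b = {}"
    by (force simp: cell_disj_def incomp_def cone_iff)
next
  assume e: "cone n a \<inter> cone n b = {}"
  show "cell_disj n a b"
  proof (rule ccontr)
    assume "\<not> cell_disj n a b"
    then have *: "a d ! j = b d ! j" if "d < n" "j < length (a d)" "j < length (b d)" for d j
      using that by (auto simp: cell_disj_def incomp_def)
    (* The last conjunction continues the longer word by zeros. *)
    define x where "x = (\<lambda>d\<in>{..<n}. \<lambda>j. if j < length (a d) then a d ! j else j < length (b d) \<and> b d ! j)"
    have "x \<in> cone n a \<inter> cone n b"
      using * by (auto simp: cone_iff x_def Gamma_def)
    then show False using e by auto
  qed
qed

lemma cone_half: "d < n \<Longrightarrow> x \<in> cone n a \<Longrightarrow> x \<in> cone n (half a d (x d (length (a d))))"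
  by (auto simp: cone_iff half_def nth_append less_Suc_eq)

definition tiling :: "nat \<Rightarrow> cell list \<Rightarrow> bool" where
  "tiling n P \<longleftrightarrow> disjoint_cells n P \<and> (\<forall>x\<in>Gamma n. \<exists>a\<in>set P. x \<in> cone n a)"

lemma tiling_disjoint_cells: "tiling n P \<Longrightarrow> disjoint_cells n P" by (simp add: tiling_def)

lemma tiling_cover: "tiling n P \<Longrightarrow> x \<in> Gamma n \<Longrightarrow> \<exists>a\<in>set P. x \<in> cone n a" by (simp add: tiling_def)

lemma tiling_unique:
  assumes "tiling n P" "i < length P" "j < length P" "x \<in> cone n (P ! i)" "x \<in> cone n (P ! j)" shows "i = j"
proof (rule ccontr)
  assume "i \<noteq> j"
  then have "cell_disj n (P ! i) (P ! j)"
    using assms cell_disj_sym by (metis disjoint_cells_def linorder_neqE_nat tiling_disjoint_cells sorted_wrt_iff_nth_less)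
  then show False using assms cone_disjoint_iff by blast
qed

lemma tiling_mset: "tiling n P \<Longrightarrow> mset P = mset Q \<Longrightarrow> tiling n Q"
  unfolding tiling_def using disjoint_cells_mset mset_eq_setD by metis

lemma tiling_run: "tiling n P \<Longrightarrow> valid n (length P) ms \<Longrightarrow> tiling n (run ms P)"
proof (induction ms P rule: run.induct)
  case (2 i ms P)
  then show ?case using tiling_mset[of n P "swp i P"] by simp
next
  case (3 d ms a P)
  have "tiling n (half a d False # half a d True # P)"
    unfolding tiling_def
  proof (intro conjI ballI)
    show "disjoint_cells n (half a d False # half a d True # P)"
      using 3 by (intro disjoint_cells_half) (auto simp: tiling_def)
    fix x assume "x \<in> Gamma n"
    then obtain b where b: "b \<in> set (a # P)" "x \<in> cone n b" using 3 tiling_cover by blast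
    show "\<exists>b\<in>set (half a d False # half a d True # P). x \<in> cone n b"
    proof (cases "b = a")
      case True
      then show ?thesis using b cone_half[of d n x a] 3 by (cases "x d (length (a d))") auto
    qed (use b in auto)
  qed
  then show ?case using 3 by simp
qed auto

definition carries :: "nat \<Rightarrow> ((nat \<Rightarrow> nat \<Rightarrow> bool) \<Rightarrow> nat \<Rightarrow> nat \<Rightarrow> bool) \<Rightarrow> cell \<Rightarrow> cell \<Rightarrow> bool" where
  "carries n f a b \<longleftrightarrow> (\<forall>w\<in>Gamma n. f (prepend_tuple n a w) = prepend_tuple n b w)"

abbreviation "table n f P Q \<equiv> list_all2 (carries n f) P Q"

lemma prepend_half: "d < n \<Longrightarrow> prepend_tuple n (half a d v) w =
    prepend_tuple n a (w(d := \<lambda>j. if j = 0 then v else w d (j - 1)))"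
  by (auto simp: fun_eq_iff prepend_tuple_def prepend_def half_def nth_append less_Suc_eq)

lemma carries_half: "d < n \<Longrightarrow> carries n f a b \<Longrightarrow> carries n f (half a d v) (half b d v)"
  unfolding carries_def by (auto simp: prepend_half Gamma_def PiE_iff extensional_def)

lemma table_swp: "table n f P Q \<Longrightarrow> table n f (swp i P) (swp i Q)"
  by (induction i P arbitrary: Q rule: swp.induct)
     (auto simp: list_all2_Cons1 dest: list_all2_lengthD)

lemma table_run: "table n f P Q \<Longrightarrow> valid n (length P) ms \<Longrightarrow> table n f (run ms P) (run ms Q)"
proof (induction ms P arbitrary: Q rule: run.induct)
  case (2 i ms P)
  then show ?case using table_swp by fastforce
next
  case (3 d ms a P)
  then show ?case by (auto simp: list_all2_Cons1 carries_half)
qed auto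

lemma carries_compose:
  "carries n f a b \<Longrightarrow> carries n g b c \<Longrightarrow> carries n (compose (Gamma n) g f) a c"
  by (auto simp: carries_def compose_def)

lemma table_compose:
  "table n f P Q \<Longrightarrow> table n g Q R \<Longrightarrow> table n (compose (Gamma n) g f) P R"
  by (rule list_all2_trans[of "carries n f" "carries n g"]) (auto intro: carries_compose)

lemma table_unique:
  assumes "tiling n P" "table n f P Q" "table n g P Q" "f \<in> extensional (Gamma n)" "g \<in> extensional (Gamma n)"
  shows "f = g"
proof (rule extensionalityI[OF assms(4,5)])
  fix x assume "x \<in> Gamma n"
  then obtain a where a: "a \<in> set P" "x \<in> cone n a" using tiling_cover assms by blast
  then obtain i where i: "i < length P" "a = P ! i" by (auto simp: in_set_conv_nth)
  then have "carries n f a (Q ! i)" "carries n g a (Q ! i)"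
    using assms by (auto simp: list_all2_conv_all_nth)
  moreover obtain w where "w \<in> Gamma n" "x = prepend_tuple n a w" using a by (auto simp: cone_def)
  ultimately show "f x = g x" by (simp add: carries_def)
qed

text \<open>
  The cell that contains \<open>x\<close> is unique when \<open>P\<close> is a tiling.
\<close>

definition tab :: "nat \<Rightarrow> cell list \<Rightarrow> cell list \<Rightarrow> (nat \<Rightarrow> nat \<Rightarrow> bool) \<Rightarrow> nat \<Rightarrow> nat \<Rightarrow> bool" where
  "tab n P Q = (\<lambda>x\<in>Gamma n. let i = (THE i. i < length P \<and> x \<in> cone n (P ! i))
      in prepend_tuple n (Q ! i) (drop_tuple n (P ! i) x))"

lemma tab_extensional [simp]: "tab n P Q \<in> extensional (Gamma n)"
  by (simp add: tab_def)

lemma table_tab: assumes "tiling n P" "length P = length Q" shows "table n (tab n P Q) P Q"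
proof (rule list_all2_all_nthI)
  fix i assume i: "i < length P"
  show "carries n (tab n P Q) (P ! i) (Q ! i)"
    unfolding carries_def
  proof
    fix w assume w: "w \<in> Gamma n"
    let ?x = "prepend_tuple n (P ! i) w"
    have x: "?x \<in> cone n (P ! i)" using w by (auto simp: cone_def)
    then have "(THE j. j < length P \<and> ?x \<in> cone n (P ! j)) = i"
      using i tiling_unique[OF assms(1)] by (intro the_equality) auto
    then show "tab n P Q ?x = prepend_tuple n (Q ! i) w"
      using w by (simp add: tab_def drop_prepend)
  qed
qed (use assms in simp)

lemma id_table: "table n (\<lambda>x\<in>Gamma n. x) P P"
  by (rule list_all2_refl) (simp add: carries_def)

lemma table_Gamma: assumes "tiling n P" "table n f P Q" "x \<in> Gamma n" shows "f x \<in> Gamma n"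
proof -
  obtain a where a: "a \<in> set P" "x \<in> cone n a" using tiling_cover assms by blast
  then obtain i where "i < length P" "a = P ! i" by (auto simp: in_set_conv_nth)
  then have "carries n f a (Q ! i)" using assms by (auto simp: list_all2_conv_all_nth)
  then show ?thesis using a by (auto simp: carries_def cone_def)
qed

lemma tab_inverse:
  assumes "tiling n P" "tiling n Q" "length P = length Q"
  shows "compose (Gamma n) (tab n Q P) (tab n P Q) = (\<lambda>x\<in>Gamma n. x)"
proof (rule table_unique[OF assms(1)])
  show "table n (compose (Gamma n) (tab n Q P) (tab n P Q)) P P"
    using assms by (intro table_compose[of n _ P Q] table_tab) auto
qed (auto simp: id_table compose_def)

lemma continuous_coordinate:
  "d < n \<Longrightarrow> continuous_map (Gamma_top n) (discrete_topology UNIV) (\<lambda>x. x d m)"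
proof -
  assume d: "d < n"
  have "continuous_map (Gamma_top n) Cantor_space (\<lambda>x. x d)"
    unfolding Gamma_top_def using d by (intro continuous_map_product_projection) auto
  moreover have "continuous_map Cantor_space (discrete_topology UNIV) (\<lambda>y. y m)"
    unfolding Cantor_space_def by (rule continuous_map_product_projection[of m UNIV "\<lambda>_. discrete_topology UNIV"]) simp
  ultimately show ?thesis using continuous_map_compose[unfolded comp_def] by blast
qed

lemma openin_coordinate:
  assumes "d < n" shows "openin (Gamma_top n) {x \<in> Gamma n. x d m \<in> U}"
  using continuous_coordinate[OF assms, of m] unfolding continuous_map_def by simp

lemma openin_cone: "openin (Gamma_top n) (cone n a)"
proof -
  let ?I = "Sigma {..<n} (\<lambda>d. {..<length (a d)})"
  have "openin (Gamma_top n) ((\<Inter>i\<in>?I. {x \<in> Gamma n. x (fst i) (snd i) \<in> {a (fst i) ! snd i}}) \<inter> topspace (Gamma_top n))"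
    by (intro openin_INT openin_coordinate) auto
  also have "(\<Inter>i\<in>?I. {x \<in> Gamma n. x (fst i) (snd i) \<in> {a (fst i) ! snd i}}) \<inter> topspace (Gamma_top n) = cone n a"
    by (auto simp: cone_iff)
  finally show ?thesis .
qed

text \<open>
  On each of the finitely many open cones of \<open>P\<close>, a digit of \<open>f x\<close> is either
  constant or a digit of \<open>x\<close>.
\<close>

lemma table_continuous:
  assumes P: "tiling n P" and f: "table n f P Q"
  shows "continuous_map (Gamma_top n) (Gamma_top n) f"
proof -
  have ext: "f x \<in> Gamma n" if "x \<in> Gamma n" for x using table_Gamma[OF P f that] .
  have "continuous_map (Gamma_top n) (discrete_topology UNIV) (\<lambda>x. f x d j)" if d: "d < n" for d j
    unfolding continuous_map_def
  proof (intro conjI allI impI)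
    fix U :: "bool set"
    define g where "g i x = (if j < length ((Q ! i) d) then (Q ! i) d ! j
       else x d (j - length ((Q ! i) d) + length ((P ! i) d)))" for i and x :: "nat \<Rightarrow> nat \<Rightarrow> bool"
    have g: "f x d j = g i x" if "i < length P" "x \<in> cone n (P ! i)" for i x
    proof -
      have "carries n f (P ! i) (Q ! i)" using f that by (auto simp: list_all2_conv_all_nth)
      then have "f x = prepend_tuple n (Q ! i) (drop_tuple n (P ! i) x)"
        using prepend_drop[OF that(2)] by (metis carries_def drop_closed)
      then show ?thesis using d by (simp add: prepend_tuple_def prepend_def drop_tuple_def g_def)
    qed
    have "openin (Gamma_top n) (cone n (P ! i) \<inter> {x \<in> Gamma n. g i x \<in> U})" for i
    proof (cases "j < length ((Q ! i) d)")
      case True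
      then have "cone n (P ! i) \<inter> {x \<in> Gamma n. g i x \<in> U} = (if (Q ! i) d ! j \<in> U then cone n (P ! i) else {})"
        using cone_subset by (auto simp: g_def)
      then show ?thesis by (simp add: openin_cone)
    next
      case False
      then show ?thesis using d by (auto simp: g_def intro!: openin_Int openin_cone openin_coordinate)
    qed
    then have "openin (Gamma_top n) (\<Union>i<length P. cone n (P ! i) \<inter> {x \<in> Gamma n. g i x \<in> U})"
      by blast
    also have "(\<Union>i<length P. cone n (P ! i) \<inter> {x \<in> Gamma n. g i x \<in> U}) = {x \<in> topspace (Gamma_top n). f x d j \<in> U}"
    proof (intro equalityI subsetI)
      fix x assume x: "x \<in> {x \<in> topspace (Gamma_top n). f x d j \<in> U}"
      then obtain i where "i < length P" "x \<in> cone n (P ! i)"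
        using tiling_cover[OF P, of x] by (auto simp: in_set_conv_nth)
      then show "x \<in> (\<Union>i<length P. cone n (P ! i) \<inter> {x \<in> Gamma n. g i x \<in> U})"
        using x g by auto
    qed (use g in auto)
    finally show "openin (Gamma_top n) {x \<in> topspace (Gamma_top n). f x d j \<in> U}" .
  qed simp
  then have "continuous_map (Gamma_top n) Cantor_space (\<lambda>x. f x d)" if "d < n" for d
    using that unfolding Cantor_space_def by (subst continuous_map_componentwise_UNIV) auto
  then show ?thesis
    using ext by (subst (2) Gamma_top_def) (auto simp: continuous_map_componentwise Gamma_def PiE_iff)
qed

lemma homeomorphic_tab:
  assumes "tiling n P" "tiling n Q" "length P = length Q"
  shows "homeomorphic_map (Gamma_top n) (Gamma_top n) (tab n P Q)"
proof -
  have "tab n Q P (tab n P Q x) = x" "tab n P Q (tab n Q P x) = x" if "x \<in> Gamma n" for x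
    using tab_inverse[of n P Q] tab_inverse[of n Q P] assms that by (metis compose_eq restrict_apply')+
  then have "homeomorphic_maps (Gamma_top n) (Gamma_top n) (tab n P Q) (tab n Q P)"
    using assms table_continuous[OF _ table_tab[of n P Q]] table_continuous[OF _ table_tab[of n Q P]]
    by (simp add: homeomorphic_maps_def)
  then show ?thesis by (rule homeomorphic_maps_imp_map)
qed

lemma tab_Bij:
  assumes "tiling n P" "tiling n Q" "length P = length Q"
  shows "tab n P Q \<in> Bij (Gamma n)"
proof -
  have "tab n P Q ` Gamma n = Gamma n \<and> inj_on (tab n P Q) (Gamma n)"
    using homeomorphic_tab[OF assms, unfolded homeomorphic_eq_everything_map] by (simp only: topspace_Gamma_top)
  then show ?thesis by (simp add: Bij_def bij_betw_def)
qed

section \<open>The group nV\<close>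

lemma nV_table: "tiling n P \<Longrightarrow> tiling n Q \<Longrightarrow> length P = length Q \<Longrightarrow> tab n P Q \<in> carrier (nV n)"
proof -
  assume PQ: "tiling n P" "tiling n Q" "length P = length Q"
  have part: "cone_partition n (length P) ((!) P)" if o: "tiling n P" for P
    unfolding cone_partition_def
  proof
    show "(\<Union>i<length P. cone n (P ! i)) = Gamma n"
    proof (intro equalityI subsetI)
      fix x assume "x \<in> Gamma n"
      then obtain a where "a \<in> set P" "x \<in> cone n a" using tiling_cover[OF o] by blast
      then show "x \<in> (\<Union>i<length P. cone n (P ! i))" by (auto simp: in_set_conv_nth)
    qed (use cone_subset in auto)
    show "disjoint_family_on (\<lambda>i. cone n (P ! i)) {..<length P}"
      using tiling_unique[OF o] by (auto simp: disjoint_family_on_def)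
  qed
  have "\<forall>i<length P. \<forall>w\<in>Gamma n. tab n P Q (prepend_tuple n (P ! i) w) = prepend_tuple n (Q ! i) w"
    using table_tab[OF PQ(1,3)] by (auto simp: list_all2_conv_all_nth carries_def)
  then have "\<exists>k \<alpha> \<beta>. cone_partition n k \<alpha> \<and> cone_partition n k \<beta> \<and>
           (\<forall>i<k. \<forall>w\<in>Gamma n. tab n P Q (prepend_tuple n (\<alpha> i) w) = prepend_tuple n (\<beta> i) w)"
    using part[OF PQ(1)] part[OF PQ(2)] PQ(3) by (intro exI[of _ "length P"] exI[of _ "(!) P"] exI[of _ "(!) Q"]) simp
  then show "tab n P Q \<in> carrier (nV n)"
    using tab_Bij[OF PQ] homeomorphic_tab[OF PQ] by (simp add: nV_def)
qed

text \<open>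
  Cells in a cone partition may have arbitrary values outside the first \<open>n\<close> coordinates.
\<close>

definition clip :: "nat \<Rightarrow> cell \<Rightarrow> cell" where
  "clip n a = (\<lambda>d. if d < n then a d else [])"

lemma clip_props: "prepend_tuple n (clip n a) = prepend_tuple n a" "cone n (clip n a) = cone n a" "wf_cell n (clip n a)"
  by (auto simp: clip_def prepend_tuple_def fun_eq_iff cone_def wf_cell_def)

lemma tiling_clip:
  assumes "cone_partition n k \<alpha>" shows "tiling n (map (\<lambda>i. clip n (\<alpha> i)) [0..<k])"
proof -
  have "cell_disj n (clip n (\<alpha> i)) (clip n (\<alpha> j))" if "i < j" "j < k" for i j
    using assms that
    by (auto simp: cone_partition_def disjoint_family_on_def clip_props cone_disjoint_iff[symmetric])
  moreover have "\<exists>i<k. x \<in> cone n (\<alpha> i)" if "x \<in> Gamma n" for x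
    using assms that unfolding cone_partition_def by blast
  ultimately show ?thesis
    by (fastforce simp: tiling_def disjoint_cells_def sorted_wrt_iff_nth_less clip_props)
qed

lemma nV_E:
  assumes "f \<in> carrier (nV n)"
  obtains P Q where "tiling n P" "tiling n Q" "table n f P Q"
proof -
  obtain k \<alpha> \<beta> where k: "cone_partition n k \<alpha>" "cone_partition n k \<beta>"
    "\<And>i w. i < k \<Longrightarrow> w \<in> Gamma n \<Longrightarrow> f (prepend_tuple n (\<alpha> i) w) = prepend_tuple n (\<beta> i) w"
    using assms by (auto simp: nV_def)
  have "table n f (map (\<lambda>i. clip n (\<alpha> i)) [0..<k]) (map (\<lambda>i. clip n (\<beta> i)) [0..<k])"
    using k by (auto simp: list_all2_conv_all_nth carries_def clip_props)
  then show ?thesis using that tiling_clip k by blast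
qed

lemma nV_Bij: "f \<in> carrier (nV n) \<Longrightarrow> f \<in> Bij (Gamma n)"
  by (simp add: nV_def)

lemma nV_ext: "f \<in> carrier (nV n) \<Longrightarrow> f \<in> extensional (Gamma n)"
  by (rule Bij_imp_extensional[OF nV_Bij])

lemma nV_mult: "f \<in> carrier (nV n) \<Longrightarrow> g \<in> carrier (nV n) \<Longrightarrow> f \<otimes>\<^bsub>nV n\<^esub> g = compose (Gamma n) f g"
proof -
  assume "f \<in> carrier (nV n)" "g \<in> carrier (nV n)"
  then have "f \<in> Bij (Gamma n)" "g \<in> Bij (Gamma n)" by (auto dest: nV_Bij)
  then show ?thesis by (simp add: nV_def BijGroup_def)
qed

lemma nV_one: "\<one>\<^bsub>nV n\<^esub> = (\<lambda>x\<in>Gamma n. x)"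
  by (simp add: nV_def BijGroup_def)

lemma table_lengths: "table n f P Q \<Longrightarrow> length P = length Q"
  by (rule list_all2_lengthD)

lemma nV_eq_tab: "f \<in> carrier (nV n) \<Longrightarrow> tiling n P \<Longrightarrow> table n f P Q \<Longrightarrow> f = tab n P Q"
  using table_unique[of n P f Q "tab n P Q"] nV_ext table_tab table_lengths by simp

text \<open>
  A cell \<open>c\<close> at depth \<open>M\<close> contains the point that continues it by zeros. The
  cell of the tiling around this point is not deeper than \<open>c\<close>, hence it contains
  \<open>c\<close>.
\<close>

lemma tiling_grid:
  assumes P: "tiling n P" "within_depth n M P"
  shows "grid n M P = {c. wf_cell n c \<and> (\<forall>d<n. length (c d) = M)}"
proof -
  have "\<exists>a\<in>set P. \<forall>d. prefix (a d) (c d)" if c: "wf_cell n c" "\<forall>d<n. length (c d) = M" for c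
  proof -
    define x where "x = prepend_tuple n c (\<lambda>d\<in>{..<n}. \<lambda>j. False)"
    have x: "x \<in> cone n c" by (auto simp: x_def cone_def Gamma_def)
    obtain a where a: "a \<in> set P" "x \<in> cone n a"
      using tiling_cover[OF P(1)] by (metis cone_subset subsetD x)
    have "prefix (a d) (c d)" for d
    proof (cases "d < n")
      case True
      then have l: "length (a d) \<le> length (c d)" using P a c by (auto simp: within_depth_def)
      moreover have "a d ! j = c d ! j" if "j < length (a d)" for j
        using a x that True l by (auto simp: cone_iff)
      ultimately have "a d = take (length (a d)) (c d)" by (intro nth_equalityI) auto
      then show ?thesis by (metis take_is_prefix)
    next
      case False
      then have "a d = []" using a P by (auto simp: tiling_def disjoint_cells_def wf_cell_def)
      then show ?thesis by simp
    qed
    then show ?thesis using a by blast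
  qed
  then show ?thesis by (auto simp: grid_def)
qed

text \<open>
  The two tilings have the same grid at a depth that bounds them both.
\<close>

lemma common_refinement:
  assumes P: "tiling n P" "tiling n Q"
  obtains ms ms' where "valid n (length P) ms" "valid n (length Q) ms'" "run ms P = run ms' Q"
proof -
  obtain M where M: "within_depth n M P" "within_depth n M Q"
    using ex_within_depth[of n P] ex_within_depth[of n Q] by (metis linear)
  obtain ms where ms: "valid n (length P) ms" "at_depth n M (run ms P)" using run_to_at_depth[OF M(1)] by blast
  have o: "tiling n (run ms P)" using tiling_run P ms by blast
  have "set (run ms P) = grid n M Q"
    using grid_at_depth[OF ms(2) tiling_disjoint_cells[OF o]] tiling_grid[OF o within_depth_if_at_depth[OF ms(2)]] tiling_grid[OF P(2) M(2)] by simp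
  then obtain ms' where "valid n (length Q) ms'" "run ms' Q = run ms P"
    using run_to_grid[OF tiling_disjoint_cells[OF P(2)] M(2) tiling_disjoint_cells[OF o] ms(2)] by blast
  then show ?thesis using that ms by metis
qed

lemma nV_compose:
  assumes "f \<in> carrier (nV n)" "g \<in> carrier (nV n)"
  shows "compose (Gamma n) g f \<in> carrier (nV n)"
proof -
  obtain P Q where f: "tiling n P" "tiling n Q" "table n f P Q" using nV_E[OF assms(1)] by blast
  obtain P' Q' where g: "tiling n P'" "tiling n Q'" "table n g P' Q'" using nV_E[OF assms(2)] by blast
  obtain ms ms' where ms: "valid n (length Q) ms" "valid n (length P') ms'" "run ms Q = run ms' P'"
    using common_refinement f g by blast
  let ?P = "run ms P" and ?Q = "run ms' Q'"
  have t: "table n (compose (Gamma n) g f) ?P ?Q"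
  proof (rule table_compose)
    show "table n f ?P (run ms Q)" using table_run[OF f(3), of ms] ms(1) table_lengths[OF f(3)] by simp
    show "table n g (run ms Q) ?Q" using table_run[OF g(3), of ms'] ms(2) by (simp add: ms(3))
  qed
  have o: "tiling n ?P" "tiling n ?Q"
    using tiling_run[OF f(1), of ms] tiling_run[OF g(2), of ms'] ms table_lengths[OF f(3)] table_lengths[OF g(3)]
    by simp_all
  have "compose (Gamma n) g f = tab n ?P ?Q"
    using table_unique[OF o(1) t table_tab[OF o(1) table_lengths[OF t]]] by (simp add: compose_def)
  then show ?thesis using nV_table[OF o table_lengths[OF t]] by simp
qed

lemma group_nV: "group (nV n)"
proof -
  interpret B: group "BijGroup (Gamma n)" by (rule group_BijGroup)
  have "subgroup (carrier (nV n)) (BijGroup (Gamma n))"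
  proof (rule B.subgroupI)
    show "carrier (nV n) \<subseteq> carrier (BijGroup (Gamma n))"
      by (auto simp: BijGroup_def dest: nV_Bij)
    have "tiling n [\<lambda>_. []]"
      by (auto simp: tiling_def disjoint_cells_def wf_cell_def cone_iff)
    then have "tab n [\<lambda>_. []] [\<lambda>_. []] \<in> carrier (nV n)" by (intro nV_table) auto
    then show "carrier (nV n) \<noteq> {}" by blast
  next
    fix f assume f: "f \<in> carrier (nV n)"
    obtain P Q where PQ: "tiling n P" "tiling n Q" "table n f P Q" using nV_E[OF f] by blast
    have l: "length P = length Q" using table_lengths PQ by blast
    have "f = tab n P Q" using nV_eq_tab f PQ by blast
    then have "tab n Q P \<otimes>\<^bsub>BijGroup (Gamma n)\<^esub> f = \<one>\<^bsub>BijGroup (Gamma n)\<^esub>"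
      using tab_inverse[OF PQ(1,2) l] tab_Bij PQ l by (simp add: BijGroup_def)
    then have "inv\<^bsub>BijGroup (Gamma n)\<^esub> f = tab n Q P"
      using tab_Bij[of n Q P] PQ l nV_Bij[OF f] by (intro B.inv_equality) (simp_all add: BijGroup_def)
    then show "inv\<^bsub>BijGroup (Gamma n)\<^esub> f \<in> carrier (nV n)" using nV_table PQ l by simp
  next
    fix f g assume "f \<in> carrier (nV n)" "g \<in> carrier (nV n)"
    then show "f \<otimes>\<^bsub>BijGroup (Gamma n)\<^esub> g \<in> carrier (nV n)"
      using nV_compose[of g n f] nV_Bij[of f n] nV_Bij[of g n] by (simp add: BijGroup_def)
  qed
  then have "group (BijGroup (Gamma n)\<lparr>carrier := carrier (nV n)\<rparr>)"
    by (rule B.subgroup_imp_group)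
  then show ?thesis by (simp add: nV_def)
qed

section \<open>Generators of nV and their action on tables\<close>

definition chart :: "nat \<Rightarrow> cell list \<Rightarrow> (nat \<Rightarrow> nat \<Rightarrow> bool) \<Rightarrow> nat \<Rightarrow> nat \<Rightarrow> bool" where
  "chart n P = tab n P (comb (length P))"

definition swp_el :: "nat \<Rightarrow> nat \<Rightarrow> nat \<Rightarrow> (nat \<Rightarrow> nat \<Rightarrow> bool) \<Rightarrow> nat \<Rightarrow> nat \<Rightarrow> bool" where
  "swp_el n k i = tab n (swp i (comb k)) (comb k)"

definition split_el :: "nat \<Rightarrow> nat \<Rightarrow> (nat \<Rightarrow> nat \<Rightarrow> bool) \<Rightarrow> nat \<Rightarrow> nat \<Rightarrow> bool" where
  "split_el n d = tab n (run [Spl d] (comb 3)) (comb 4)"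

text \<open>
  The value for \<open>l \<ge> n + 3\<close> only keeps \<open>nV_gen n\<close> inside the group for all
  letters.
\<close>

definition nV_gen :: "nat \<Rightarrow> nat \<Rightarrow> (nat \<Rightarrow> nat \<Rightarrow> bool) \<Rightarrow> nat \<Rightarrow> nat \<Rightarrow> bool" where
  "nV_gen n l = (if l = 0 then swp_el n 3 0 else if l = 1 then swp_el n 4 1
     else if l = 2 then swp_el n 3 1 else if l < n + 3 then split_el n (l - 3) else \<one>\<^bsub>nV n\<^esub>)"

lemma tiling_comb: assumes "n \<ge> 1" "k \<ge> 1" shows "tiling n (comb k)"
proof -
  have "tiling n (comb (Suc m))" for m
  proof (induction m)
    case 0
    then show ?case using assms
      by (auto simp: comb_def tiling_def disjoint_cells_def wf_cell_def comb_end_def cone_iff)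
  next
    case (Suc m)
    have "tiling n (comb_end m # map comb_cell [0..<m])"
      using Suc by (rule tiling_mset) (simp add: comb_Suc')
    then have "tiling n (run [Spl 0] (comb_end m # map comb_cell [0..<m]))"
      using assms by (intro tiling_run) auto
    then show ?case by (rule tiling_mset) (simp add: comb_Suc)
  qed
  then show ?thesis using assms by (cases k) auto
qed

lemma tiling_nonempty: "tiling n P \<Longrightarrow> 1 \<le> length P"
proof -
  assume P: "tiling n P"
  have "(\<lambda>d\<in>{..<n}. \<lambda>j. False) \<in> Gamma n" by (auto simp: Gamma_def)
  then obtain a where "a \<in> set P" using tiling_cover[OF P] by blast
  then show ?thesis by (cases P) auto
qed

lemma tab_mult:
  assumes "tiling n P" "tiling n Q" "tiling n R" "length P = length Q" "length Q = length R"
  shows "tab n Q R \<otimes>\<^bsub>nV n\<^esub> tab n P Q = tab n P R"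
proof -
  have c: "tab n Q R \<in> carrier (nV n)" "tab n P Q \<in> carrier (nV n)" using assms nV_table by auto
  have "table n (compose (Gamma n) (tab n Q R) (tab n P Q)) P R"
    using assms by (intro table_compose[of n _ P Q] table_tab) auto
  then have "compose (Gamma n) (tab n Q R) (tab n P Q) = tab n P R"
    using assms by (intro table_unique[of n P _ R]) (auto simp: compose_def table_tab)
  then show ?thesis using nV_mult[OF c] by simp
qed

lemma tab_id: "tiling n P \<Longrightarrow> tab n P P = \<one>\<^bsub>nV n\<^esub>"
  using table_unique[of n P "tab n P P" P "\<lambda>x\<in>Gamma n. x"] table_tab[of n P P] id_table by (simp add: nV_one)

lemma tab_run:
  assumes "tiling n P" "length P = length Q" "valid n (length P) ms"
  shows "tab n P Q = tab n (run ms P) (run ms Q)"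
proof (rule table_unique)
  show "table n (tab n P Q) (run ms P) (run ms Q)" using assms table_tab table_run by blast
  show "table n (tab n (run ms P) (run ms Q)) (run ms P) (run ms Q)"
    using assms length_run[of n P ms] length_run[of n Q ms] tiling_run by (intro table_tab) auto
qed (use assms tiling_run in auto)

lemma swp_el_closed: "n \<ge> 1 \<Longrightarrow> k \<ge> 1 \<Longrightarrow> swp_el n k i \<in> carrier (nV n)"
  unfolding swp_el_def using tiling_comb tiling_mset[of n "comb k" "swp i (comb k)"] by (intro nV_table) auto

lemma tiling_half: "tiling n (a # P) \<Longrightarrow> d < n \<Longrightarrow> tiling n (half a d False # half a d True # P)"
  using tiling_run[of n "a # P" "[Spl d]"] by simp

lemma comb_Cons: "k \<ge> 2 \<Longrightarrow> \<exists>P. comb k = comb_cell 0 # P \<and> length P = k - 1"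
  by (cases k; cases "k - 1") (auto simp: comb_def upt_conv_Cons simp del: upt_Suc)

lemma split_el_closed: "n \<ge> 1 \<Longrightarrow> d < n \<Longrightarrow> split_el n d \<in> carrier (nV n)"
  unfolding split_el_def using length_run[of n "comb 3" "[Spl d]"] tiling_comb tiling_run[of n "comb 3" "[Spl d]"]
  by (intro nV_table) auto

lemma nV_gen_closed: "n \<ge> 1 \<Longrightarrow> nV_gen n l \<in> carrier (nV n)"
  using swp_el_closed[of n] split_el_closed[of n] group.is_monoid[OF group_nV, THEN monoid.one_closed]
  by (simp add: nV_gen_def)

lemma ev_nV_gen_closed: "n \<ge> 1 \<Longrightarrow> ev (nV n) (nV_gen n) w \<in> carrier (nV n)"
  using group.ev_closed[OF group_nV, of "nV_gen n"] nV_gen_closed by simp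

lemma table_snoc:
  "n \<ge> 1 \<Longrightarrow> table n f (P @ [a]) (Q @ [b]) \<Longrightarrow>
    table n f (P @ [half a 0 False, half a 0 True]) (Q @ [half b 0 False, half b 0 True])"
  using list_all2_lengthD[of "carries n f" "P @ [a]" "Q @ [b]"]
  by (auto simp: list_all2_append carries_half)

lemma swp_append: "Suc i < length P \<Longrightarrow> swp i (P @ Q) = swp i P @ Q"
  by (induction i P rule: swp.induct) auto

lemma comb_split_end: "k \<ge> 1 \<Longrightarrow> comb k = map comb_cell [0..<k - 1] @ [comb_end (k - 1)] \<and>
   comb (Suc k) = map comb_cell [0..<k - 1] @ [half (comb_end (k - 1)) 0 False, half (comb_end (k - 1)) 0 True]"
  by (cases k) (auto simp: comb_Suc comb_Suc' half_comb_end)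

text \<open>
  Splitting the last cell of the comb, in the source and in the target of the table, gives the table for
  the longer comb. The exchange does not involve this cell.
\<close>

lemma swp_el_Suc: assumes "n \<ge> 1" "i + 2 < k" shows "swp_el n (Suc k) i = swp_el n k i"
proof -
  let ?C = "map comb_cell [0..<k - 1]" and ?e = "comb_end (k - 1)"
  have c: "comb k = ?C @ [?e]" "comb (Suc k) = ?C @ [half ?e 0 False, half ?e 0 True]"
    using comb_split_end[of k] assms by simp_all
  have s: "swp i (comb k) = swp i ?C @ [?e]" "swp i (comb (Suc k)) = swp i ?C @ [half ?e 0 False, half ?e 0 True]"
    using assms by (auto simp: c swp_append)
  have o: "tiling n (swp i (comb k))" "tiling n (swp i (comb (Suc k)))"
    using tiling_comb assms tiling_mset[of n "comb k" "swp i (comb k)"]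
      tiling_mset[of n "comb (Suc k)" "swp i (comb (Suc k))"] by auto
  have "table n (swp_el n k i) (swp i (comb k)) (comb k)"
    unfolding swp_el_def using o assms by (intro table_tab) auto
  then have "table n (swp_el n k i) (swp i (comb (Suc k))) (comb (Suc k))"
    using table_snoc[OF assms(1), of "swp_el n k i" "swp i ?C" ?e ?C ?e] by (metis s c)
  then show ?thesis
    using o assms nV_eq_tab swp_el_closed[of n k i] by (simp add: swp_el_def)
qed

lemma swp_el_ge: assumes "n \<ge> 1" "i + 2 < k" "k \<le> k'" shows "swp_el n k' i = swp_el n k i"
  using assms(3)
proof (induction rule: dec_induct)
  case (step m)
  then show ?case using swp_el_Suc[OF assms(1), of i m] assms(2) by simp
qed simp

text \<open>
  Splitting the last cell of the comb in the source and in the target of the table leads from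
  \<open>k\<close> to \<open>k + 1\<close> cells.
\<close>

lemma split_el_eq: assumes "n \<ge> 1" "d < n" "k \<ge> 3" shows "split_el n d = tab n (run [Spl d] (comb k)) (comb (Suc k))"
  using assms(3)
proof (induction rule: dec_induct)
  case base
  then show ?case by (simp add: split_el_def)
next
  case (step k)
  let ?C = "map comb_cell [0..<k - 1]" and ?e = "comb_end (k - 1)" and ?e' = "comb_end k"
  have c: "comb k = ?C @ [?e]" "comb (Suc k) = ?C @ [half ?e 0 False, half ?e 0 True]"
    "comb (Suc k) = map comb_cell [0..<k] @ [?e']"
    "comb (Suc (Suc k)) = map comb_cell [0..<k] @ [half ?e' 0 False, half ?e' 0 True]"
    using comb_split_end[of k] comb_split_end[of "Suc k"] step by auto
  obtain a B where aB: "?C = a # B" using step by (cases ?C) auto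
  have o: "tiling n (run [Spl d] (comb k))" "tiling n (run [Spl d] (comb (Suc k)))"
    using tiling_comb assms step by (auto intro: tiling_run)
  have l: "length (run [Spl d] (comb k)) = length (comb (Suc k))"
    "length (run [Spl d] (comb (Suc k))) = length (comb (Suc (Suc k)))"
    using length_run[of n "comb k" "[Spl d]"] length_run[of n "comb (Suc k)" "[Spl d]"] assms step by auto
  have r: "run [Spl d] (comb k) = (half a d False # half a d True # B) @ [?e]"
    "run [Spl d] (comb (Suc k)) = (half a d False # half a d True # B) @ [half ?e 0 False, half ?e 0 True]"
    unfolding c(1,2) aB by simp_all
  have "table n (split_el n d) (run [Spl d] (comb k)) (comb (Suc k))"
    unfolding step.IH using o l by (intro table_tab) auto
  then have "table n (split_el n d) ((half a d False # half a d True # B) @ [?e]) (map comb_cell [0..<k] @ [?e'])"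
    by (simp only: r(1) flip: c(3))
  from table_snoc[OF assms(1) this]
  have "table n (split_el n d) (run [Spl d] (comb (Suc k))) (comb (Suc (Suc k)))"
    by (simp only: r(2) c(4))
  then show ?case using nV_eq_tab[OF split_el_closed o(2)] assms by simp
qed

text \<open>
  A table can be permuted in both of its columns at once, so the chart of \<open>P\<close> is also given
  by the exchanged list \<open>P\<close> and the exchanged comb. The factor \<open>swp_el\<close> carries
  the latter to the comb.
\<close>

lemma swp_el_chart:
  assumes "n \<ge> 1" "tiling n P" "Suc i < length P" "length P = k"
  shows "swp_el n k i \<otimes>\<^bsub>nV n\<^esub> chart n P = chart n (swp i P)"
proof -
  have c: "tiling n (comb k)" "length (comb k) = k" using tiling_comb assms by auto
  have o: "tiling n (swp i P)" "tiling n (swp i (comb k))"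
    using assms c tiling_mset[of n P "swp i P"] tiling_mset[of n "comb k" "swp i (comb k)"] by auto
  have "chart n P = tab n (swp i P) (swp i (comb k))"
    using tab_run[of n P "comb k" "[Swp i]"] assms c by (simp add: chart_def)
  then show ?thesis
    using tab_mult[of n "swp i P" "swp i (comb k)" "comb k"] assms c o by (simp add: swp_el_def chart_def)
qed

lemma split_el_chart:
  assumes "n \<ge> 1" "tiling n P" "3 \<le> length P" "d < n"
  shows "split_el n d \<otimes>\<^bsub>nV n\<^esub> chart n P = chart n (run [Spl d] P)"
proof -
  let ?k = "length P"
  have c: "tiling n (comb ?k)" "length (comb ?k) = ?k" "tiling n (comb (Suc ?k))"
    using tiling_comb assms by auto
  have v: "valid n ?k [Spl d]" using assms by (cases P) auto
  have o: "tiling n (run [Spl d] P)" "tiling n (run [Spl d] (comb ?k))"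
    using c v tiling_run[OF assms(2) v] tiling_run[of n "comb ?k" "[Spl d]"] by simp_all
  have l: "length (run [Spl d] P) = Suc ?k" "length (run [Spl d] (comb ?k)) = Suc ?k"
    using length_run[OF v] length_run[of n "comb ?k" "[Spl d]"] v c by auto
  have "chart n P = tab n (run [Spl d] P) (run [Spl d] (comb ?k))"
    using tab_run[of n P "comb ?k" "[Spl d]"] assms c v by (simp add: chart_def)
  then show ?thesis
    using tab_mult[OF o c(3)] l c assms split_el_eq[of n d ?k] by (simp add: chart_def)
qed

lemma chart_comb: "n \<ge> 1 \<Longrightarrow> k \<ge> 1 \<Longrightarrow> chart n (comb k) = \<one>\<^bsub>nV n\<^esub>"
  using tiling_comb by (simp add: chart_def tab_id)

lemma chart_closed: "n \<ge> 1 \<Longrightarrow> tiling n P \<Longrightarrow> chart n P \<in> carrier (nV n)"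
  unfolding chart_def using tiling_comb tiling_nonempty by (intro nV_table) auto

text \<open>
  Applied to the comb, whose chart is trivial, both sides describe the same tiling.
\<close>

lemma split_swp:
  assumes "n \<ge> 1" "d < n" "1 \<le> i" "Suc i < k" 
  shows "split_el n d \<otimes>\<^bsub>nV n\<^esub> swp_el n k i = swp_el n (Suc k) (Suc i) \<otimes>\<^bsub>nV n\<^esub> split_el n d"
proof -
  interpret nV: group "nV n" by (rule group_nV)
  obtain j where j: "i = Suc j" using assms by (cases i) auto
  obtain P where P: "comb k = comb_cell 0 # P" "length P = k - 1" using comb_Cons[of k] assms by auto
  have o: "tiling n (comb k)" using tiling_comb assms by auto
  then have o1: "tiling n (swp i (comb k))" using tiling_mset[of n "comb k" "swp i (comb k)"] by simp
  have o2: "tiling n (run [Spl d] (comb k))" and l2: "length (run [Spl d] (comb k)) = Suc k"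
    using o tiling_run[of n "comb k" "[Spl d]"] length_run[of n "comb k" "[Spl d]"] assms by auto
  note closed = swp_el_closed[OF assms(1)] split_el_closed[OF assms(1,2)]
  have "split_el n d \<otimes>\<^bsub>nV n\<^esub> swp_el n k i = split_el n d \<otimes>\<^bsub>nV n\<^esub> (swp_el n k i \<otimes>\<^bsub>nV n\<^esub> chart n (comb k))"
    using chart_comb closed assms by simp
  also have "\<dots> = chart n (run [Spl d] (swp i (comb k)))"
    using assms o o1 by (simp add: swp_el_chart split_el_chart del: run.simps)
  also have "run [Spl d] (swp i (comb k)) = swp (Suc i) (run [Spl d] (comb k))"
    by (simp add: P j)
  also have "chart n \<dots> = swp_el n (Suc k) (Suc i) \<otimes>\<^bsub>nV n\<^esub> (split_el n d \<otimes>\<^bsub>nV n\<^esub> chart n (comb k))"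
    using assms o o2 l2 by (simp add: swp_el_chart split_el_chart del: run.simps)
  also have "\<dots> = swp_el n (Suc k) (Suc i) \<otimes>\<^bsub>nV n\<^esub> split_el n d"
    using chart_comb closed assms by simp
  finally show ?thesis .
qed

lemma nV_gen_simps:
  "nV_gen n 0 = swp_el n 3 0" "nV_gen n 1 = swp_el n 4 1" "nV_gen n (Suc 0) = swp_el n 4 1" "nV_gen n 2 = swp_el n 3 1"
  "n \<ge> 1 \<Longrightarrow> nV_gen n 3 = split_el n 0" "d < n \<Longrightarrow> nV_gen n (3 + d) = split_el n d"
  by (simp_all add: nV_gen_def)

lemma ev_T_word:
  assumes n: "n \<ge> 1"
  shows "i + 2 < k \<Longrightarrow> ev (nV n) (nV_gen n) (T_word i) = swp_el n k i"
proof (induction i arbitrary: k)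
  interpret nV: group "nV n" by (rule group_nV)
  case 0
  then show ?case using swp_el_ge[OF n, of 0 3 k] n
    by (simp add: ev_Cons nV_gen_simps swp_el_closed)
next
  interpret nV: group "nV n" by (rule group_nV)
  note closed = nV_gen_closed[OF n] swp_el_closed[OF n] split_el_closed[OF n]
  case (Suc i)
  show ?case
  proof (cases i)
    case 0
    then show ?thesis using swp_el_ge[OF n, of 1 4 k] n Suc.prems closed
      by (simp add: ev_Cons nV_gen_simps)
  next
    case (Suc j)
    obtain k' where k': "k = Suc k'" "i + 2 < k'" using Suc.prems by (cases k) auto
    have "replicate (Suc j) (3::nat, False) = replicate j (3, False) @ [(3, False)]"
      by (metis replicate_Suc replicate_append_same)
    then have "T_word (Suc i) = [(3, True)] @ T_word i @ [(3, False)]" by (simp add: Suc)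
    then have "ev (nV n) (nV_gen n) (T_word (Suc i)) =
        split_el n 0 \<otimes>\<^bsub>nV n\<^esub> (ev (nV n) (nV_gen n) (T_word i) \<otimes>\<^bsub>nV n\<^esub> inv\<^bsub>nV n\<^esub> split_el n 0)"
      using closed n by (simp add: nV.ev_append ev_Cons nV_gen_simps del: T_word.simps)
    also have "\<dots> = (split_el n 0 \<otimes>\<^bsub>nV n\<^esub> swp_el n k' i) \<otimes>\<^bsub>nV n\<^esub> inv\<^bsub>nV n\<^esub> split_el n 0"
      using Suc.IH[OF k'(2)] closed n k' by (simp add: nV.m_assoc)
    also have "\<dots> = swp_el n k (Suc i)"
      using split_swp[OF n, of 0 i k'] closed n k' Suc by (simp add: nV.m_assoc)
    finally show ?thesis .
  qed
qed

lemma ev_S_word: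
  assumes n: "n \<ge> 1"
  shows "i \<ge> 1 \<Longrightarrow> ev (nV n) (nV_gen n) (S_word i) = swp_el n (i + 2) i"
proof (induction i)
  interpret nV: group "nV n" by (rule group_nV)
  note closed = nV_gen_closed[OF n] swp_el_closed[OF n] split_el_closed[OF n]
  case (Suc i)
  show ?case
  proof (cases i)
    case 0
    then show ?thesis using n closed by (simp add: ev_Cons nV_gen_simps S_word_def numeral_3_eq_3)
  next
    case (Suc j)
    have "replicate (Suc j) (3::nat, False) = replicate j (3, False) @ [(3, False)]"
      by (metis replicate_Suc replicate_append_same)
    then have "S_word (Suc i) = [(3, True)] @ S_word i @ [(3, False)]" by (simp add: Suc S_word_def)
    then have "ev (nV n) (nV_gen n) (S_word (Suc i)) =
        split_el n 0 \<otimes>\<^bsub>nV n\<^esub> (ev (nV n) (nV_gen n) (S_word i) \<otimes>\<^bsub>nV n\<^esub> inv\<^bsub>nV n\<^esub> split_el n 0)"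
      using closed n by (simp add: nV.ev_append ev_Cons nV_gen_simps)
    also have "\<dots> = (split_el n 0 \<otimes>\<^bsub>nV n\<^esub> swp_el n (i + 2) i) \<otimes>\<^bsub>nV n\<^esub> inv\<^bsub>nV n\<^esub> split_el n 0"
      using Suc.IH closed n Suc by (simp add: nV.m_assoc)
    also have "\<dots> = swp_el n (Suc i + 2) (Suc i)"
      using split_swp[OF n, of 0 i "i + 2"] closed n Suc by (simp add: nV.m_assoc)
    finally show ?thesis .
  qed
qed simp

lemma ev_swap_word:
  assumes "n \<ge> 1" "Suc i < k" "k \<ge> 3" shows "ev (nV n) (nV_gen n) (swap_word k i) = swp_el n k i"
  using assms ev_T_word[of n i k] ev_S_word[of n i] 
  by (cases "i + 2 < k") (auto simp: swap_word_def dest: le_antisym intro: arg_cong[of _ _ "\<lambda>k. swp_el n k i"])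

text \<open>
  This is the link between words and tilings: multiplying a chart by the word of some moves makes the
  moves.
\<close>

theorem word_chart:
  assumes n: "n \<ge> 1"
  shows "tiling n P \<Longrightarrow> length P = k \<Longrightarrow> k \<ge> 3 \<Longrightarrow> valid n k ms \<Longrightarrow>
    ev (nV n) (nV_gen n) (word k ms) \<otimes>\<^bsub>nV n\<^esub> chart n P = chart n (run ms P)"
proof (induction k ms arbitrary: P rule: word.induct)
  interpret nV: group "nV n" by (rule group_nV)
  case (1 k)
  then show ?case using chart_closed[OF n] by simp
next
  interpret nV: group "nV n" by (rule group_nV)
  note ev_closed = ev_nV_gen_closed[OF n]
  case (2 k i ms)
  have o: "tiling n (swp i P)" using 2 tiling_mset[of n P "swp i P"] by simp
  have "ev (nV n) (nV_gen n) (word k (Swp i # ms)) \<otimes>\<^bsub>nV n\<^esub> chart n P =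
    ev (nV n) (nV_gen n) (word k ms) \<otimes>\<^bsub>nV n\<^esub> (ev (nV n) (nV_gen n) (swap_word k i) \<otimes>\<^bsub>nV n\<^esub> chart n P)"
    using 2 ev_closed chart_closed[OF n] by (simp add: nV.ev_append nV_gen_closed[OF n] nV.m_assoc)
  also have "\<dots> = ev (nV n) (nV_gen n) (word k ms) \<otimes>\<^bsub>nV n\<^esub> chart n (swp i P)"
    using 2 n by (simp add: ev_swap_word swp_el_chart)
  also have "\<dots> = chart n (run ms (swp i P))" using 2 o by (intro 2) auto
  finally show ?case by simp
next
  interpret nV: group "nV n" by (rule group_nV)
  note ev_closed = ev_nV_gen_closed[OF n]
  case (3 k d ms)
  have o: "tiling n (run [Spl d] P)" "length (run [Spl d] P) = Suc k"
    using 3 tiling_run[of n P "[Spl d]"] length_run[of n P "[Spl d]"] by auto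
  have "ev (nV n) (nV_gen n) (word k (Spl d # ms)) \<otimes>\<^bsub>nV n\<^esub> chart n P =
    ev (nV n) (nV_gen n) (word (Suc k) ms) \<otimes>\<^bsub>nV n\<^esub> (split_el n d \<otimes>\<^bsub>nV n\<^esub> chart n P)"
    using 3 ev_closed chart_closed[OF n] nV_gen_closed[OF n, of "3 + d"]
    by (simp add: nV.ev_append nV_gen_closed[OF n] nV.m_assoc ev_Cons nV_gen_simps del: add_Suc)
  also have "\<dots> = ev (nV n) (nV_gen n) (word (Suc k) ms) \<otimes>\<^bsub>nV n\<^esub> chart n (run [Spl d] P)"
    using 3 n by (simp add: split_el_chart del: run.simps)
  also have "\<dots> = chart n (run ms (run [Spl d] P))" using 3 o by (intro 3) auto
  also have "run ms (run [Spl d] P) = run (Spl d # ms) P"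
    using run_append[of n P "[Spl d]" ms] 3 by simp
  finally show ?case .
qed

lemma comb_numerals:
  "comb 3 = [comb_cell 0, comb_cell 1, comb_end 2]"
  "comb 4 = [comb_cell 0, comb_cell 1, comb_cell 2, comb_end 3]"
  "comb 5 = [comb_cell 0, comb_cell 1, comb_cell 2, comb_cell 3, comb_end 4]"
  "comb 6 = [comb_cell 0, comb_cell 1, comb_cell 2, comb_cell 3, comb_cell 4, comb_end 5]"
  by (simp_all add: comb_def upt_rec eval_nat_numeral)

lemma swp_numeral [simp]: "swp (numeral m) (a # P) = a # swp (pred_numeral m) P"
  by (simp add: numeral_eq_Suc)

lemma rels_run:
  assumes r: "(k, ms, k', ms') \<in> set (rels n)"
  shows "run ms (comb k) = run ms' (comb k')"
proof -
  consider "(k, ms, k', ms') \<in> set const_rels" | d where "(k, ms, k', ms') \<in> set (shift_rels d)"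
    | d e where "(k, ms, k', ms') = (if d \<le> e then two_cells_rel d e else one_cell_rel e d)"
    using r unfolding rels_def by auto
  then show ?thesis
  proof cases
    case 1
    have e: "half (comb_end 2) 0 False = comb_cell 2" "half (comb_end 2) 0 True = comb_end 3"
      using half_comb_end[of 2] by (simp_all add: numeral_3_eq_3 numeral_2_eq_2)
    have "\<forall>(k, ms, k', ms')\<in>set const_rels. run ms (comb k) = run ms' (comb k')"
      by (simp add: const_rels_def split1_def comb_numerals e)
    with 1 show ?thesis by fast
  next
    case 2
    have "\<forall>(k, ms, k', ms')\<in>set (shift_rels d). run ms (comb k) = run ms' (comb k')"
      by (simp add: shift_rels_def comb_numerals)
    with 2 show ?thesis by fast
  next
    case 3
    then show ?thesis
      by (cases "d = e") (auto simp: two_cells_rel_def one_cell_rel_def comb_numerals half_comm[of d e] split: if_splits)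
  qed
qed

lemma acts_left_mult_out: "group G \<Longrightarrow> (\<And>l. f l \<in> carrier G) \<Longrightarrow> x \<notin> carrier G \<Longrightarrow> acts (\<lambda>l. left_mult G (f l)) w x = x"
proof (induction w)
  case (Cons a w)
  then show ?case by (cases a) (simp add: group.inv_left_mult left_mult_def[of _ _ x])
qed simp

lemma thompson_action_left_mult:
  assumes n: "n \<ge> 1" and G: "group G" and f: "\<And>l. f l \<in> carrier G"
    and rel: "\<And>k ms k' ms'. (k, ms, k', ms') \<in> set (rels n) \<Longrightarrow> ev G f (word k ms) = ev G f (word k' ms')"
  shows "thompson_action n (\<lambda>l. left_mult G (f l))"
proof -
  interpret G: group G by (rule G)
  show ?thesis
  proof
    show "bij (left_mult G (f i))" for i using f by (rule G.bij_left_mult)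
    show "acts (\<lambda>l. left_mult G (f l)) (word k ms) x = acts (\<lambda>l. left_mult G (f l)) (word k' ms') x"
      if "(k, ms, k', ms') \<in> set (rels n)" for k ms k' ms' x
      using rel[OF that] G.acts_left_mult[of f, OF f] acts_left_mult_out[of G f, OF G f]
      by (cases "x \<in> carrier G") simp_all
  qed (rule n)
qed

text \<open>
  Both sides of a relation lead from combs, whose charts are trivial, to the same tiling.
\<close>

lemma rels_nV:
  assumes n: "n \<ge> 1" and r: "(k, ms, k', ms') \<in> set (rels n)"
  shows "ev (nV n) (nV_gen n) (word k ms) = ev (nV n) (nV_gen n) (word k' ms')"
proof -
  interpret nV: group "nV n" by (rule group_nV)
  have v: "valid n k ms" "valid n k' ms'" "k \<ge> 3" "k' \<ge> 3" using valid_rels[OF n r] by auto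
  have "ev (nV n) (nV_gen n) (word k ms) = chart n (run ms (comb k))" if "valid n k ms" "k \<ge> 3" for k ms
    using word_chart[OF n, of "comb k" k ms] that tiling_comb[OF n] chart_comb[OF n] ev_nV_gen_closed[OF n] by simp
  then show ?thesis using v rels_run[OF r] by simp
qed

lemma thompson_action_nV:
  assumes n: "n \<ge> 1" shows "thompson_action n (\<lambda>l. left_mult (nV n) (nV_gen n l))"
  using nV_gen_closed[OF n] rels_nV[OF n] by (rule thompson_action_left_mult[OF n group_nV])

lemma reach_at_depth:
  assumes n: "n \<ge> 1" and Q: "tiling n Q" "at_depth n M Q" and M: "M \<ge> 2"
  obtains ms where "valid n 3 ms" "run ms (comb 3) = Q"
proof -
  have c: "tiling n (comb 3)" using tiling_comb n by simp
  have s: "within_depth n M (comb 3)"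
    using M by (auto simp: within_depth_def comb_numerals comb_cell_def comb_end_def)
  have "set Q = grid n M (comb 3)"
    using grid_at_depth[OF Q(2) tiling_disjoint_cells[OF Q(1)]] tiling_grid[OF Q(1) within_depth_if_at_depth[OF Q(2)]] tiling_grid[OF c s] by simp
  then show ?thesis using run_to_grid[OF tiling_disjoint_cells[OF c] s tiling_disjoint_cells[OF Q(1)] Q(2)] that by auto
qed

text \<open>
  If \<open>f\<close> has a table from \<open>P\<close> to \<open>Q\<close>, then \<open>f\<close> is the
  quotient of their charts. The chart of a tiling that moves reach from the comb with three cells is a
  word, and deep uniform grids are reached. So the table is refined until \<open>P\<close> is such a grid,
  and then until \<open>Q\<close> is one, where \<open>P\<close> remains reachable.
\<close>

theorem nV_generated:
  assumes n: "n \<ge> 1" and f: "f \<in> carrier (nV n)"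
  shows "f \<in> generate (nV n) (nV_gen n ` {..<n + 3})"
proof -
  interpret nV: group "nV n" by (rule group_nV)
  let ?H = "generate (nV n) (nV_gen n ` {..<n + 3})"
  obtain P Q where PQ: "tiling n P" "tiling n Q" "table n f P Q" using nV_E[OF f] by blast
  obtain M0 where M0: "\<forall>M\<ge>M0. within_depth n M P" using ex_within_depth by blast
  (* The comb with three cells has depth 2. *)
  define M where "M = M0 + 2"
  obtain g where g: "valid n (length P) g" "at_depth n M (run g P)"
    using run_to_at_depth M0 M_def by (metis le_add1)
  let ?P = "run g P" and ?Q = "run g Q"
  have l: "length P = length Q" using table_lengths PQ by blast
  have 1: "tiling n ?P" "tiling n ?Q" "table n f ?P ?Q"
    using tiling_run PQ g table_run l by auto
  obtain h where h: "valid n 3 h" "run h (comb 3) = ?P"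
    using reach_at_depth[OF n 1(1) g(2)] M_def by auto
  have l3: "length ?P = 3 + grow h" using length_run[of n "comb 3" h] h by simp
  have l': "length ?P = length ?Q" using table_lengths 1 by blast
  obtain M1 where M1: "\<forall>M\<ge>M1. within_depth n M ?Q" using ex_within_depth by blast
  obtain g' where g': "valid n (length ?Q) g'" "at_depth n (M1 + 2) (run g' ?Q)"
    using run_to_at_depth M1 by (metis le_add1)
  let ?PP = "run g' ?P" and ?QQ = "run g' ?Q"
  have 2: "tiling n ?PP" "tiling n ?QQ" "table n f ?PP ?QQ"
    using tiling_run 1 g' table_run l' by auto
  obtain h' where h': "valid n 3 h'" "run h' (comb 3) = ?QQ"
    using reach_at_depth[OF n 2(2) g'(2)] by auto
  have hh: "valid n 3 (h @ g')" "run (h @ g') (comb 3) = ?PP"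
    using h g' l' l3 run_append[of n "comb 3" h g'] by (auto simp: valid_append)
  have ch: "chart n (run m (comb 3)) \<in> ?H" if "valid n 3 m" for m
  proof -
    have "ev (nV n) (nV_gen n) (word 3 m) = chart n (run m (comb 3))"
      using word_chart[OF n, of "comb 3" 3 m] that tiling_comb[OF n] chart_comb[OF n] ev_nV_gen_closed[OF n] by simp
    then show ?thesis
      using nV.ev_in_generate[of "nV_gen n", OF nV_gen_closed[OF n] set_word[OF n that]] by metis
  qed
  have lPP: "length ?PP = length ?QQ" using table_lengths 2 by blast
  have "f = tab n ?PP ?QQ" using nV_eq_tab[OF f 2(1,3)] .
  then have "chart n ?QQ \<otimes>\<^bsub>nV n\<^esub> f = chart n ?PP"
    using tab_mult[OF 2(1,2), of "comb (length ?QQ)"] lPP tiling_comb[OF n] tiling_nonempty[OF 2(2)]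
    by (simp add: chart_def)
  then have "f = inv\<^bsub>nV n\<^esub> chart n ?QQ \<otimes>\<^bsub>nV n\<^esub> chart n ?PP"
    using chart_closed[OF n] 2 f by (metis nV.inv_solve_left)
  moreover have "chart n ?QQ \<in> ?H" "chart n ?PP \<in> ?H" using ch[OF h'(1)] ch[OF hh(1)] h' hh by auto
  moreover have "nV_gen n ` {..<n + 3} \<subseteq> carrier (nV n)" using nV_gen_closed[OF n] by auto
  ultimately show ?thesis by (metis generate.eng nV.generate_m_inv_closed)
qed

text \<open>
  The digits of a cell can be read off from its prefix map: a digit of the image that does not depend on
  the argument belongs to the prefix.
\<close>

lemma cell_eqI:
  assumes "wf_cell n a" "wf_cell n b" "\<And>w. w \<in> Gamma n \<Longrightarrow> prepend_tuple n a w = prepend_tuple n b w"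
  shows "a = b"
proof
  fix d
  have le: "length (a d) \<ge> length (b d)" if "d < n" "\<And>w. w \<in> Gamma n \<Longrightarrow> prepend_tuple n a w = prepend_tuple n b w" for a b :: cell
  proof (rule ccontr)
    assume l: "\<not> length (a d) \<ge> length (b d)"
    define w where "w = (\<lambda>v. \<lambda>d\<in>{..<n}. \<lambda>j::nat. v::bool)"
    have w: "w v \<in> Gamma n" for v by (auto simp: w_def Gamma_def)
    have "prepend_tuple n a (w v) d (length (a d)) = v" for v
      using that l by (simp add: w_def prepend_tuple_def prepend_def)
    moreover have "prepend_tuple n b (w v) d (length (a d)) = b d ! length (a d)" for v
      using that l by (simp add: prepend_tuple_def prepend_def)
    ultimately show False using that(2)[OF w] by metis
  qed
  show "a d = b d"
  proof (cases "d < n")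
    case True
    then have "length (a d) = length (b d)" using le[of a b] le[of b a] assms(3) by fastforce
    moreover have "a d ! j = b d ! j" if "j < length (a d)" for j
    proof -
      have "(\<lambda>d\<in>{..<n}. \<lambda>j. False) \<in> Gamma n" by (auto simp: Gamma_def)
      from assms(3)[OF this] have "prepend_tuple n a (\<lambda>d\<in>{..<n}. \<lambda>j. False) d j = prepend_tuple n b (\<lambda>d\<in>{..<n}. \<lambda>j. False) d j" by simp
      then show ?thesis using True that calculation by (simp add: prepend_tuple_def prepend_def)
    qed
    ultimately show ?thesis by (intro nth_equalityI) auto
  next
    case False
    then show ?thesis using assms by (simp add: wf_cell_def)
  qed
qed

lemma chart_inj:
  assumes n: "n \<ge> 1" and P: "tiling n P" "tiling n Q" "length P = length Q" "chart n P = chart n Q"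
  shows "P = Q"
proof (rule nth_equalityI[OF P(3)])
  fix i assume i: "i < length P"
  let ?f = "chart n P" and ?c = "comb (length P)"
  have t: "table n ?f P ?c" "table n ?f Q ?c"
    using table_tab[of n P ?c] table_tab[of n Q ?c] P tiling_nonempty[OF P(1)] by (simp_all add: chart_def)
  have inj: "inj_on ?f (Gamma n)"
    using nV_Bij[OF chart_closed[OF n P(1)]] by (simp add: Bij_def bij_betw_def)
  show "P ! i = Q ! i"
  proof (rule cell_eqI[of n])
    show "wf_cell n (P ! i)" "wf_cell n (Q ! i)" using P i by (auto simp: tiling_def disjoint_cells_def)
    fix w assume w: "w \<in> Gamma n"
    have "?f (prepend_tuple n (P ! i) w) = ?f (prepend_tuple n (Q ! i) w)"
      using t i P w by (auto simp: list_all2_conv_all_nth carries_def)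
    then show "prepend_tuple n (P ! i) w = prepend_tuple n (Q ! i) w"
      using inj by (simp add: inj_on_def)
  qed
qed

section \<open>The words that are trivial in nV are consequences of the relations\<close>

text \<open>
  Write the word as a fraction of two paths, simultaneously in \<open>G\<close> and in \<open>nV\<close>.
  In \<open>nV\<close> the paths have equal values, hence their tilings have equal charts and are equal.
  Then uniqueness of paths makes their values in \<open>G\<close> equal too.
\<close>

theorem trivial_word:
  assumes n: "n \<ge> 1" and G: "group G" and f: "\<And>l. f l \<in> carrier G"
    and rel: "\<And>k ms k' ms'. (k, ms, k', ms') \<in> set (rels n) \<Longrightarrow> ev G f (word k ms) = ev G f (word k' ms')"
    and w: "set w \<subseteq> {..<n + 3} \<times> UNIV" "ev (nV n) (nV_gen n) w = \<one>\<^bsub>nV n\<^esub>"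
  shows "ev G f w = \<one>\<^bsub>G\<^esub>"
proof -
  interpret nV: group "nV n" by (rule group_nV)
  interpret G: group G by (rule G)
  have A: "thompson_action n (\<lambda>l. left_mult G (f l))"
    using f rel by (rule thompson_action_left_mult[OF n G])
  interpret A: thompson_action n "\<lambda>l. left_mult G (f l)" by (rule A)
  obtain ms ms' where ms: "valid n 3 ms" "valid n 3 ms'" "grow ms = grow ms'"
    and 1: "acts (\<lambda>l. left_mult G (f l)) (word 3 ms) \<one>\<^bsub>G\<^esub> =
      acts (\<lambda>l. left_mult G (f l)) (word 3 ms') (acts (\<lambda>l. left_mult G (f l)) w \<one>\<^bsub>G\<^esub>)"
    and 2: "acts (\<lambda>l. left_mult (nV n) (nV_gen n l)) (word 3 ms) \<one>\<^bsub>nV n\<^esub> =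
      acts (\<lambda>l. left_mult (nV n) (nV_gen n l)) (word 3 ms') (acts (\<lambda>l. left_mult (nV n) (nV_gen n l)) w \<one>\<^bsub>nV n\<^esub>)"
    using simultaneous_moves[OF A thompson_action_nV[OF n] w(1)] by metis
  have o: "tiling n (comb 3)" using tiling_comb[OF n] by simp
  have c: "ev (nV n) (nV_gen n) (word 3 m) = chart n (run m (comb 3))" if "valid n 3 m" for m
    using word_chart[OF n, of "comb 3" 3 m] that o chart_comb[OF n] ev_nV_gen_closed[OF n] by simp
  have "chart n (run m (comb 3)) \<in> carrier (nV n)" if "valid n 3 m" for m
    using c[OF that] ev_nV_gen_closed[OF n] by metis
  then have "chart n (run ms (comb 3)) = chart n (run ms' (comb 3))"
    using 2 w(2) nV.acts_left_mult[of "nV_gen n", OF nV_gen_closed[OF n]] ev_nV_gen_closed[OF n] c ms by simp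
  then have "run ms (comb 3) = run ms' (comb 3)"
    using ms o length_run[of n "comb 3"] by (intro chart_inj[OF n]) (auto intro: tiling_run)
  then have "A.ops 3 ms x = A.ops 3 ms' x" for x
    using A.ops_unique[of "comb 3" ms ms' x] ms tiling_disjoint_cells[OF o] by simp
  with 1 have "A.ops 3 ms \<one>\<^bsub>G\<^esub> = A.ops 3 ms (ev G f w)"
    using G.acts_left_mult[of f, OF f] G.ev_closed[of f, OF f] by simp
  then show ?thesis
    using A.bij_ops[OF ms(1)] by (simp add: bij_is_inj[THEN inj_eq])
qed

section \<open>Isolating commutators\<close>

text \<open>
  In base 4 the sum of two powers shows its exponents without carry.
\<close>

lemma sum_two_powers:
  assumes "4 ^ a + 4 ^ b = 4 ^ c + (4::nat) ^ d"
  shows "a = c \<and> b = d \<or> a = d \<and> b = c"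
proof -
  have *: "b = d" if "4 ^ a + 4 ^ b = 4 ^ c + (4::nat) ^ d" "a \<le> b" "c \<le> d" for a b c d
  proof -
    have le: "\<not> b < d" if "4 ^ a + 4 ^ b = 4 ^ c + (4::nat) ^ d" "a \<le> b" for a b c d
    proof
      assume "b < d"
      then have "4 * 4 ^ b \<le> (4::nat) ^ d" using power_increasing[of "Suc b" d "4::nat"] by simp
      moreover have "(4::nat) ^ a \<le> 4 ^ b" using that by (simp add: power_increasing)
      moreover have "(0::nat) < 4 ^ b" by simp
      ultimately show False using that(1) by linarith
    qed
    show ?thesis using le[of a b c d] le[of c d a b] that by linarith
  qed
  show ?thesis
    using *[of a b c d] *[of b a c d] *[of a b d c] *[of b a d c] assms
    by (cases "a \<le> b"; cases "c \<le> d") (auto simp: add.commute)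
qed

context group begin

definition "comm x y \<longleftrightarrow> x \<otimes> y = y \<otimes> x"

lemma comm_sym: "comm x y \<Longrightarrow> comm y x" by (simp add: comm_def)

lemma comm_mult: 
  assumes "x \<in> carrier G" "y \<in> carrier G" "z \<in> carrier G" "comm x y" "comm x z" shows "comm x (y \<otimes> z)"
  using assms unfolding comm_def by (metis m_assoc)

lemma comm_inv:
  assumes "x \<in> carrier G" "y \<in> carrier G" "comm x y" shows "comm x (inv y)"
proof -
  have "inv y \<otimes> (x \<otimes> y) \<otimes> inv y = inv y \<otimes> (y \<otimes> x) \<otimes> inv y" using assms by (simp add: comm_def)
  moreover have "inv y \<otimes> (x \<otimes> y) \<otimes> inv y = inv y \<otimes> x" using assms by (simp add: m_assoc)
  moreover have "inv y \<otimes> (y \<otimes> x) \<otimes> inv y = x \<otimes> inv y" using assms by (simp add: m_assoc[symmetric])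
  ultimately show ?thesis by (simp add: comm_def)
qed

lemma comm_generate:
  assumes "x \<in> carrier G" "S \<subseteq> carrier G" "\<And>s. s \<in> S \<Longrightarrow> comm x s" "y \<in> generate G S"
  shows "comm x y"
  using assms(4)
proof (induction rule: generate.induct)
  case one
  then show ?case using assms by (simp add: comm_def)
next
  case (incl h)
  then show ?case using assms by blast
next
  case (inv h)
  then show ?case using assms comm_inv by blast
next
  case (eng a b)
  then show ?case using assms comm_mult generate_in_carrier[of S] by blast
qed

definition "conj_pow z r x = z [^] (r::int) \<otimes> x \<otimes> inv (z [^] r)"

lemma conj_pow_closed [simp]: "z \<in> carrier G \<Longrightarrow> x \<in> carrier G \<Longrightarrow> conj_pow z r x \<in> carrier G"
  by (simp add: conj_pow_def)

lemma conj_pow_mult: "z \<in> carrier G \<Longrightarrow> x \<in> carrier G \<Longrightarrow> y \<in> carrier G \<Longrightarrow> conj_pow z r (x \<otimes> y) = conj_pow z r x \<otimes> conj_pow z r y"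
  by (simp add: conj_pow_def m_assoc inv_solve_left)

lemma conj_pow_add: "z \<in> carrier G \<Longrightarrow> x \<in> carrier G \<Longrightarrow> conj_pow z r (conj_pow z s x) = conj_pow z (r + s) x"
  by (simp add: conj_pow_def int_pow_mult inv_mult_group m_assoc)

lemma conj_pow_0: "x \<in> carrier G \<Longrightarrow> conj_pow z 0 x = x"
  by (simp add: conj_pow_def)

lemma conj_pow_comm: "z \<in> carrier G \<Longrightarrow> x \<in> carrier G \<Longrightarrow> y \<in> carrier G \<Longrightarrow> comm x y \<Longrightarrow> comm (conj_pow z r x) (conj_pow z r y)"
  unfolding comm_def by (metis conj_pow_mult)

lemma conj_pow_comm_iff: "z \<in> carrier G \<Longrightarrow> x \<in> carrier G \<Longrightarrow> y \<in> carrier G \<Longrightarrow>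
    comm (conj_pow z r x) (conj_pow z s y) \<longleftrightarrow> comm (conj_pow z (r - s) x) y"
  using conj_pow_comm[of z "conj_pow z r x" "conj_pow z s y" "-s"] conj_pow_comm[of z "conj_pow z (r - s) x" y s]
  by (auto simp: conj_pow_add conj_pow_0)

lemma conj_pow_one: "z \<in> carrier G \<Longrightarrow> conj_pow z r \<one> = \<one>"
  by (simp add: conj_pow_def)

lemma conj_pow_inv: "z \<in> carrier G \<Longrightarrow> x \<in> carrier G \<Longrightarrow> conj_pow z r (inv x) = inv (conj_pow z r x)"
  by (simp add: conj_pow_def inv_mult_group m_assoc)

lemma conj_pow_generate:
  assumes z: "z \<in> carrier G" and S: "S \<subseteq> carrier G" and x: "x \<in> generate G S"
  shows "conj_pow z r x \<in> generate G (conj_pow z r ` S)"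
  using x
proof (induction rule: generate.induct)
  case one
  then show ?case using z by (simp add: conj_pow_one generate.one)
next
  case (incl h)
  then show ?case by (auto intro: generate.incl)
next
  case (inv h)
  then have "h \<in> carrier G" using S by auto
  moreover have "inv (conj_pow z r h) \<in> generate G (conj_pow z r ` S)" using inv by (intro generate.inv) auto
  ultimately show ?case by (simp only: conj_pow_inv[OF z])
next
  case (eng a b)
  then show ?case using z generate_in_carrier[OF S] by (simp add: conj_pow_mult generate.eng)
qed

text \<open>
  Factors \<open>a\<close> and \<open>b\<close> that commute with everything in sight drop out of a
  commutator.
\<close>

lemma commutator_split:
  assumes c: "h \<in> carrier G" "k \<in> carrier G" "a \<in> carrier G" "b \<in> carrier G"
    and "comm a h" "comm a k" "comm b h" "comm b k" "comm a b"
  shows "(h \<otimes> a) \<otimes> (k \<otimes> b) \<otimes> inv (h \<otimes> a) \<otimes> inv (k \<otimes> b) = h \<otimes> k \<otimes> inv h \<otimes> inv k"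
proof -
  have "(h \<otimes> a) \<otimes> (k \<otimes> b) = (h \<otimes> k) \<otimes> (a \<otimes> b)"
    using assms unfolding comm_def by (metis m_assoc m_closed)
  moreover have "(k \<otimes> b) \<otimes> (h \<otimes> a) = (k \<otimes> h) \<otimes> (a \<otimes> b)"
    using assms unfolding comm_def by (metis m_assoc m_closed)
  moreover have "(h \<otimes> a) \<otimes> (k \<otimes> b) \<otimes> inv (h \<otimes> a) \<otimes> inv (k \<otimes> b) = (h \<otimes> a) \<otimes> (k \<otimes> b) \<otimes> inv ((k \<otimes> b) \<otimes> (h \<otimes> a))"
    using c by (simp add: inv_mult_group m_assoc)
  moreover have "h \<otimes> k \<otimes> inv h \<otimes> inv k = h \<otimes> k \<otimes> inv (k \<otimes> h)"
    using c by (simp add: inv_mult_group m_assoc)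
  moreover have "(h \<otimes> k) \<otimes> (a \<otimes> b) \<otimes> inv ((k \<otimes> h) \<otimes> (a \<otimes> b)) = h \<otimes> k \<otimes> inv (k \<otimes> h)"
    using c by (subst inv_mult_group) (simp_all add: m_assoc[symmetric], simp add: m_assoc)
  ultimately show ?thesis by simp
qed

text \<open>
  The positions have distinct differences, by \<open>sum_two_powers\<close>. As they are multiples of 4,
  so are their differences, which are thus at least 2 apart whenever they are distinct.
\<close>

abbreviation (input) pos :: "nat \<Rightarrow> int" where "pos i \<equiv> 4 ^ Suc i"

lemma pos_diff:
  assumes "i \<noteq> j" "k \<noteq> i" "l \<noteq> j"
  shows "2 \<le> \<bar>(pos k - pos i) - (pos l - pos j)\<bar>"
proof -
  let ?x = "(4::int) ^ k - 4 ^ i - (4 ^ l - 4 ^ j)"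
  have "?x \<noteq> 0"
  proof
    assume "?x = 0"
    then have "(4::int) ^ k + 4 ^ j = 4 ^ i + 4 ^ l" by linarith
    then have "int (4 ^ k + 4 ^ j) = int (4 ^ i + 4 ^ l)" by simp
    then have "(4::nat) ^ k + 4 ^ j = 4 ^ i + 4 ^ l" by (simp only: of_nat_eq_iff)
    then show False using sum_two_powers assms by blast
  qed
  moreover have "(pos k - pos i) - (pos l - pos j) = 4 * ?x" by simp
  moreover have "2 \<le> \<bar>4 * y\<bar>" if "y \<noteq> 0" for y :: int using that by linarith
  ultimately show ?thesis by (simp only:)
qed

lemma pos_diff': assumes "k \<noteq> i" shows "2 \<le> \<bar>pos k - pos i\<bar>"
proof -
  have "(4::int) ^ k - 4 ^ i \<noteq> 0" using assms by simp
  moreover have "pos k - pos i = 4 * (4 ^ k - 4 ^ i)" by simp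
  moreover have "2 \<le> \<bar>4 * y\<bar>" if "y \<noteq> 0" for y :: int using that by linarith
  ultimately show ?thesis by (simp only:)
qed

lemma pos_less: "k < p \<Longrightarrow> pos k \<le> 4 ^ p \<and> pos k > 0"
  using power_increasing[of "Suc k" p "4::int"] by simp

text \<open>
  Conjugation by a power of \<open>z\<close> moves the factor of \<open>v\<close> at position \<open>pos
  i\<close> to position 0. In the product so obtained from \<open>i\<close>, and the one obtained from
  \<open>j\<close>, the factors apart from \<open>h i\<close> and \<open>h j\<close> sit at positions that
  are at distance at least 2 from 0 and from each other, because the differences of the positions are
  distinct. By assumption such factors commute, so the commutator of the two products is that of \<open>h
  i\<close> and \<open>h j\<close>.
\<close>

theorem isolated_commutator:
  fixes h :: "nat \<Rightarrow> 'a"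
  assumes z: "z \<in> carrier G" and h: "\<And>i. h i \<in> carrier G"
    and far: "\<And>k l r. 2 \<le> \<bar>r\<bar> \<Longrightarrow> \<bar>r\<bar> \<le> 2 * 4 ^ p \<Longrightarrow> comm (conj_pow z r (h k)) (h l)"
    and v: "v = foldr (\<lambda>k y. conj_pow z (pos k) (h k) \<otimes> y) [0..<p] \<one>"
    and ij: "i < p" "j < p" "i \<noteq> j"
  shows "h i \<otimes> h j \<otimes> inv (h i) \<otimes> inv (h j) \<in> generate G {z, v}"
proof -
  let ?c = "\<lambda>k. conj_pow z (pos k) (h k)"
  define P where "P xs = foldr (\<lambda>k y. ?c k \<otimes> y) xs \<one>" for xs
  have Pc: "P xs \<in> carrier G" for xs unfolding P_def using z h by (induction xs) auto
  have bound: "\<bar>pos k - pos i\<bar> \<le> 4 ^ p" if "k < p" "i < p" for k i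
    using pos_less[OF that(1)] pos_less[OF that(2)] by linarith
  have p0: "(0::int) < 4 ^ p" by simp
  have cc: "comm (?c k) (?c l)" if "k < p" "l < p" "k \<noteq> l" for k l
  proof -
    have "\<bar>pos k - pos l\<bar> \<le> 2 * 4 ^ p" using bound[OF that(1,2)] p0 by linarith
    then have "comm (conj_pow z (pos k - pos l) (h k)) (h l)" by (rule far[OF pos_diff'[OF that(3)]])
    then show ?thesis using conj_pow_comm_iff[OF z h h] by blast
  qed
  have gen_P: "P xs \<in> generate G (?c ` set xs)" for xs
    unfolding P_def
  proof (induction xs)
    case (Cons k xs)
    have "generate G (?c ` set xs) \<subseteq> generate G (?c ` set (k # xs))"
      by (intro mono_generate) auto
    then have "foldr (\<lambda>k y. ?c k \<otimes> y) xs \<one> \<in> generate G (?c ` set (k # xs))" using Cons by blast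
    moreover have "?c k \<in> generate G (?c ` set (k # xs))" by (intro generate.incl) simp
    ultimately show ?case using generate.eng by simp
  qed (simp add: generate.one)
  have out: "\<exists>a. P xs = ?c k \<otimes> a \<and> a \<in> generate G (?c ` (set xs - {k}))"
    if "k \<in> set xs" "distinct xs" "set xs \<subseteq> {..<p}" for k xs
    using that
  proof (induction xs)
    case (Cons l xs)
    show ?case
    proof (cases "k = l")
      case True
      then have "set (l # xs) - {k} = set xs" using Cons.prems by auto
      then show ?thesis using True gen_P[of xs] by (auto simp: P_def)
    next
      case False
      then obtain a where a: "P xs = ?c k \<otimes> a" "a \<in> generate G (?c ` (set xs - {k}))" using Cons by auto
      have "?c ` (set xs - {k}) \<subseteq> carrier G" using z h by auto
      then have ac: "a \<in> carrier G" using a(2) by (rule generate_in_carrier)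
      have "P (l # xs) = ?c l \<otimes> (?c k \<otimes> a)" using a by (simp add: P_def)
      also have "\<dots> = ?c k \<otimes> (?c l \<otimes> a)"
      proof -
        have "k < p" "l < p" using Cons.prems by auto
        from cc[OF this False] have "?c l \<otimes> ?c k = ?c k \<otimes> ?c l" unfolding comm_def by (rule sym)
        then show ?thesis using z h ac by (simp only: m_assoc[symmetric] conj_pow_closed)
      qed
      finally have 1: "P (l # xs) = ?c k \<otimes> (?c l \<otimes> a)" .
      have "generate G (?c ` (set xs - {k})) \<subseteq> generate G (?c ` (set (l # xs) - {k}))"
        by (intro mono_generate) auto
      then have "a \<in> generate G (?c ` (set (l # xs) - {k}))" using a by blast
      moreover have "?c l \<in> generate G (?c ` (set (l # xs) - {k}))"
        using False by (intro generate.incl imageI) simp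
      ultimately have "?c l \<otimes> a \<in> generate G (?c ` (set (l # xs) - {k}))" by (rule generate.eng[rotated])
      then show ?thesis using 1 by blast
    qed
  qed simp
  have vP: "v = P [0..<p]" by (simp add: v P_def)
  then have vc: "v \<in> carrier G" using Pc by simp
  have shifted: "\<exists>a. a \<in> carrier G \<and> conj_pow z (- pos i) v = h i \<otimes> a \<and>
      (\<forall>x\<in>carrier G. (\<forall>k<p. k \<noteq> i \<longrightarrow> comm x (conj_pow z (pos k - pos i) (h k))) \<longrightarrow> comm x a)" if "i < p" for i
  proof -
    obtain a where a: "v = ?c i \<otimes> a" "a \<in> generate G (?c ` ({0..<p} - {i}))"
      using out[of i "[0..<p]"] \<open>i < p\<close> vP by (auto simp: atLeast0LessThan)
    have S: "?c ` ({0..<p} - {i}) \<subseteq> carrier G" using z h by auto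
    have ac: "a \<in> carrier G" using generate_in_carrier[OF S a(2)] .
    have "conj_pow z (- pos i) v = h i \<otimes> conj_pow z (- pos i) a"
      using a z h ac by (simp add: conj_pow_mult conj_pow_add conj_pow_0)
    moreover have "comm x (conj_pow z (- pos i) a)"
      if x: "x \<in> carrier G" "\<forall>k<p. k \<noteq> i \<longrightarrow> comm x (conj_pow z (pos k - pos i) (h k))" for x
    proof (rule comm_generate[OF x(1) _ _ conj_pow_generate[OF z S a(2)]])
      show "conj_pow z (- pos i) ` ?c ` ({0..<p} - {i}) \<subseteq> carrier G" using z h by auto
      fix s assume "s \<in> conj_pow z (- pos i) ` ?c ` ({0..<p} - {i})"
      then obtain k where k0: "k \<in> {0..<p} - {i}" and ks: "s = conj_pow z (- pos i) (?c k)"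
        by (elim imageE) blast
      then have k: "k < p" "k \<noteq> i" "s = conj_pow z (- pos i) (?c k)" by simp_all
      have "s = conj_pow z (pos k - pos i) (h k)" using k(3) conj_pow_add[OF z h, of "- pos i" "pos k"] by simp
      then show "comm x s" using x(2) k by blast
    qed
    ultimately show ?thesis using z ac by (intro exI[of _ "conj_pow z (- pos i) a"]) auto
  qed
  obtain a where A: "a \<in> carrier G \<and> conj_pow z (- pos i) v = h i \<otimes> a \<and>
      (\<forall>x\<in>carrier G. (\<forall>k<p. k \<noteq> i \<longrightarrow> comm x (conj_pow z (pos k - pos i) (h k))) \<longrightarrow> comm x a)"
    using shifted[OF ij(1)] by (elim exE)
  have a: "a \<in> carrier G" "conj_pow z (- pos i) v = h i \<otimes> a" using A by simp_all
  have a3: "comm x a" if "x \<in> carrier G" "\<And>k. k < p \<Longrightarrow> k \<noteq> i \<Longrightarrow> comm x (conj_pow z (pos k - pos i) (h k))" for x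
    using A that by simp
  obtain b where B: "b \<in> carrier G \<and> conj_pow z (- pos j) v = h j \<otimes> b \<and>
      (\<forall>x\<in>carrier G. (\<forall>k<p. k \<noteq> j \<longrightarrow> comm x (conj_pow z (pos k - pos j) (h k))) \<longrightarrow> comm x b)"
    using shifted[OF ij(2)] by (elim exE)
  have b: "b \<in> carrier G" "conj_pow z (- pos j) v = h j \<otimes> b" using B by simp_all
  have b3: "comm x b" if "x \<in> carrier G" "\<And>k. k < p \<Longrightarrow> k \<noteq> j \<Longrightarrow> comm x (conj_pow z (pos k - pos j) (h k))" for x
    using B that by simp
  have ha: "comm (h l) a" for l
  proof (rule a3[OF h])
    fix k assume k: "k < p" "k \<noteq> i"
    have "\<bar>pos k - pos i\<bar> \<le> 2 * 4 ^ p" using bound[OF k(1), of i] ij p0 by linarith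
    then show "comm (h l) (conj_pow z (pos k - pos i) (h k))"
      by (rule comm_sym[OF far[OF pos_diff'[OF k(2)]]])
  qed
  have hb: "comm (h l) b" for l
  proof (rule b3[OF h])
    fix k assume k: "k < p" "k \<noteq> j"
    have "\<bar>pos k - pos j\<bar> \<le> 2 * 4 ^ p" using bound[OF k(1), of j] ij p0 by linarith
    then show "comm (h l) (conj_pow z (pos k - pos j) (h k))"
      by (rule comm_sym[OF far[OF pos_diff'[OF k(2)]]])
  qed
  have ab: "comm a b"
  proof (rule b3[OF a(1)])
    fix l assume l: "l < p" "l \<noteq> j"
    have "comm (conj_pow z (pos l - pos j) (h l)) a"
    proof (rule a3)
      fix k assume k: "k < p" "k \<noteq> i"
      have "\<bar>(pos k - pos i) - (pos l - pos j)\<bar> \<le> 2 * 4 ^ p"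
        using bound[OF k(1) ij(1)] bound[OF l(1) ij(2)] by linarith
      then have "comm (conj_pow z ((pos k - pos i) - (pos l - pos j)) (h k)) (h l)"
        by (rule far[OF pos_diff[OF ij(3) k(2) l(2)]])
      then have "comm (conj_pow z (pos k - pos i) (h k)) (conj_pow z (pos l - pos j) (h l))"
        using conj_pow_comm_iff[OF z h h] by blast
      then show "comm (conj_pow z (pos l - pos j) (h l)) (conj_pow z (pos k - pos i) (h k))" by (rule comm_sym)
    qed (use z h in simp)
    then show "comm a (conj_pow z (pos l - pos j) (h l))" by (rule comm_sym)
  qed
  have W: "{z, v} \<subseteq> carrier G" using z vc by simp
  interpret W: subgroup "generate G {z, v}" G using generate_is_subgroup[OF W] .
  have zW: "z \<in> generate G {z, v}" and vW: "v \<in> generate G {z, v}" by (auto intro: generate.incl)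
  have "z [^] (r::int) \<in> generate G {z, v}" for r
    by (rule subgroup_int_pow_closed[OF W.subgroup_axioms zW])
  then have cW: "conj_pow z r v \<in> generate G {z, v}" for r using vW by (simp add: conj_pow_def)
  have "h i \<otimes> h j \<otimes> inv (h i) \<otimes> inv (h j) =
      conj_pow z (- pos i) v \<otimes> conj_pow z (- pos j) v \<otimes> inv (conj_pow z (- pos i) v) \<otimes> inv (conj_pow z (- pos j) v)"
    unfolding a(2) b(2)
    by (rule commutator_split[symmetric]) (use h a(1) b(1) ha hb ab comm_sym in auto)
  then show ?thesis using cW by simp
qed

lemma generate_finite_subset:
  assumes "x \<in> generate G S" shows "\<exists>F. finite F \<and> F \<subseteq> S \<and> x \<in> generate G F"
  using assms
proof (induction rule: generate.induct)
  case one
  show ?case by (intro exI[of _ "{}"]) (simp add: generate.one)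
next
  case (incl h)
  then show ?case by (intro exI[of _ "{h}"]) (auto intro: generate.incl)
next
  case (inv h)
  then show ?case by (intro exI[of _ "{h}"]) (auto intro: generate.inv)
next
  case (eng a b)
  then obtain E F where EF: "finite E" "E \<subseteq> S" "a \<in> generate G E" "finite F" "F \<subseteq> S" "b \<in> generate G F" by blast
  then have "a \<in> generate G (E \<union> F)" "b \<in> generate G (E \<union> F)"
    using mono_generate[of E "E \<union> F"] mono_generate[of F "E \<union> F"] by auto
  then show ?case using EF by (intro exI[of _ "E \<union> F"]) (auto intro: generate.eng)
qed

text \<open>
  Each of the finitely many generators is a product of finitely many commutators and their inverses. The
  family \<open>h\<close> lists the entries of all of these.
\<close>

theorem perfect_finite_commutators:
  assumes perfect: "derived G (carrier G) = carrier G"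
    and fin: "finite X" and X: "carrier G \<subseteq> generate G X" "X \<subseteq> carrier G"
  shows "\<exists>(h :: nat \<Rightarrow> 'a) p. (\<forall>i. h i \<in> carrier G) \<and>
    carrier G \<subseteq> generate G {h i \<otimes> h j \<otimes> inv (h i) \<otimes> inv (h j) | i j. i < p \<and> j < p \<and> i \<noteq> j}"
proof -
  have "\<forall>x\<in>X. \<exists>F. finite F \<and> F \<subseteq> derived_set G (carrier G) \<and> x \<in> generate G F"
  proof
    fix x assume "x \<in> X"
    then have "x \<in> generate G (derived_set G (carrier G))"
      using X(2) perfect by (auto simp only: derived_def)
    then show "\<exists>F. finite F \<and> F \<subseteq> derived_set G (carrier G) \<and> x \<in> generate G F"
      by (rule generate_finite_subset)
  qed
  from bchoice[OF this] obtain F where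
    F: "\<forall>x\<in>X. finite (F x) \<and> F x \<subseteq> derived_set G (carrier G) \<and> x \<in> generate G (F x)" by blast
  define E where "E = (\<Union>x\<in>X. F x)"
  have fE: "finite E" using F fin by (simp add: E_def)
  have E: "E \<subseteq> derived_set G (carrier G)" unfolding E_def using F by (intro UN_least) blast
  have XE: "X \<subseteq> generate G E"
  proof
    fix x assume x: "x \<in> X"
    then have "F x \<subseteq> E" by (auto simp: E_def)
    then show "x \<in> generate G E" using mono_generate[of "F x" E] F x by blast
  qed
  have "\<forall>e\<in>E. \<exists>a. \<exists>b. a \<in> carrier G \<and> b \<in> carrier G \<and> e = a \<otimes> b \<otimes> inv a \<otimes> inv b"
    using E by blast
  from bchoice[OF this] obtain a where
    "\<forall>e\<in>E. \<exists>b. a e \<in> carrier G \<and> b \<in> carrier G \<and> e = a e \<otimes> b \<otimes> inv (a e) \<otimes> inv b" by blast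
  from bchoice[OF this] obtain b where
    ab': "\<forall>e\<in>E. a e \<in> carrier G \<and> b e \<in> carrier G \<and> e = a e \<otimes> b e \<otimes> inv (a e) \<otimes> inv (b e)" by blast
  have ab: "a e \<in> carrier G" "b e \<in> carrier G" "e = a e \<otimes> b e \<otimes> inv (a e) \<otimes> inv (b e)" if "e \<in> E" for e
    using ab' that by blast+
  obtain xs where xs: "set xs = a ` E \<union> b ` E" using finite_list[of "a ` E \<union> b ` E"] fE by auto
  define h where "h i = (if i < length xs then xs ! i else \<one>)" for i
  let ?C = "{h i \<otimes> h j \<otimes> inv (h i) \<otimes> inv (h j) | i j. i < length xs \<and> j < length xs \<and> i \<noteq> j}"
  have hc: "h i \<in> carrier G" for i
    using xs ab nth_mem[of i xs] by (auto simp: h_def)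
  have "e \<in> generate G ?C" if e: "e \<in> E" for e
  proof -
    obtain i j where i: "i < length xs" "xs ! i = a e" and j: "j < length xs" "xs ! j = b e"
      using xs e by (metis UnCI image_eqI in_set_conv_nth)
    show ?thesis
    proof (cases "i = j")
      case True
      then have "a e = b e" using i j by simp
      have "a e \<otimes> a e \<otimes> inv (a e) \<otimes> inv (a e) = \<one>" using ab(1)[OF e] by (simp add: m_assoc)
      with \<open>a e = b e\<close> have "e = \<one>" using ab(3)[OF e] by simp
      then show ?thesis by (simp add: generate.one)
    next
      case False
      have "e = h i \<otimes> h j \<otimes> inv (h i) \<otimes> inv (h j)" using ab(3)[OF e] i j by (simp add: h_def)
      then show ?thesis using False i j by (auto intro!: generate.incl)
    qed
  qed
  then have "generate G E \<subseteq> generate G ?C"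
    using generate_subgroup_incl[of E "generate G ?C"] generate_is_subgroup[of ?C] hc by blast
  then have "X \<subseteq> generate G ?C" using XE by auto
  then have "generate G X \<subseteq> generate G ?C"
    using generate_subgroup_incl[of X "generate G ?C"] generate_is_subgroup[of ?C] hc by blast
  then show ?thesis using hc X by blast
qed

end

section \<open>The group nV is perfect\<close>

text \<open>
  In an abelian group the braid relations identify all exchanges. The two sides of
  \<open>two_cells\<close> differ by an odd number of exchanges, which are involutions, so these are
  trivial. Then the relation \<open>X S\<^sub>1 = S\<^sub>2 T\<^sub>1\<close> kills the split along
  coordinate 0, and \<open>one_cell\<close>, where the number of splits along each of two coordinates is
  once on one side and twice on the other, kills the remaining splits.
\<close>

lemma abelian_quotient_trivial:
  assumes n: "n \<ge> 1" and G: "comm_group G" and f: "\<And>l. f l \<in> carrier G"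
    and rel: "\<And>k ms k' ms'. (k, ms, k', ms') \<in> set (rels n) \<Longrightarrow> ev G f (word k ms) = ev G f (word k' ms')"
    and l: "l < n + 3"
  shows "f l = \<one>\<^bsub>G\<^esub>"
proof -
  interpret G: comm_group G by (rule G)
  interpret A: thompson_action n "\<lambda>l. left_mult G (f l)"
    using f rel by (rule thompson_action_left_mult[OF n G.is_group])
  define a b c r where "a = f 0" and "b = f 1" and "c = f 2" and "r = f 3"
  have cl: "a \<in> carrier G" "b \<in> carrier G" "c \<in> carrier G" "r \<in> carrier G"
    using f by (auto simp: a_def b_def c_def r_def)
  have acts: "acts (\<lambda>l. left_mult G (f l)) w x = ev G f w \<otimes>\<^bsub>G\<^esub> x" if "x \<in> carrier G" for w x
    using G.acts_left_mult[of f, OF f that] .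
  have conj: "r \<otimes>\<^bsub>G\<^esub> (x \<otimes>\<^bsub>G\<^esub> inv\<^bsub>G\<^esub> r) = x" if "x \<in> carrier G" for x
    using cl that by (metis G.inv_closed G.m_assoc G.m_comm G.m_closed G.r_inv G.r_one)
  have T: "A.T 0 x = a \<otimes>\<^bsub>G\<^esub> x" "A.T 1 x = b \<otimes>\<^bsub>G\<^esub> x" "A.S 1 x = c \<otimes>\<^bsub>G\<^esub> x"
    "A.T 2 x = b \<otimes>\<^bsub>G\<^esub> x" "A.S 2 x = c \<otimes>\<^bsub>G\<^esub> x"
    if "x \<in> carrier G" for x
    using cl conj[OF cl(2)] conj[OF cl(3)]
    by (simp_all add: acts[OF that] ev_Cons S_word_def numeral_2_eq_2 flip: a_def b_def c_def r_def)
       (simp_all add: a_def b_def c_def r_def numeral_2_eq_2)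
  have R: "A.R d x = f (3 + d) \<otimes>\<^bsub>G\<^esub> x" if "x \<in> carrier G" for x d
    using that by (simp add: G.left_mult_eq)
  have aa: "a \<otimes>\<^bsub>G\<^esub> a = \<one>\<^bsub>G\<^esub>" using A.base_rels(1)[of "\<one>\<^bsub>G\<^esub>"] T cl by (simp del: T_word.simps)
  have "a \<otimes>\<^bsub>G\<^esub> (b \<otimes>\<^bsub>G\<^esub> a) = b \<otimes>\<^bsub>G\<^esub> (a \<otimes>\<^bsub>G\<^esub> b)" using A.base_rels(4)[of "\<one>\<^bsub>G\<^esub>"] T cl by (simp del: T_word.simps)
  then have "(a \<otimes>\<^bsub>G\<^esub> b) \<otimes>\<^bsub>G\<^esub> a = (a \<otimes>\<^bsub>G\<^esub> b) \<otimes>\<^bsub>G\<^esub> b" using cl by (simp add: G.m_ac)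
  then have ab: "b = a" using cl by simp
  have "c \<otimes>\<^bsub>G\<^esub> (a \<otimes>\<^bsub>G\<^esub> c) = a \<otimes>\<^bsub>G\<^esub> (c \<otimes>\<^bsub>G\<^esub> a)" using A.base_rels(6)[of "\<one>\<^bsub>G\<^esub>"] T cl by (simp del: T_word.simps)
  then have "(a \<otimes>\<^bsub>G\<^esub> c) \<otimes>\<^bsub>G\<^esub> a = (a \<otimes>\<^bsub>G\<^esub> c) \<otimes>\<^bsub>G\<^esub> c" using cl by (simp add: G.m_ac)
  then have ac: "c = a" using cl by simp
  have aa': "a \<otimes>\<^bsub>G\<^esub> (a \<otimes>\<^bsub>G\<^esub> x) = x" if "x \<in> carrier G" for x
    using aa cl that by (simp flip: G.m_assoc)
  have R0: "A.R 0 x = r \<otimes>\<^bsub>G\<^esub> x" if "x \<in> carrier G" for x using R[OF that, of 0] by (simp add: r_def)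
  have "r \<otimes>\<^bsub>G\<^esub> (a \<otimes>\<^bsub>G\<^esub> (a \<otimes>\<^bsub>G\<^esub> r)) =
     a \<otimes>\<^bsub>G\<^esub> (a \<otimes>\<^bsub>G\<^esub> (a \<otimes>\<^bsub>G\<^esub> (a \<otimes>\<^bsub>G\<^esub> (r \<otimes>\<^bsub>G\<^esub> (a \<otimes>\<^bsub>G\<^esub> (a \<otimes>\<^bsub>G\<^esub> (r \<otimes>\<^bsub>G\<^esub> a)))))))"
    using A.two_cells[of 0 0 "\<one>\<^bsub>G\<^esub>"] n T R0 cl ab by (simp del: T_word.simps add_0_right)
  then have "r \<otimes>\<^bsub>G\<^esub> r = (r \<otimes>\<^bsub>G\<^esub> r) \<otimes>\<^bsub>G\<^esub> a" using cl aa' by (simp add: G.m_assoc)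
  then have a1: "a = \<one>\<^bsub>G\<^esub>" using cl by simp
  have "a \<otimes>\<^bsub>G\<^esub> (a \<otimes>\<^bsub>G\<^esub> (r \<otimes>\<^bsub>G\<^esub> (a \<otimes>\<^bsub>G\<^esub> a))) = a \<otimes>\<^bsub>G\<^esub> a"
    using A.base_rels(16)[of "\<one>\<^bsub>G\<^esub>"] T R0[simplified] cl ab ac by (simp add: A.X_def del: T_word.simps)
  then have r1: "r = \<one>\<^bsub>G\<^esub>" using a1 cl by simp
  have rd: "f (3 + d) = \<one>\<^bsub>G\<^esub>" if "d < n" for d
  proof (cases "d = 0")
    case True
    then show ?thesis using r1 by (simp add: r_def)
  next
    case False
    have "f (3 + d) \<otimes>\<^bsub>G\<^esub> f (3 + d) = f (3 + d)"
      using A.one_cell[of 0 d "\<one>\<^bsub>G\<^esub>"] False that n T R R0 f[of "3 + d"] by (simp add: ab a1 r1 del: T_word.simps add_0_right)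
    then show ?thesis using f[of "3 + d"] by (metis G.l_cancel_one)
  qed
  show ?thesis
  proof (cases "l < 3")
    case True
    then have "l = 0 \<or> l = 1 \<or> l = 2" by auto
    then show ?thesis using a1 ab ac by (auto simp: a_def b_def c_def)
  next
    case False
    then have "l = 3 + (l - 3)" "l - 3 < n" using l by auto
    then show ?thesis using rd by metis
  qed
qed

theorem nV_perfect:
  assumes n: "n \<ge> 1" shows "derived (nV n) (carrier (nV n)) = carrier (nV n)"
proof -
  interpret nV: group "nV n" by (rule group_nV)
  let ?D = "derived (nV n) (carrier (nV n))"
  let ?A = "nV n Mod ?D"
  interpret D: normal ?D "nV n" by (rule nV.derived_self_is_normal)
  have A: "comm_group ?A" by (rule nV.derived_quot_is_comm_group)
  then interpret A: comm_group ?A .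
  define f where "f l = ?D #>\<^bsub>nV n\<^esub> nV_gen n l" for l
  interpret q: group_hom "nV n" ?A "\<lambda>x. ?D #>\<^bsub>nV n\<^esub> x"
    by (intro group_hom.intro group_hom_axioms.intro D.r_coset_hom_Mod group_nV A.is_group)
  have fc: "f l \<in> carrier ?A" for l using nV_gen_closed[OF n] by (simp add: f_def)
  have hom: "?D #>\<^bsub>nV n\<^esub> ev (nV n) (nV_gen n) w = ev ?A f w" for w
  proof (induction w)
    case (Cons a w)
    obtain l b where a: "a = (l, b)" by (cases a)
    show ?case using nV_gen_closed[OF n, of l] ev_nV_gen_closed[OF n, of w] Cons
      by (simp add: a ev_Cons f_def)
  qed simp
  have rel: "ev ?A f (word k ms) = ev ?A f (word k' ms')" if "(k, ms, k', ms') \<in> set (rels n)" for k ms k' ms'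
    using rels_nV[OF n that] by (simp flip: hom)
  have "f l = \<one>\<^bsub>?A\<^esub>" if "l < n + 3" for l
    using fc rel that by (rule abelian_quotient_trivial[OF n A])
  then have sub: "nV_gen n ` {..<n + 3} \<subseteq> ?D"
    using nV.rcos_self[OF nV_gen_closed[OF n] D.subgroup_axioms] by (auto simp: f_def FactGroup_def)
  have "carrier (nV n) \<subseteq> ?D"
    using nV.generate_subgroup_incl[OF sub D.subgroup_axioms] nV_generated[OF n] by blast
  then show ?thesis using D.subset by blast
qed

section \<open>Copies of nV inside the last cell of a comb\<close>

text \<open>
  \<open>nest m a\<close> is the cell that corresponds to \<open>a\<close> when the whole space is
  identified with the cone of \<open>comb_end m\<close>, and \<open>nest_all m P\<close> is the tiling of
  the space in which \<open>P\<close> has replaced the end of a comb.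
\<close>

definition nest :: "nat \<Rightarrow> cell \<Rightarrow> cell" where
  "nest m a = (\<lambda>d. if d = 0 then replicate m True @ a 0 else a d)"

definition nest_all :: "nat \<Rightarrow> cell list \<Rightarrow> cell list" where
  "nest_all m P = map comb_cell [0..<m] @ map (nest m) P"

definition inner_copy :: "nat \<Rightarrow> nat \<Rightarrow> ((nat \<Rightarrow> nat \<Rightarrow> bool) \<Rightarrow> nat \<Rightarrow> nat \<Rightarrow> bool) \<Rightarrow> (nat \<Rightarrow> nat \<Rightarrow> bool) \<Rightarrow> nat \<Rightarrow> nat \<Rightarrow> bool" where
  "inner_copy n m g = (\<lambda>x\<in>Gamma n. if x \<in> cone n (comb_end m)
     then prepend_tuple n (comb_end m) (g (drop_tuple n (comb_end m) x)) else x)"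

lemma prepend_nest: "prepend_tuple n (nest m a) w = prepend_tuple n (comb_end m) (prepend_tuple n a w)"
  by (intro ext) (auto simp: prepend_tuple_def prepend_def nest_def comb_end_def nth_append)

lemma nest_comb: "nest m (comb_cell i) = comb_cell (m + i)" "nest m (comb_end i) = comb_end (m + i)"
  by (auto simp: nest_def comb_cell_def comb_end_def replicate_add fun_eq_iff)

lemma nest_half: "nest m (half a d v) = half (nest m a) d v"
  by (auto simp: nest_def half_def fun_eq_iff)

lemma nest_all_comb: "k \<ge> 1 \<Longrightarrow> nest_all m (comb k) = comb (m + k)"
proof -
  assume k: "k \<ge> 1"
  have "map comb_cell [0..<m + (k - 1)] = map comb_cell [0..<m] @ map (\<lambda>i. comb_cell (m + i)) [0..<k - 1]"
    by (rule nth_equalityI) (auto simp: nth_append)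
  then show ?thesis using k by (simp add: nest_all_def comb_def nest_comb comp_def)
qed

lemma swp_shift: "swp (length B + i) (B @ P) = B @ swp i P"
  by (induction B) auto

lemma nest_all_swp: "nest_all m (swp i P) = swp (m + i) (nest_all m P)"
  using swp_shift[of "map comb_cell [0..<m]" i "map (nest m) P"] by (simp add: nest_all_def map_swp)

lemma cell_disj_comb_nest: "n \<ge> 1 \<Longrightarrow> i < m \<Longrightarrow> cell_disj n (comb_cell i) (nest m a)"
  unfolding cell_disj_def incomp_def
  by (intro exI[of _ 0] conjI exI[of _ i]) (auto simp: comb_cell_def nest_def nth_append)

lemma cell_disj_comb_end: "n \<ge> 1 \<Longrightarrow> i < m \<Longrightarrow> cell_disj n (comb_cell i) (comb_end m)"
  unfolding cell_disj_def incomp_def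
  by (intro exI[of _ 0] conjI exI[of _ i]) (auto simp: comb_cell_def comb_end_def nth_append)

lemma cell_disj_comb_disjoint_cells: "n \<ge> 1 \<Longrightarrow> i < j \<Longrightarrow> cell_disj n (comb_cell i) (comb_cell j)"
  unfolding cell_disj_def incomp_def
  by (intro exI[of _ 0] conjI exI[of _ i]) (auto simp: comb_cell_def nth_append)

lemma cell_disj_nest:
  assumes "cell_disj n a b" shows "cell_disj n (nest m a) (nest m b)"
proof -
  obtain d j where d: "d < n" "j < length (a d)" "j < length (b d)" "a d ! j \<noteq> b d ! j"
    using assms by (auto simp: cell_disj_def incomp_def)
  then show ?thesis unfolding cell_disj_def incomp_def
    by (intro exI[of _ d] conjI exI[of _ "if d = 0 then m + j else j"]) (auto simp: nest_def nth_append)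
qed

lemma tiling_nest_all:
  assumes n: "n \<ge> 1" and P: "tiling n P" shows "tiling n (nest_all m P)"
  unfolding tiling_def
proof (intro conjI ballI)
  have c: "tiling n (comb (Suc m))" using tiling_comb n by simp
  have "sorted_wrt (cell_disj n) (map comb_cell [0..<m])"
    unfolding sorted_wrt_map
  proof (rule sorted_wrt_mono_rel[of _ "(<)"])
    show "cell_disj n (comb_cell i) (comb_cell j)" if "i < j" for i j using n that by (rule cell_disj_comb_disjoint_cells)
  qed simp
  moreover have "sorted_wrt (cell_disj n) (map (nest m) P)"
    unfolding sorted_wrt_map
  proof (rule sorted_wrt_mono_rel[of _ "cell_disj n"])
    show "sorted_wrt (cell_disj n) P" using tiling_disjoint_cells[OF P] by (simp add: disjoint_cells_def)
  qed (rule cell_disj_nest)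
  moreover have "cell_disj n a b" if ab: "a \<in> set (map comb_cell [0..<m])" "b \<in> set (map (nest m) P)" for a b
  proof -
    obtain i c where "i < m" "a = comb_cell i" "b = nest m c" using ab by auto
    then show ?thesis using cell_disj_comb_nest[OF n] by simp
  qed
  ultimately have 1: "sorted_wrt (cell_disj n) (nest_all m P)"
    unfolding nest_all_def sorted_wrt_append by blast
  have "wf_cell n (comb_cell i)" for i using n by (auto simp: wf_cell_def comb_cell_def)
  moreover have "wf_cell n (nest m a)" if "a \<in> set P" for a
  proof -
    have "wf_cell n a" using tiling_disjoint_cells[OF P] that by (simp add: disjoint_cells_def)
    then show ?thesis using n by (simp add: wf_cell_def nest_def)
  qed
  ultimately have 2: "\<forall>a\<in>set (nest_all m P). wf_cell n a" by (auto simp: nest_all_def)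
  show "disjoint_cells n (nest_all m P)" unfolding disjoint_cells_def using 1 2 by blast
  fix x assume x: "x \<in> Gamma n"
  show "\<exists>a\<in>set (nest_all m P). x \<in> cone n a"
  proof (cases "x \<in> cone n (comb_end m)")
    case True
    then obtain y where y: "y \<in> Gamma n" "x = prepend_tuple n (comb_end m) y" by (auto simp: cone_def)
    then obtain a where a: "a \<in> set P" "y \<in> cone n a" using tiling_cover[OF P] by blast
    then obtain w where w: "w \<in> Gamma n" "y = prepend_tuple n a w" by (auto simp: cone_def)
    then have "x \<in> cone n (nest m a)" using y by (auto simp: cone_def prepend_nest[symmetric])
    then show ?thesis using a by (auto simp: nest_all_def)
  next
    case False
    then show ?thesis using tiling_cover[OF c x] by (auto simp: nest_all_def comb_Suc')
  qed
qed

lemma length_nest_all [simp]: "length (nest_all m P) = m + length P"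
  by (simp add: nest_all_def)

lemma table_inner_copy:
  assumes n: "n \<ge> 1" and t: "table n g P Q" shows "table n (inner_copy n m g) (nest_all m P) (nest_all m Q)"
proof -
  have "carries n (inner_copy n m g) (comb_cell i) (comb_cell i)" if "i < m" for i
    unfolding carries_def
  proof
    fix w assume w: "w \<in> Gamma n"
    have "prepend_tuple n (comb_cell i) w \<in> cone n (comb_cell i)" using w by (auto simp: cone_def)
    then have "prepend_tuple n (comb_cell i) w \<notin> cone n (comb_end m)"
      using cell_disj_comb_end[OF n that] cone_disjoint_iff by blast
    then show "inner_copy n m g (prepend_tuple n (comb_cell i) w) = prepend_tuple n (comb_cell i) w"
      by (simp add: inner_copy_def)
  qed
  then have 1: "table n (inner_copy n m g) (map comb_cell [0..<m]) (map comb_cell [0..<m])"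
    by (simp add: list_all2_conv_all_nth)
  have "carries n (inner_copy n m g) (nest m a) (nest m b)" if "carries n g a b" for a b
    unfolding carries_def
  proof
    fix w assume w: "w \<in> Gamma n"
    have "prepend_tuple n (nest m a) w \<in> cone n (comb_end m)"
      unfolding prepend_nest cone_def by (rule imageI) simp
    then show "inner_copy n m g (prepend_tuple n (nest m a) w) = prepend_tuple n (nest m b) w"
      using that w by (simp add: inner_copy_def prepend_nest drop_prepend carries_def)
  qed
  then have "table n (inner_copy n m g) (map (nest m) P) (map (nest m) Q)"
    using t by (auto simp: list_all2_map1 list_all2_map2 elim: list_all2_mono)
  then show ?thesis unfolding nest_all_def using 1 by (rule list_all2_appendI[rotated])
qed

lemma inner_copy_ext: "inner_copy n m g \<in> extensional (Gamma n)"
  by (simp add: inner_copy_def)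

lemma inner_copy_tab:
  assumes n: "n \<ge> 1" and "tiling n P" "length P = length Q"
  shows "inner_copy n m (tab n P Q) = tab n (nest_all m P) (nest_all m Q)"
proof (rule table_unique)
  show o: "tiling n (nest_all m P)" using assms tiling_nest_all by blast
  show "table n (inner_copy n m (tab n P Q)) (nest_all m P) (nest_all m Q)" using assms table_inner_copy table_tab by blast
  show "table n (tab n (nest_all m P) (nest_all m Q)) (nest_all m P) (nest_all m Q)" using assms by (intro table_tab o) simp
qed (simp_all add: inner_copy_ext)

lemma inner_copy_closed:
  assumes n: "n \<ge> 1" and g: "g \<in> carrier (nV n)" shows "inner_copy n m g \<in> carrier (nV n)"
proof -
  obtain P Q where PQ: "tiling n P" "tiling n Q" "table n g P Q" using nV_E[OF g] by blast
  have l: "length P = length Q" using table_lengths PQ by blast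
  have "g = tab n P Q" using nV_eq_tab[OF g] PQ by blast
  then show ?thesis using PQ l n by (simp add: inner_copy_tab nV_table tiling_nest_all)
qed

lemma nV_Gamma: "f \<in> carrier (nV n) \<Longrightarrow> x \<in> Gamma n \<Longrightarrow> f x \<in> Gamma n"
  using nV_Bij Bij_imp_funcset by fastforce

lemma inner_copy_mult:
  assumes n: "n \<ge> 1" and g: "g \<in> carrier (nV n)" "h \<in> carrier (nV n)"
  shows "inner_copy n m (g \<otimes>\<^bsub>nV n\<^esub> h) = inner_copy n m g \<otimes>\<^bsub>nV n\<^esub> inner_copy n m h"
proof -
  have "inner_copy n m (compose (Gamma n) g h) = compose (Gamma n) (inner_copy n m g) (inner_copy n m h)"
  proof (rule extensionalityI[of _ "Gamma n"])
    fix x assume x: "x \<in> Gamma n"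
    show "inner_copy n m (compose (Gamma n) g h) x = compose (Gamma n) (inner_copy n m g) (inner_copy n m h) x"
    proof (cases "x \<in> cone n (comb_end m)")
      case True
      let ?y = "h (drop_tuple n (comb_end m) x)"
      have y: "?y \<in> Gamma n" using nV_Gamma g by simp
      then have "prepend_tuple n (comb_end m) ?y \<in> cone n (comb_end m)" by (auto simp: cone_def)
      then show ?thesis using x True y by (simp add: inner_copy_def compose_def drop_prepend)
    qed (use x in \<open>simp add: inner_copy_def compose_def\<close>)
  qed (simp_all add: inner_copy_ext compose_def)
  then show ?thesis using g inner_copy_closed[OF n] by (simp add: nV_mult)
qed

lemma inner_copy_hom: "n \<ge> 1 \<Longrightarrow> group_hom (nV n) (nV n) (inner_copy n m)"
  by (intro group_hom.intro group_hom_axioms.intro group_nV) (auto simp: hom_def inner_copy_closed inner_copy_mult)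

lemma inner_copy_swp_el:
  assumes "n \<ge> 1" "k \<ge> 1" shows "inner_copy n m (swp_el n k i) = swp_el n (m + k) (m + i)"
proof -
  have "tiling n (swp i (comb k))" using tiling_comb assms tiling_mset[of n "comb k" "swp i (comb k)"] by simp
  then show ?thesis using assms by (simp add: swp_el_def inner_copy_tab nest_all_swp nest_all_comb)
qed

text \<open>
  The copy of a split, which acts on the last three cells of a list, splits the cell in front of the last
  two.
\<close>

lemma inner_copy_split_chart:
  assumes n: "n \<ge> 1" and d: "d < n" and P: "tiling n (B @ a # Y)" "length B = m" "length Y = 2"
  shows "inner_copy n m (split_el n d) \<otimes>\<^bsub>nV n\<^esub> chart n (B @ a # Y) = chart n (B @ half a d False # half a d True # Y)"
proof -
  let ?P = "B @ a # Y" and ?Q = "B @ half a d False # half a d True # Y"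
  let ?C = "map comb_cell [0..<m]" and ?E = "[comb_cell (m + 1), comb_end (m + 2)]"
  let ?c = "comb_cell m"
  let ?S = "?C @ half ?c d False # half ?c d True # ?E"
  have c3: "tiling n (comb 3)" "tiling n (comb (m + 3))" "tiling n (comb (m + 4))" using tiling_comb n by auto
  have C: "comb (m + 3) = ?C @ ?c # ?E"
    using nest_all_comb[of 3 m] by (simp add: nest_all_def comb_numerals nest_comb)
  have S: "nest_all m (run [Spl d] (comb 3)) = ?S"
    by (simp add: nest_all_def comb_numerals nest_comb nest_half)
  have o3: "tiling n (run [Spl d] (comb 3))" using tiling_run[OF c3(1), of "[Spl d]"] d by simp
  have oS: "tiling n ?S" using tiling_nest_all[OF n o3, of m] S by simp
  have oQ: "tiling n ?Q"
  proof -
    have "tiling n (a # B @ Y)" using P(1) by (rule tiling_mset) simp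
    then have "tiling n (half a d False # half a d True # B @ Y)" using tiling_half d by blast
    then show ?thesis by (rule tiling_mset) simp
  qed
  have "inner_copy n m (split_el n d) = tab n ?S (comb (m + 4))"
    unfolding split_el_def using inner_copy_tab[OF n o3, of "comb 4" m] length_run[of n "comb 3" "[Spl d]"] d S
    by (simp add: nest_all_comb del: run.simps)
  moreover have "chart n ?P = tab n ?Q ?S"
  proof -
    have "table n (chart n ?P) (B @ a # Y) (?C @ ?c # ?E)"
      using table_tab[OF P(1), of "comb (m + 3)"] P C by (simp add: chart_def)
    then have "table n (chart n ?P) ?Q ?S"
      using P d by (simp add: list_all2_append list_all2_Cons carries_half)
    then show ?thesis by (intro nV_eq_tab chart_closed n P(1) oQ)
  qed
  ultimately show ?thesis
    using tab_mult[OF oQ oS c3(3)] P by (simp add: chart_def)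
qed

section \<open>Rotating the cells of a comb\<close>

definition rotation :: "nat \<Rightarrow> nat \<Rightarrow> (nat \<Rightarrow> nat \<Rightarrow> bool) \<Rightarrow> nat \<Rightarrow> nat \<Rightarrow> bool" where
  "rotation n N = tab n (rotate1 (comb N)) (comb N)"

lemma table_rotate1: "table n f P Q \<Longrightarrow> table n f (rotate1 P) (rotate1 Q)"
  by (cases P; cases Q) (auto intro: list_all2_appendI)

lemma mset_rotate: "mset (rotate j P) = mset P"
proof (induction j)
  case (Suc j)
  have "mset (rotate1 Q) = mset Q" for Q :: "'a list" by (cases Q) auto
  then show ?case using Suc by simp
qed simp

lemma tiling_rotate: "tiling n P \<Longrightarrow> tiling n (rotate j P)"
  by (erule tiling_mset) (simp add: mset_rotate)

lemma rotation_closed: "n \<ge> 1 \<Longrightarrow> N \<ge> 1 \<Longrightarrow> rotation n N \<in> carrier (nV n)"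
  unfolding rotation_def using tiling_comb tiling_rotate[of n "comb N" 1] by (intro nV_table) auto

lemma rotation_chart:
  assumes n: "n \<ge> 1" and P: "tiling n P" "length P = N"
  shows "rotation n N \<otimes>\<^bsub>nV n\<^esub> chart n P = chart n (rotate1 P)"
proof -
  have N: "N \<ge> 1" using tiling_nonempty P by blast
  have c: "tiling n (comb N)" "tiling n (rotate1 (comb N))" "tiling n (rotate1 P)"
    using tiling_comb n N P tiling_rotate[of n "comb N" 1] tiling_rotate[of n P 1] by auto
  have "table n (chart n P) (rotate1 P) (rotate1 (comb N))"
    using table_tab[OF P(1), of "comb N"] P N by (intro table_rotate1) (simp add: chart_def)
  then have "chart n P = tab n (rotate1 P) (rotate1 (comb N))"
    using nV_eq_tab chart_closed[OF n P(1)] c by blast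
  then show ?thesis using tab_mult[OF c(3,2,1)] P N by (simp add: rotation_def chart_def)
qed

lemma rotation_pow:
  assumes n: "n \<ge> 1" and N: "N \<ge> 1"
  shows "rotation n N [^]\<^bsub>nV n\<^esub> (j::nat) = chart n (rotate j (comb N))"
proof (induction j)
  interpret nV: group "nV n" by (rule group_nV)
  case 0
  then show ?case using chart_comb n N by simp
next
  interpret nV: group "nV n" by (rule group_nV)
  case (Suc j)
  have "rotation n N [^]\<^bsub>nV n\<^esub> Suc j = rotation n N \<otimes>\<^bsub>nV n\<^esub> rotation n N [^]\<^bsub>nV n\<^esub> j"
    using nV.nat_pow_Suc2 rotation_closed[OF n N] by blast
  then show ?case using Suc rotation_chart[OF n, of "rotate j (comb N)" N] tiling_rotate tiling_comb n N by simp
qed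

lemma rotation_order: "n \<ge> 1 \<Longrightarrow> N \<ge> 1 \<Longrightarrow> rotation n N [^]\<^bsub>nV n\<^esub> N = \<one>\<^bsub>nV n\<^esub>"
  using rotation_pow[of n N N] chart_comb[of n N] rotate_id[of N "comb N"] by simp

text \<open>
  The support of the copy inside \<open>comb_end (N - 2)\<close> consists of the last two cells that
  \<open>rotation n N\<close> permutes.
\<close>

lemma cone_comb_end:
  assumes n: "n \<ge> 1" and N: "N \<ge> 2"
  shows "cone n (comb_end (N - 2)) = cone n (comb N ! (N - 2)) \<union> cone n (comb N ! (N - 1))"
proof -
  obtain m where m: "N = Suc (Suc m)" using N by (metis add_2_eq_Suc le_Suc_ex)
  have c: "comb N ! (N - 2) = half (comb_end m) 0 False" "comb N ! (N - 1) = half (comb_end m) 0 True"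
    by (simp_all add: m comb_Suc nth_append)
  have sub: "cone n (half (comb_end m) 0 v) \<subseteq> cone n (comb_end m)" for v
    using n by (auto simp: cone_def prepend_half Gamma_def PiE_iff extensional_def intro!: imageI)
  have "x \<in> cone n (half (comb_end m) 0 False) \<union> cone n (half (comb_end m) 0 True)" if "x \<in> cone n (comb_end m)" for x
    using cone_half[of 0 n x "comb_end m"] n that by (cases "x 0 (length (comb_end m 0))") auto
  then show ?thesis using sub c m by auto
qed

lemma rotation_moves_end:
  assumes n: "n \<ge> 1" and N: "N \<ge> 4" and j: "2 \<le> j" "j \<le> N - 2" and x: "x \<in> cone n (comb_end (N - 2))"
  shows "(rotation n N [^]\<^bsub>nV n\<^esub> j) x \<notin> cone n (comb_end (N - 2))"
proof -
  let ?C = "comb N"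
  have o: "tiling n ?C" using tiling_comb n N by simp
  have t: "table n (rotation n N [^]\<^bsub>nV n\<^esub> j) (rotate j ?C) ?C"
    using rotation_pow[OF n, of N j] table_tab[OF tiling_rotate[OF o, of j], of ?C] N by (simp add: chart_def)
  obtain a where a: "a < N" "N - 2 \<le> a" "x \<in> cone n (?C ! a)"
    using x cone_comb_end[OF n, of N] N that[of "N - 2"] that[of "N - 1"] by auto
  have i: "a - j < N" "rotate j ?C ! (a - j) = ?C ! a"
    using nth_rotate[of "a - j" ?C j] a j N by auto
  then have "carries n (rotation n N [^]\<^bsub>nV n\<^esub> j) (?C ! a) (?C ! (a - j))"
    using t N by (auto simp: list_all2_conv_all_nth)
  then have y: "(rotation n N [^]\<^bsub>nV n\<^esub> j) x \<in> cone n (?C ! (a - j))"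
    using a(3) by (auto simp: carries_def cone_def)
  show ?thesis
  proof
    assume "(rotation n N [^]\<^bsub>nV n\<^esub> j) x \<in> cone n (comb_end (N - 2))"
    then obtain b where b: "b < N" "N - 2 \<le> b" "(rotation n N [^]\<^bsub>nV n\<^esub> j) x \<in> cone n (?C ! b)"
      using cone_comb_end[OF n, of N] N that[of "N - 2"] that[of "N - 1"] by auto
    have "b = a - j" using tiling_unique[OF o _ _ b(3) y] b i N by auto
    then show False using a b j by linarith
  qed
qed

lemma disjoint_commute:
  assumes y: "y \<in> carrier (nV n)" and k: "k \<in> carrier (nV n)"
    and yD: "\<And>x. x \<in> Gamma n \<Longrightarrow> x \<in> D \<Longrightarrow> y x = x" and kD: "\<And>x. x \<in> Gamma n \<Longrightarrow> x \<notin> D \<Longrightarrow> k x = x"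
  shows "y \<otimes>\<^bsub>nV n\<^esub> k = k \<otimes>\<^bsub>nV n\<^esub> y"
proof -
  have inj: "inj_on y (Gamma n)" "inj_on k (Gamma n)" using nV_Bij[OF y] nV_Bij[OF k] by (auto simp: Bij_def bij_betw_def)
  have "compose (Gamma n) y k = compose (Gamma n) k y"
  proof (rule extensionalityI[of _ "Gamma n"])
    fix x assume x: "x \<in> Gamma n"
    have G: "y x \<in> Gamma n" "k x \<in> Gamma n" using nV_Gamma y k x by auto
    show "compose (Gamma n) y k x = compose (Gamma n) k y x"
    proof (cases "x \<in> D")
      case True
      have "k x \<in> D"
      proof (rule ccontr)
        assume "k x \<notin> D"
        then have "k (k x) = k x" using kD G by blast
        then have "k x = x" using inj(2) G x by (simp add: inj_on_eq_iff)
        then show False using True \<open>k x \<notin> D\<close> by simp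
      qed
      then show ?thesis using True x yD G by (simp add: compose_def)
    next
      case False
      have "y x \<notin> D"
      proof
        assume "y x \<in> D"
        then have "y (y x) = y x" using yD G by blast
        then have "y x = x" using inj(1) G x by (simp add: inj_on_eq_iff)
        then show False using False \<open>y x \<in> D\<close> by simp
      qed
      then show ?thesis using False x kD G by (simp add: compose_def)
    qed
  qed (simp_all add: compose_def)
  then show ?thesis using y k by (simp add: nV_mult)
qed

text \<open>
  The conjugate is supported where the rotation moves the last two cells, and this is disjoint from them.
\<close>

lemma inner_copy_far_commute:
  assumes n: "n \<ge> 1" and N: "N \<ge> 4" and j: "2 \<le> j" "j \<le> N - 2"
    and g: "g \<in> carrier (nV n)" "h \<in> carrier (nV n)"
  defines "z \<equiv> rotation n N [^]\<^bsub>nV n\<^esub> (j::nat)"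
  shows "(z \<otimes>\<^bsub>nV n\<^esub> inner_copy n (N - 2) g \<otimes>\<^bsub>nV n\<^esub> inv\<^bsub>nV n\<^esub> z) \<otimes>\<^bsub>nV n\<^esub> inner_copy n (N - 2) h
    = inner_copy n (N - 2) h \<otimes>\<^bsub>nV n\<^esub> (z \<otimes>\<^bsub>nV n\<^esub> inner_copy n (N - 2) g \<otimes>\<^bsub>nV n\<^esub> inv\<^bsub>nV n\<^esub> z)"
proof -
  interpret nV: group "nV n" by (rule group_nV)
  let ?m = "N - 2" and ?D = "cone n (comb_end (N - 2))"
  let ?y = "z \<otimes>\<^bsub>nV n\<^esub> inner_copy n ?m g \<otimes>\<^bsub>nV n\<^esub> inv\<^bsub>nV n\<^esub> z"
  have z: "z \<in> carrier (nV n)" using rotation_closed[OF n, of N] N by (simp add: z_def)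
  have l: "inner_copy n ?m g \<in> carrier (nV n)" "inner_copy n ?m h \<in> carrier (nV n)" using inner_copy_closed[OF n] g by auto
  have y: "?y \<in> carrier (nV n)" using z l by simp
  have yz: "compose (Gamma n) ?y z = compose (Gamma n) z (inner_copy n ?m g)"
    using y z l by (simp flip: nV_mult add: nV.m_assoc)
  have out: "inner_copy n ?m f x = x" if "x \<in> Gamma n" "x \<notin> ?D" for f x using that by (simp add: inner_copy_def)
  show ?thesis
  proof (rule disjoint_commute[OF y l(2), of ?D])
    fix x assume x: "x \<in> Gamma n" "x \<in> ?D"
    have "z ` Gamma n = Gamma n" using nV_Bij[OF z] by (simp add: Bij_def bij_betw_def)
    then obtain u where u: "u \<in> Gamma n" "z u = x" using x(1) by (metis imageE)
    have "u \<notin> ?D" using rotation_moves_end[OF n N j, of u] x u by (auto simp: z_def)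
    then have "inner_copy n ?m g u = u" using out u by blast
    moreover have "?y (z u) = z (inner_copy n ?m g u)" using fun_cong[OF yz, of u] u by (simp add: compose_def)
    ultimately show "?y x = x" using u by simp
  qed (rule out)
qed

lemma (in group) int_pow_mod:
  assumes z: "z \<in> carrier G" and N: "z [^] (N::nat) = \<one>" "N \<ge> 1"
  shows "z [^] (r::int) = z [^] nat (r mod int N)"
proof -
  have "z [^] r = z [^] (int N * (r div int N) + r mod int N)" by simp
  also have "\<dots> = z [^] (int N * (r div int N)) \<otimes> z [^] (r mod int N)" using z by (rule int_pow_mult)
  also have "z [^] (int N * (r div int N)) = (z [^] int N) [^] (r div int N)" using z by (simp add: int_pow_pow)
  also have "z [^] int N = \<one>" using N by (simp add: int_pow_int)
  also have "z [^] (r mod int N) = z [^] nat (r mod int N)" using N(2) by (subst int_pow_int[symmetric]) simp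
  finally show ?thesis using z by simp
qed

lemma inner_copy_far_commute_int:
  assumes n: "n \<ge> 1" and N: "N \<ge> 4" and r: "2 \<le> \<bar>r\<bar>" "\<bar>r\<bar> \<le> int N - 2"
    and g: "g \<in> carrier (nV n)" "h \<in> carrier (nV n)"
  shows "group.comm (nV n) (group.conj_pow (nV n) (rotation n N) r (inner_copy n (N - 2) g)) (inner_copy n (N - 2) h)"
proof -
  interpret nV: group "nV n" by (rule group_nV)
  let ?j = "nat (r mod int N)"
  have "r mod int N = (if r < 0 then r + int N else r)"
  proof (cases "r < 0")
    case True
    have "(r + int N) mod int N = r + int N" using r True by (intro mod_pos_pos_trivial) auto
    then show ?thesis using True by simp
  next
    case False
    then show ?thesis using r by (simp add: mod_pos_pos_trivial)
  qed
  then have "2 \<le> ?j" "?j \<le> N - 2" using r N by (auto split: if_splits)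
  then show ?thesis
    using inner_copy_far_commute[OF n N _ _ g, of ?j] nV.int_pow_mod[OF rotation_closed[OF n] rotation_order[OF n], of N r] N
    by (simp add: nV.comm_def nV.conj_pow_def)
qed

section \<open>Two generators\<close>

lemma run_swaps_chart:
  assumes n: "n \<ge> 1" and W: "subgroup W (nV n)"
    and swp: "\<And>i. Suc i < k \<Longrightarrow> swp_el n k i \<in> W"
  shows "grow ms = 0 \<Longrightarrow> valid n k ms \<Longrightarrow> tiling n P \<Longrightarrow> length P = k \<Longrightarrow>
    \<exists>w\<in>W. w \<otimes>\<^bsub>nV n\<^esub> chart n P = chart n (run ms P)"
proof (induction ms P rule: run.induct)
  interpret nV: group "nV n" by (rule group_nV)
  interpret W: subgroup W "nV n" by (rule W)
  case (1 P)
  then show ?case using chart_closed[OF n] by (intro bexI[of _ "\<one>\<^bsub>nV n\<^esub>"]) auto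
next
  interpret nV: group "nV n" by (rule group_nV)
  interpret W: subgroup W "nV n" by (rule W)
  case (2 i ms P)
  have "tiling n (swp i P)" using 2 tiling_mset[of n P "swp i P"] by simp
  then obtain w where w: "w \<in> W" "w \<otimes>\<^bsub>nV n\<^esub> chart n (swp i P) = chart n (run ms (swp i P))"
    using 2 by auto
  have s: "swp_el n k i \<in> W" using swp 2 by simp
  have "w \<otimes>\<^bsub>nV n\<^esub> swp_el n k i \<otimes>\<^bsub>nV n\<^esub> chart n P = chart n (run ms (swp i P))"
    using w s 2 chart_closed[OF n, of P] swp_el_chart[OF n, of P i k] by (simp add: nV.m_assoc W.mem_carrier)
  then show ?case using w s by (intro bexI[of _ "w \<otimes>\<^bsub>nV n\<^esub> swp_el n k i"]) auto
qed auto

lemma rearrange_chart: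
  assumes n: "n \<ge> 1" and W: "subgroup W (nV n)"
    and swp: "\<And>i. Suc i < length P \<Longrightarrow> swp_el n (length P) i \<in> W"
    and P: "tiling n P" "mset P = mset Q"
  shows "\<exists>w\<in>W. w \<otimes>\<^bsub>nV n\<^esub> chart n P = chart n Q"
proof -
  obtain ms where "grow ms = 0" "valid n (length P) ms" "run ms P = Q" using rearrange[OF P(2)] by blast
  then show ?thesis using run_swaps_chart[OF n W swp, of ms P] P by auto
qed

lemma rotate_chart:
  assumes n: "n \<ge> 1" and P: "tiling n P"
  shows "rotation n (length P) [^]\<^bsub>nV n\<^esub> (j::nat) \<otimes>\<^bsub>nV n\<^esub> chart n P = chart n (rotate j P)"
proof (induction j)
  interpret nV: group "nV n" by (rule group_nV)
  case 0
  then show ?case using chart_closed[OF n P] by simp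
next
  interpret nV: group "nV n" by (rule group_nV)
  case (Suc j)
  have z: "rotation n (length P) \<in> carrier (nV n)" using rotation_closed[OF n tiling_nonempty[OF P]] .
  have "rotation n (length P) [^]\<^bsub>nV n\<^esub> Suc j = rotation n (length P) \<otimes>\<^bsub>nV n\<^esub> rotation n (length P) [^]\<^bsub>nV n\<^esub> j"
    using nV.nat_pow_Suc2[OF z] .
  then show ?case using Suc z chart_closed[OF n P] rotation_chart[OF n tiling_rotate[OF P, of j], of "length P"]
    by (simp add: nV.m_assoc)
qed

text \<open>
  The copy contains the exchanges of the last cells, and rotating the comb makes them exchanges at every
  position. With all exchanges available, a split of the first cell is the split, in the copy, of the cell
  in front of the last two, between two rearrangements. This works for long combs only. The exchange of
  the last two cells of a short comb is the conjugate, by splits, of that of a long one.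
\<close>

lemma cycle_and_copy_generate:
  assumes n: "n \<ge> 1" and N: "N \<ge> 4" and W: "subgroup W (nV n)" and z: "rotation n N \<in> W"
    and inner_copy: "\<And>g. g \<in> carrier (nV n) \<Longrightarrow> inner_copy n (N - 2) g \<in> W"
  shows "carrier (nV n) \<subseteq> W"
proof -
  interpret nV: group "nV n" by (rule group_nV)
  interpret W: subgroup W "nV n" by (rule W)
  let ?m = "N - 2"
  have high: "swp_el n k i \<in> W" if "?m \<le> i" "Suc i < k" for k i
  proof -
    have "swp_el n k i = inner_copy n ?m (swp_el n (k - ?m) (i - ?m))"
      using inner_copy_swp_el[OF n, of "k - ?m" ?m "i - ?m"] that by simp
    then show ?thesis using inner_copy swp_el_closed[OF n] that by simp
  qed
  have zpow: "rotation n N [^]\<^bsub>nV n\<^esub> (j::nat) \<in> W" for j using z by (induction j) auto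
  have low: "swp_el n N i \<in> W" if i: "i < ?m" for i
  proof -
    let ?C = "comb N"
    have C: "tiling n ?C" "length ?C = N" using tiling_comb n N by auto
    define A B where "A = take i ?C" and "B = drop (i + 2) ?C"
    define x y where "x = ?C ! i" and "y = ?C ! (i + 1)"
    have lA: "length A = i" using i C(2) by (simp add: A_def)
    have "drop i ?C = x # drop (Suc i) ?C"
      using i C(2) unfolding x_def by (intro Cons_nth_drop_Suc[symmetric]) simp
    moreover have "drop (Suc i) ?C = y # B"
      using i C(2) Cons_nth_drop_Suc[of "Suc i" ?C] by (simp add: y_def B_def)
    moreover have "?C = A @ drop i ?C" by (simp add: A_def)
    ultimately have dec: "?C = A @ [x, y] @ B" by simp
    have lB: "length (B @ A) = N - 2" using i C(2) by (simp add: A_def B_def)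
    let ?P1 = "B @ A @ [x, y]" and ?P2 = "B @ A @ [y, x]" and ?P3 = "A @ [y, x] @ B"
    have r1: "rotate (i + 2) ?C = ?P1" using rotate_append[of "A @ [x, y]" B] lA by (simp add: dec)
    have s: "swp ?m ?P1 = ?P2" using swp_shift[of "B @ A" 0 "[x, y]"] lB by simp
    have r2: "rotate (length B) ?P2 = ?P3" using rotate_append[of B "A @ [y, x]"] by simp
    have s3: "swp i ?C = ?P3" using swp_shift[of A 0 "[x, y] @ B"] lA by (simp add: dec)
    have o: "tiling n ?P1" "tiling n ?P2" "length ?P1 = N" "length ?P2 = N"
    proof -
      show P1: "tiling n ?P1" using tiling_rotate[OF C(1), of "i + 2"] by (simp only: r1)
      then show "tiling n ?P2" by (rule tiling_mset) simp
      show "length ?P1 = N" "length ?P2 = N" using lB N by simp_all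
    qed
    have "rotation n N [^]\<^bsub>nV n\<^esub> (i + 2) \<otimes>\<^bsub>nV n\<^esub> chart n ?C = chart n ?P1"
      using rotate_chart[OF n C(1), of "i + 2"] C(2) r1 by simp
    moreover have "swp_el n N ?m \<otimes>\<^bsub>nV n\<^esub> chart n ?P1 = chart n ?P2"
      using swp_el_chart[OF n o(1), of ?m N] o(3) s N by simp
    moreover have "rotation n N [^]\<^bsub>nV n\<^esub> length B \<otimes>\<^bsub>nV n\<^esub> chart n ?P2 = chart n (swp i ?C)"
      using rotate_chart[OF n o(2), of "length B"] o(4) r2 s3 by simp
    ultimately have "rotation n N [^]\<^bsub>nV n\<^esub> length B \<otimes>\<^bsub>nV n\<^esub> (swp_el n N ?m \<otimes>\<^bsub>nV n\<^esub>
        (rotation n N [^]\<^bsub>nV n\<^esub> (i + 2) \<otimes>\<^bsub>nV n\<^esub> chart n ?C)) = chart n (swp i ?C)"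
      by simp
    also have "chart n (swp i ?C) = swp_el n N i"
      using swp_el_chart[OF n C(1), of i N] C(2) i chart_comb[OF n, of N] swp_el_closed[OF n, of N i] N by simp
    finally have "swp_el n N i = rotation n N [^]\<^bsub>nV n\<^esub> length B \<otimes>\<^bsub>nV n\<^esub> (swp_el n N ?m \<otimes>\<^bsub>nV n\<^esub> rotation n N [^]\<^bsub>nV n\<^esub> (i + 2))"
      using chart_comb[OF n, of N] N zpow[of "i + 2"] W.mem_carrier by simp
    moreover have "swp_el n N ?m \<in> W" using N by (intro high) auto
    ultimately show ?thesis using zpow W.m_closed by metis
  qed
  have swpW: "swp_el n k i \<in> W" if "k \<ge> N" "Suc i < k" for k i
  proof (cases "?m \<le> i")
    case True
    then show ?thesis using that(2) by (rule high)
  next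
    case False
    then have "i < ?m" "i + 2 < N" by linarith+
    then show ?thesis using low swp_el_ge[OF n _ that(1), of i] by simp
  qed
  have splitW: "split_el n d \<in> W" if d: "d < n" for d
  proof -
    let ?k = "?m + 3"
    obtain Y0 where Y0: "comb ?k = comb_cell 0 # Y0" "length Y0 = ?m + 2" using comb_Cons[of ?k] by auto
    define B Y where "B = take ?m Y0" and "Y = drop ?m Y0"
    have BY: "Y0 = B @ Y" "length B = ?m" "length Y = 2" using Y0 by (auto simp: B_def Y_def)
    let ?c = "comb_cell 0"
    let ?P1 = "B @ ?c # Y" and ?P2 = "B @ half ?c d False # half ?c d True # Y"
    let ?P3 = "half ?c d False # half ?c d True # B @ Y"
    have C: "tiling n (comb ?k)" "length (comb ?k) = ?k" using tiling_comb n by auto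
    have o1: "tiling n ?P1" using C(1) by (rule tiling_mset) (simp only: Y0 BY, simp)
    have o3: "tiling n ?P3" using tiling_half[of n ?c "B @ Y" d] C(1) d by (simp add: Y0 BY)
    then have o2: "tiling n ?P2" by (rule tiling_mset) simp
    have m1: "mset (comb ?k) = mset ?P1" unfolding Y0 BY by simp
    have "\<exists>w\<in>W. w \<otimes>\<^bsub>nV n\<^esub> chart n (comb ?k) = chart n ?P1"
      by (rule rearrange_chart[OF n W _ C(1) m1], rule swpW) (use C(2) N in auto)
    then obtain w1 where w1: "w1 \<in> W" "w1 \<otimes>\<^bsub>nV n\<^esub> chart n (comb ?k) = chart n ?P1" by blast
    have w2: "inner_copy n ?m (split_el n d) \<otimes>\<^bsub>nV n\<^esub> chart n ?P1 = chart n ?P2"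
      using inner_copy_split_chart[OF n d o1 BY(2,3)] .
    have m3: "mset ?P2 = mset ?P3" by simp
    have "\<exists>w\<in>W. w \<otimes>\<^bsub>nV n\<^esub> chart n ?P2 = chart n ?P3"
      by (rule rearrange_chart[OF n W _ o2 m3], rule swpW) (use BY(2,3) N in auto)
    then obtain w3 where w3: "w3 \<in> W" "w3 \<otimes>\<^bsub>nV n\<^esub> chart n ?P2 = chart n ?P3" by blast
    have lW: "inner_copy n ?m (split_el n d) \<in> W" using inner_copy split_el_closed[OF n d] by blast
    have "w3 \<otimes>\<^bsub>nV n\<^esub> (inner_copy n ?m (split_el n d) \<otimes>\<^bsub>nV n\<^esub> (w1 \<otimes>\<^bsub>nV n\<^esub> chart n (comb ?k))) = chart n ?P3"
      using w1 w2 w3 by simp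
    moreover have "split_el n d \<otimes>\<^bsub>nV n\<^esub> chart n (comb ?k) = chart n ?P3"
      using split_el_chart[OF n C(1) _ d] C(2) by (simp add: Y0 BY)
    ultimately have eq: "split_el n d = w3 \<otimes>\<^bsub>nV n\<^esub> (inner_copy n ?m (split_el n d) \<otimes>\<^bsub>nV n\<^esub> w1)"
      using chart_comb[OF n, of ?k] w1 split_el_closed[OF n d] W.mem_carrier by simp
    show ?thesis by (subst eq) (intro W.m_closed w1(1) w3(1) lW)
  qed
  have S: "swp_el n (k + 2) k \<in> W" if "1 \<le> k" for k
  proof (cases "k \<le> N")
    case True
    then show ?thesis
    proof (induction rule: inc_induct)
      case base
      show ?case using swpW[of "N + 2" N] by simp
    next
      case (step j)
      have j: "1 \<le> j" using step that by simp
      have "split_el n 0 \<otimes>\<^bsub>nV n\<^esub> swp_el n (j + 2) j = swp_el n (Suc j + 2) (Suc j) \<otimes>\<^bsub>nV n\<^esub> split_el n 0"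
        using split_swp[OF n, of 0 j "j + 2"] n j by simp
      then have "swp_el n (j + 2) j = inv\<^bsub>nV n\<^esub> split_el n 0 \<otimes>\<^bsub>nV n\<^esub> (swp_el n (Suc j + 2) (Suc j) \<otimes>\<^bsub>nV n\<^esub> split_el n 0)"
        using split_el_closed[OF n, of 0] swp_el_closed[OF n] n
          nV.inv_solve_left[of "swp_el n (j + 2) j" "split_el n 0" "swp_el n (Suc j + 2) (Suc j) \<otimes>\<^bsub>nV n\<^esub> split_el n 0"]
        by simp
      moreover have "split_el n 0 \<in> W" using splitW n by simp
      ultimately show ?case using step.IH W.m_closed W.m_inv_closed by metis
    qed
  next
    case False
    then show ?thesis using swpW by simp
  qed
  have "nV_gen n l \<in> W" if l: "l < n + 3" for l
  proof -
    consider "l = 0" | "l = 1" | "l = 2" | "l \<ge> 3" by linarith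
    then show ?thesis
    proof cases
      case 1
      then show ?thesis using swpW[of N 0] swp_el_ge[OF n, of 0 3 N] N by (simp add: nV_gen_def)
    next
      case 2
      then show ?thesis using swpW[of N 1] swp_el_ge[OF n, of 1 4 N] N by (simp add: nV_gen_def)
    next
      case 3
      then show ?thesis using S[of 1] by (simp add: nV_gen_def numeral_3_eq_3)
    next
      case 4
      then show ?thesis using splitW[of "l - 3"] l by (simp add: nV_gen_def)
    qed
  qed
  then have "nV_gen n ` {..<n + 3} \<subseteq> W" by auto
  then show ?thesis using nV.generate_subgroup_incl[OF _ W] nV_generated[OF n] by blast
qed

text \<open>
  The commutators of the copies lie in the subgroup generated by the rotation and \<open>v\<close>. As
  \<open>inner_copy\<close> is a homomorphism and the commutators of the \<open>h i\<close> generate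
  \<open>nV\<close>, so does the entire copy.
\<close>

theorem nV_two_generated:
  assumes n: "n \<ge> 1"
  obtains u v N where "u \<in> carrier (nV n)" "v \<in> carrier (nV n)" "carrier (nV n) \<subseteq> generate (nV n) {u, v}"
    "N \<ge> 1" "u [^]\<^bsub>nV n\<^esub> (N::nat) = \<one>\<^bsub>nV n\<^esub>"
proof -
  interpret nV: group "nV n" by (rule group_nV)
  have c: "nV_gen n ` {..<n + 3} \<subseteq> carrier (nV n)" using nV_gen_closed[OF n] by auto
  have g: "carrier (nV n) \<subseteq> generate (nV n) (nV_gen n ` {..<n + 3})" using nV_generated[OF n] by (rule subsetI)
  let ?com = "\<lambda>h i j. h i \<otimes>\<^bsub>nV n\<^esub> h j \<otimes>\<^bsub>nV n\<^esub> inv\<^bsub>nV n\<^esub> (h i) \<otimes>\<^bsub>nV n\<^esub> inv\<^bsub>nV n\<^esub> (h j)"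
  have "finite (nV_gen n ` {..<n + 3})" by simp
  from nV.perfect_finite_commutators[OF nV_perfect[OF n] this g c]
  obtain h and p :: nat where hp: "(\<forall>i. h i \<in> carrier (nV n)) \<and>
      carrier (nV n) \<subseteq> generate (nV n) {?com h i j | i j. i < p \<and> j < p \<and> i \<noteq> j}" by (elim exE)
  let ?C = "{?com h i j | i j. i < p \<and> j < p \<and> i \<noteq> j}"
  have h: "h i \<in> carrier (nV n)" for i using hp by simp
  have gen: "carrier (nV n) \<subseteq> generate (nV n) ?C" using hp by (rule conjunct2)
  (* Differences of two differences of positions are bounded by 2 * 4 ^ p. With N this large the
     rotation does not wrap around within that range. *)
  define N :: nat where "N = 4 * 4 ^ p + 4"
  have N: "N \<ge> 4" and N': "2 * 4 ^ p \<le> int N - 2" by (simp_all add: N_def)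
  let ?m = "N - 2"
  let ?z = "rotation n N"
  have z: "?z \<in> carrier (nV n)" using rotation_closed[OF n] N by simp
  define H where "H i = inner_copy n ?m (h i)" for i
  have H: "H i \<in> carrier (nV n)" for i unfolding H_def using inner_copy_closed[OF n h] .
  define v where "v = foldr (\<lambda>k y. nV.conj_pow ?z (4 ^ Suc k) (H k) \<otimes>\<^bsub>nV n\<^esub> y) [0..<p] \<one>\<^bsub>nV n\<^esub>"
  have foldr_closed: "foldr (\<lambda>k y. nV.conj_pow ?z (4 ^ Suc k) (H k) \<otimes>\<^bsub>nV n\<^esub> y) xs \<one>\<^bsub>nV n\<^esub> \<in> carrier (nV n)" for xs
    by (induction xs) (use z H in auto)
  have v: "v \<in> carrier (nV n)" unfolding v_def by (rule foldr_closed)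
  let ?W = "generate (nV n) {?z, v}"
  have W: "subgroup ?W (nV n)" using z v by (intro nV.generate_is_subgroup) auto
  interpret lamh: group_hom "nV n" "nV n" "inner_copy n ?m" by (rule inner_copy_hom[OF n])
  have comm: "H i \<otimes>\<^bsub>nV n\<^esub> H j \<otimes>\<^bsub>nV n\<^esub> inv\<^bsub>nV n\<^esub> (H i) \<otimes>\<^bsub>nV n\<^esub> inv\<^bsub>nV n\<^esub> (H j) \<in> ?W"
    if "i < p" "j < p" "i \<noteq> j" for i j
  proof (rule nV.isolated_commutator[OF z H _ v_def that])
    fix k l and r :: int assume r: "2 \<le> \<bar>r\<bar>" "\<bar>r\<bar> \<le> 2 * 4 ^ p"
    then have "\<bar>r\<bar> \<le> int N - 2" using N' by linarith
    then show "nV.comm (nV.conj_pow ?z r (H k)) (H l)"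
      unfolding H_def by (rule inner_copy_far_commute_int[OF n N r(1) _ h h])
  qed
  have "inner_copy n ?m ` ?C \<subseteq> ?W"
  proof
    fix x assume "x \<in> inner_copy n ?m ` ?C"
    then obtain i j where ij: "i < p" "j < p" "i \<noteq> j"
      and x: "x = inner_copy n ?m (h i \<otimes>\<^bsub>nV n\<^esub> h j \<otimes>\<^bsub>nV n\<^esub> inv\<^bsub>nV n\<^esub> (h i) \<otimes>\<^bsub>nV n\<^esub> inv\<^bsub>nV n\<^esub> (h j))" by auto
    then have "x = H i \<otimes>\<^bsub>nV n\<^esub> H j \<otimes>\<^bsub>nV n\<^esub> inv\<^bsub>nV n\<^esub> (H i) \<otimes>\<^bsub>nV n\<^esub> inv\<^bsub>nV n\<^esub> (H j)"
      using h by (simp add: H_def)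
    then show "x \<in> ?W" using comm[OF ij] by simp
  qed
  then have "generate (nV n) (inner_copy n ?m ` ?C) \<subseteq> ?W" by (rule nV.generate_subgroup_incl[OF _ W])
  moreover have "?C \<subseteq> carrier (nV n)" using h by auto
  then have "generate (nV n) (inner_copy n ?m ` ?C) = inner_copy n ?m ` generate (nV n) ?C" by (rule lamh.generate_img)
  ultimately have sub: "inner_copy n ?m ` generate (nV n) ?C \<subseteq> ?W" by (simp only:)
  have "carrier (nV n) \<subseteq> ?W"
  proof (rule cycle_and_copy_generate[OF n N W])
    show "?z \<in> ?W" by (rule generate.incl) simp
    show "inner_copy n ?m g \<in> ?W" if "g \<in> carrier (nV n)" for g
      using subsetD[OF gen that] by (intro subsetD[OF sub] imageI)
  qed
  then show ?thesis using that[of ?z v N] z v rotation_order[OF n] N by simp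
qed

section \<open>The presentation\<close>

abbreviation reduce :: "('x \<times> bool) list \<Rightarrow> ('x \<times> bool) list" where
  "reduce w \<equiv> foldr push_letter w []"

lemma reduce_closed: "set w \<subseteq> X \<times> UNIV \<Longrightarrow> reduce w \<in> carrier (free_group X)"
  using set_foldr_push[of w "[]"] by (auto simp: free_group_def freely_reduced_foldr_push)

lemma (in group) ev_reduce: "(\<And>l. f l \<in> carrier G) \<Longrightarrow> ev G f (reduce w) = ev G f w"
  by (simp add: ev_foldr_push)

lemma (in group) ev_hom: "(\<And>l. f l \<in> carrier G) \<Longrightarrow> ev G f \<in> hom (free_group X) G"
  by (auto simp: hom_def free_group_def ev_foldr_push)

lemma set_inv_word: "set w \<subseteq> X \<times> UNIV \<Longrightarrow> set (inv_word w) \<subseteq> X \<times> UNIV"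
  by (fastforce simp: inv_word_def)

lemma set_subst_word:
  assumes "\<And>l. l \<in> Y \<Longrightarrow> set (s l) \<subseteq> X \<times> UNIV" "set w \<subseteq> Y \<times> UNIV"
  shows "set (subst_word s w) \<subseteq> X \<times> UNIV"
  using assms(2)
proof (induction w)
  case (Cons a w)
  obtain l b where a: "a = (l, b)" by (cases a)
  have "l \<in> Y" using Cons a by auto
  then have "set (s l) \<subseteq> X \<times> UNIV" "set (inv_word (s l)) \<subseteq> X \<times> UNIV"
    using assms(1) set_inv_word[of "s l" X] by auto
  then show ?case using Cons by (cases b) (auto simp: a subst_word_def)
qed (simp add: subst_word_def)

lemma infinite_superset_card:
  assumes "finite A" "A \<subseteq> K" "infinite K" "card A \<le> m"
  obtains B where "A \<subseteq> B" "B \<subseteq> K" "finite B" "card B = m"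
proof -
  have "infinite (K - A)" using assms by simp
  then obtain C where C: "finite C" "card C = m - card A" "C \<subseteq> K - A"
    using infinite_arbitrarily_large by metis
  have "card (A \<union> C) = m" using C assms by (subst card_Un_disjoint) auto
  then show ?thesis using that[of "A \<union> C"] C assms by auto
qed

text \<open>
  The normal closure lies in the kernel of the evaluation since the relators are trivial in
  \<open>U\<close>. For the converse the last hypothesis is applied to the quotient of the free group by
  the normal closure.
\<close>

theorem presentation_criterion:
  fixes U :: "('g, 'm) monoid_scheme" and X :: "'x set"
  assumes U: "group U" and uv: "\<And>x. uv x \<in> carrier U" and gen: "carrier U \<subseteq> generate U (uv ` X)"
    and R: "R \<subseteq> carrier (free_group X)" and triv: "\<And>r. r \<in> R \<Longrightarrow> ev U uv r = \<one>\<^bsub>U\<^esub>"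
    and suff: "\<And>(G :: ('x \<times> bool) list set monoid) q w. group G \<Longrightarrow> (\<And>x. q x \<in> carrier G) \<Longrightarrow>
      (\<And>r. r \<in> R \<Longrightarrow> ev G q r = \<one>\<^bsub>G\<^esub>) \<Longrightarrow> w \<in> carrier (free_group X) \<Longrightarrow> ev U uv w = \<one>\<^bsub>U\<^esub> \<Longrightarrow>
      ev G q w = \<one>\<^bsub>G\<^esub>"
  shows "has_presentation U X R"
proof -
  interpret U: group U by (rule U)
  interpret F: group "free_group X" by (rule group_free_group)
  interpret \<phi>: group_hom "free_group X" U "ev U uv"
    using U.ev_hom[of uv, OF uv] by unfold_locales
  let ?N = "normal_closure (free_group X) R"
  interpret N: normal ?N "free_group X" using normal_normal_closure[OF group_free_group R] .
  let ?Q = "free_group X Mod ?N"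
  interpret Q: group ?Q by (rule N.factorgroup_is_group)
  interpret c: group_hom "free_group X" ?Q "\<lambda>w. ?N #>\<^bsub>free_group X\<^esub> w"
    by (intro group_hom.intro group_hom_axioms.intro N.r_coset_hom_Mod group_free_group Q.is_group)
  let ?K = "kernel (free_group X) U (ev U uv)"
  have NK: "?N \<subseteq> ?K"
    unfolding normal_closure_def
  proof (rule F.generate_subgroup_incl[OF _ \<phi>.subgroup_kernel])
    show "(\<Union>g\<in>carrier (free_group X). (\<lambda>r. g \<otimes>\<^bsub>free_group X\<^esub> r \<otimes>\<^bsub>free_group X\<^esub> inv\<^bsub>free_group X\<^esub> g) ` R) \<subseteq> ?K"
    proof safe
      fix g r assume g: "g \<in> carrier (free_group X)" and r: "r \<in> R"
      then have rc: "r \<in> carrier (free_group X)" using R by auto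
      show "g \<otimes>\<^bsub>free_group X\<^esub> r \<otimes>\<^bsub>free_group X\<^esub> inv\<^bsub>free_group X\<^esub> g \<in> ?K"
        using g rc triv[OF r] by (simp add: kernel_def)
    qed
  qed
  define q where "q x = (if x \<in> X then ?N #>\<^bsub>free_group X\<^esub> [(x, True)] else \<one>\<^bsub>?Q\<^esub>)" for x
  have letter: "[(x, b)] \<in> carrier (free_group X)" if "x \<in> X" for x b
    using that by (simp add: free_group_def)
  have qc: "q x \<in> carrier ?Q" for x 
    by (cases "x \<in> X") (simp_all only: q_def if_True if_False c.hom_closed letter Q.one_closed)
  have inv_letter: "[(x, False)] = inv\<^bsub>free_group X\<^esub> [(x, True)]" if "x \<in> X" for x
    by (rule F.inv_equality[symmetric]) (use letter that in \<open>simp_all add: free_group_def\<close>)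
  have cos: "?N #>\<^bsub>free_group X\<^esub> reduce w = ev ?Q q w" if "set w \<subseteq> X \<times> UNIV" for w
    using that
  proof (induction w)
    case Nil
    then show ?case using c.hom_one by (simp add: free_group_def)
  next
    case (Cons a w)
    obtain l b where a: "a = (l, b)" by (cases a)
    have l: "l \<in> X" using Cons a by auto
    have w: "reduce w \<in> carrier (free_group X)" using Cons by (intro reduce_closed) auto
    have "reduce (a # w) = [a] \<otimes>\<^bsub>free_group X\<^esub> reduce w" by (simp add: free_group_def)
    then have "?N #>\<^bsub>free_group X\<^esub> reduce (a # w) = (?N #>\<^bsub>free_group X\<^esub> [a]) \<otimes>\<^bsub>?Q\<^esub> ev ?Q q w"
      using Cons c.hom_mult[of "[a]" "reduce w"] w letter[OF l] a by simp
    moreover have "?N #>\<^bsub>free_group X\<^esub> [a] = (if b then q l else inv\<^bsub>?Q\<^esub> q l)"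
      using l a letter[OF l, of True] c.hom_inv[of "[(l, True)]"] by (simp add: q_def inv_letter)
    ultimately show ?case by (simp add: a ev_Cons)
  qed
  have cos': "?N #>\<^bsub>free_group X\<^esub> w = ev ?Q q w" if "w \<in> carrier (free_group X)" for w
    using cos[of w] that foldr_push_Nil[of w] by (simp add: free_group_def)
  have one: "\<one>\<^bsub>?Q\<^esub> = ?N" by (simp add: FactGroup_def)
  have relQ: "ev ?Q q r = \<one>\<^bsub>?Q\<^esub>" if r: "r \<in> R" for r
  proof -
    have rc: "r \<in> carrier (free_group X)" using r R by auto
    have "r \<in> (\<lambda>r. \<one>\<^bsub>free_group X\<^esub> \<otimes>\<^bsub>free_group X\<^esub> r \<otimes>\<^bsub>free_group X\<^esub> inv\<^bsub>free_group X\<^esub> \<one>\<^bsub>free_group X\<^esub>) ` R"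
      using r rc by (intro image_eqI[of _ _ r]) simp_all
    then have "r \<in> ?N"
      unfolding normal_closure_def by (intro generate.incl UN_I[of "\<one>\<^bsub>free_group X\<^esub>"]) simp_all
    then have "?N #>\<^bsub>free_group X\<^esub> r = ?N" using F.coset_join2[OF rc N.subgroup_axioms] by simp
    then show ?thesis using cos'[OF rc] one by simp
  qed
  have KN: "?K \<subseteq> ?N"
  proof
    fix w assume "w \<in> ?K"
    then have w: "w \<in> carrier (free_group X)" "ev U uv w = \<one>\<^bsub>U\<^esub>" by (auto simp: kernel_def)
    have "ev ?Q q w = \<one>\<^bsub>?Q\<^esub>" using suff[OF Q.is_group qc relQ w] by simp
    then have "?N #>\<^bsub>free_group X\<^esub> w = ?N" using cos'[OF w(1)] one by simp
    then show "w \<in> ?N" using F.rcos_self[OF w(1) N.subgroup_axioms] by simp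
  qed
  have "ev U uv ` carrier (free_group X) = carrier U"
  proof
    show "ev U uv ` carrier (free_group X) \<subseteq> carrier U" by auto
    show "carrier U \<subseteq> ev U uv ` carrier (free_group X)"
    proof
      fix x assume "x \<in> carrier U"
      then obtain w where "set w \<subseteq> X \<times> UNIV" "ev U uv w = x"
        using gen U.generate_eq_ev[of uv x X, OF uv] by blast
      then show "x \<in> ev U uv ` carrier (free_group X)"
        using reduce_closed U.ev_reduce[of uv, OF uv] by (intro image_eqI[of _ _ "reduce w"]) auto
    qed
  qed
  then have "free_group X Mod ?K \<cong> U" by (rule \<phi>.FactGroup_iso)
  moreover have "?K = ?N" using NK KN by blast
  ultimately show ?thesis using R by (simp add: has_presentation_def)
qed

lemma (in group) ev_relator:
  assumes f: "\<And>l. f l \<in> carrier G"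
  shows "ev G f (reduce (subst_word s (a @ inv_word b))) = \<one> \<longleftrightarrow>
    ev G (\<lambda>l. ev G f (s l)) a = ev G (\<lambda>l. ev G f (s l)) b"
proof -
  let ?L = "\<lambda>l. ev G f (s l)"
  have L: "?L l \<in> carrier G" for l using f by simp
  have "ev G f (reduce (subst_word s (a @ inv_word b))) = ev G ?L a \<otimes> inv (ev G ?L b)"
    using f L by (simp add: ev_reduce ev_subst ev_append ev_inv_word)
  then show ?thesis using L by (simp add: inv_solve_right')
qed

text \<open>
  This relator says that the letter \<open>x\<close> equals the word \<open>a\<close> in the letters that
  \<open>s\<close> defines.
\<close>

lemma (in group) ev_definition:
  assumes f: "\<And>l. f l \<in> carrier G"
  shows "ev G f (reduce ([(x, True)] @ inv_word (subst_word s a))) = \<one> \<longleftrightarrow> f x = ev G (\<lambda>l. ev G f (s l)) a"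
proof -
  let ?L = "\<lambda>l. ev G f (s l)"
  have L: "?L l \<in> carrier G" for l using f by simp
  have "ev G f (reduce ([(x, True)] @ inv_word (subst_word s a))) = f x \<otimes> inv (ev G ?L a)"
    unfolding ev_reduce[of f, OF f] ev_append[of f, OF f] ev_inv_word[of f, OF f] ev_subst[of f, OF f]
    using f by (simp add: ev_Cons)
  then show ?thesis using f L by (simp add: inv_solve_right')
qed

theorem corollary1p3:
  fixes n :: nat
  assumes "n \<ge> 2"
  shows "\<exists>(X :: nat set) R.
           finite X \<and> card X = 2 \<and>
           finite R \<and> card R = 2 * n^2 + 3 * n + 13 \<and>
           has_presentation (nV n) X R"
proof -
  have n: "n \<ge> 1" using assms by simp
  interpret U: group "nV n" by (rule group_nV)
  obtain u v N where uv_closed: "u \<in> carrier (nV n)" "v \<in> carrier (nV n)"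
    and uv_gen: "carrier (nV n) \<subseteq> generate (nV n) {u, v}"
    and N: "N \<ge> 1" "u [^]\<^bsub>nV n\<^esub> (N::nat) = \<one>\<^bsub>nV n\<^esub>"
    by (rule nV_two_generated[OF n])
  define X :: "nat set" where "X = {0, 1}"
  define uv where "uv l = (if l = (0::nat) then u else v)" for l
  have uv: "uv l \<in> carrier (nV n)" for l using uv_closed by (simp add: uv_def)
  have img: "uv ` X = {u, v}" by (auto simp: uv_def X_def)
  have "\<exists>w. set w \<subseteq> X \<times> UNIV \<and> ev (nV n) uv w = nV_gen n l" for l
    using uv_gen nV_gen_closed[OF n] img by (intro U.generate_eq_ev[of uv, OF uv]) auto
  then obtain wl where wl: "\<And>l. set (wl l) \<subseteq> X \<times> UNIV" "\<And>l. ev (nV n) uv (wl l) = nV_gen n l" by metis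
  have "\<exists>w. set w \<subseteq> {..<n + 3} \<times> UNIV \<and> ev (nV n) (nV_gen n) w = uv x" for x
    using nV_generated[OF n uv] by (rule U.generate_eq_ev[of "nV_gen n", OF nV_gen_closed[OF n]])
  then obtain al where al: "\<And>x. set (al x) \<subseteq> {..<n + 3} \<times> UNIV" "\<And>x. ev (nV n) (nV_gen n) (al x) = uv x" by metis
  define rel where "rel = (\<lambda>(k, ms, k', ms'). reduce (subst_word wl (word k ms @ inv_word (word k' ms'))))"
  define def where "def x = reduce ([(x, True)] @ inv_word (subst_word wl (al x)))" for x :: nat
  (* The relations of the letters rewritten by wl in terms of u and v, and the definitions of u and v by
     the words al. *)
  define R0 where "R0 = rel ` set (rels n) \<union> def ` X"
  let ?K = "{w \<in> carrier (free_group X). ev (nV n) uv w = \<one>\<^bsub>nV n\<^esub>}"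
  have "R0 \<subseteq> ?K"
  proof
    fix r assume "r \<in> R0"
    then consider k ms k' ms' where "(k, ms, k', ms') \<in> set (rels n)" "r = rel (k, ms, k', ms')"
      | x where "x \<in> X" "r = def x"
      by (auto simp: R0_def)
    then show "r \<in> ?K"
    proof cases
      case 1
      have "set (word k ms @ inv_word (word k' ms')) \<subseteq> {..<n + 3} \<times> UNIV"
        using valid_rels[OF n 1(1)] set_word[OF n] set_inv_word[of "word k' ms'"] by simp
      then have "set (subst_word wl (word k ms @ inv_word (word k' ms'))) \<subseteq> X \<times> UNIV"
        using wl(1) by (rule set_subst_word[rotated])
      then have "r \<in> carrier (free_group X)" unfolding 1(2) rel_def using reduce_closed by auto
      moreover have "ev (nV n) uv r = \<one>\<^bsub>nV n\<^esub>"
        using rels_nV[OF n 1(1)] wl(2) unfolding 1(2) rel_def by (simp add: U.ev_relator[of uv, OF uv])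
      ultimately show ?thesis by simp
    next
      case 2
      have "set (inv_word (subst_word wl (al x))) \<subseteq> X \<times> UNIV"
        by (intro set_inv_word set_subst_word[OF wl(1) al(1)])
      then have "set ([(x, True)] @ inv_word (subst_word wl (al x))) \<subseteq> X \<times> UNIV" using 2 by auto
      then have "r \<in> carrier (free_group X)" unfolding 2(2) def_def by (rule reduce_closed)
      moreover have "ev (nV n) uv r = \<one>\<^bsub>nV n\<^esub>"
        using wl(2) al(2) unfolding 2(2) def_def by (simp only: U.ev_definition[of uv, OF uv])
      ultimately show ?thesis by simp
    qed
  qed
  moreover have "finite R0" by (simp add: R0_def X_def)
  (* The kernel contains the powers of the N-th power of the first letter. *)
  moreover have "infinite ?K"
  proof -
    define p where "p j = replicate (N * j) (0::nat, True)" for j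
    have "successively (\<lambda>a b. b \<noteq> inv_letter a) (replicate m (0::nat, True))" for m
      by (induction m) (auto simp: successively_Cons)
    then have "p j \<in> carrier (free_group X)" for j
      by (auto simp: p_def free_group_def freely_reduced_def X_def)
    moreover have "ev (nV n) uv (p j) = \<one>\<^bsub>nV n\<^esub>" for j
    proof -
      have "ev (nV n) uv (replicate m (0, True)) = u [^]\<^bsub>nV n\<^esub> m" for m
        using uv_closed U.nat_pow_Suc2[of u] by (induction m) (simp_all add: ev_Cons uv_def)
      then have "ev (nV n) uv (p j) = u [^]\<^bsub>nV n\<^esub> (N * j)" by (simp add: p_def)
      also have "\<dots> = (u [^]\<^bsub>nV n\<^esub> N) [^]\<^bsub>nV n\<^esub> j" using U.nat_pow_pow[OF uv_closed(1)] by simp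
      finally show ?thesis using N(2) by simp
    qed
    ultimately have "range p \<subseteq> ?K" by auto
    moreover have "inj p"
    proof (rule injI)
      fix i j assume "p i = p j"
      then have "length (p i) = length (p j)" by simp
      then show "i = j" using N(1) by (simp add: p_def)
    qed
    then have "infinite (range p)" by (rule range_inj_infinite)
    ultimately show ?thesis by (rule infinite_super)
  qed
  moreover have "card R0 \<le> 2 * n^2 + 3 * n + 13"
  proof -
    have "card R0 \<le> card (rel ` set (rels n)) + card (def ` X)" unfolding R0_def by (rule card_Un_le)
    also have "\<dots> \<le> card (set (rels n)) + card X" by (intro add_mono card_image_le) (simp_all add: X_def)
    also have "\<dots> \<le> length (rels n) + 2" by (intro add_mono card_length) (simp add: X_def)
    also have "\<dots> = n^2 + 4 * n + 14" using length_rels[OF n] by simp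
    also have "\<dots> \<le> 2 * n^2 + 3 * n + 13"
    proof -
      have "2 * n \<le> n * n" using assms by (rule mult_le_mono1)
      then have "n + 1 \<le> n^2" using assms unfolding power2_eq_square by linarith
      then show ?thesis by linarith
    qed
    finally show ?thesis .
  qed
  (* Elements of the kernel do not change the normal closure, so they may be used to reach the
     prescribed number. *)
  ultimately obtain R where R: "R0 \<subseteq> R" "R \<subseteq> ?K" "finite R" "card R = 2 * n^2 + 3 * n + 13"
    using infinite_superset_card[of R0 ?K "2 * n^2 + 3 * n + 13"] by auto
  have "has_presentation (nV n) X R"
  proof (rule presentation_criterion[OF group_nV uv])
    show "carrier (nV n) \<subseteq> generate (nV n) (uv ` X)" using uv_gen img by simp
    show "R \<subseteq> carrier (free_group X)" using R(2) by auto
    show "ev (nV n) uv r = \<one>\<^bsub>nV n\<^esub>" if "r \<in> R" for r using that R(2) by auto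
    fix G :: "(nat \<times> bool) list set monoid" and q w
    assume G: "group G" and q: "\<And>x. q x \<in> carrier G" and relG: "\<And>r. r \<in> R \<Longrightarrow> ev G q r = \<one>\<^bsub>G\<^esub>"
      and w: "w \<in> carrier (free_group X)" "ev (nV n) uv w = \<one>\<^bsub>nV n\<^esub>"
    interpret G: group G by (rule G)
    (* In G the letters are defined as the words wl; they satisfy the relations, and the relators def
       recover the generators from them. *)
    define L where "L l = ev G q (wl l)" for l
    have L: "L l \<in> carrier G" for l using q by (simp add: L_def)
    have "ev G L (word k ms) = ev G L (word k' ms')" if "(k, ms, k', ms') \<in> set (rels n)" for k ms k' ms'
    proof -
      have "rel (k, ms, k', ms') \<in> R" using that R(1) by (auto simp: R0_def)
      then have "ev G q (rel (k, ms, k', ms')) = \<one>\<^bsub>G\<^esub>" by (rule relG)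
      then show ?thesis unfolding rel_def by (simp add: G.ev_relator[of q, OF q] L_def[abs_def])
    qed
    moreover have "set (subst_word al w) \<subseteq> {..<n + 3} \<times> UNIV"
      by (rule set_subst_word[where Y = UNIV]) (use al(1) in auto)
    moreover have "ev (nV n) (nV_gen n) (subst_word al w) = \<one>\<^bsub>nV n\<^esub>"
      using U.ev_subst[of "nV_gen n", OF nV_gen_closed[OF n], of al w] al(2) w(2) by simp
    ultimately have "ev G L (subst_word al w) = \<one>\<^bsub>G\<^esub>" by (intro trivial_word[OF n G L])
    then have "ev G (\<lambda>x. ev G L (al x)) w = \<one>\<^bsub>G\<^esub>" by (simp only: G.ev_subst[of L, OF L])
    moreover have "q x = ev G L (al x)" if "x \<in> X" for x
    proof -
      have "def x \<in> R" using that R(1) by (auto simp: R0_def)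
      then have "ev G q (def x) = \<one>\<^bsub>G\<^esub>" by (rule relG)
      then show ?thesis unfolding def_def by (simp only: G.ev_definition[of q, OF q] L_def[abs_def])
    qed
    then have "ev G q w = ev G (\<lambda>x. ev G L (al x)) w"
      using w(1) by (intro G.ev_cong) (auto simp: free_group_def)
    ultimately show "ev G q w = \<one>\<^bsub>G\<^esub>" by simp
  qed
  moreover have "finite X" "card X = 2" by (simp_all add: X_def)
  ultimately show ?thesis using R by blast
qed

end
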